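(* Let $\mathfrak T$ be a measurable action of an inductively compact group $G$ on a standard Borel space $(X,\mathcal B)$, and let $\nu$ be a $\sigma$-finite $\mathfrak T$-invariant Borel measure on $X$ such that the space $L_1(X,\nu)$ contains a positive Borel measurable fibrewise continuous function. Then there exists a measure class $PCL(\nu)$ on $\mathbb P\mathfrak M^\infty$ with the following properties. (1) For any $\widetilde\nu\in PCL(\nu)$ we have $\widetilde\nu\big(\mathbb P\mathfrak M^\infty\setminus\mathbb P\mathfrak M^\infty_{\mathrm{erg}}(\mathfrak T)\big)=0$. (2) For any admissible ergodic decomposition $\nu=\int_{\mathfrak M^\infty}\eta\,d\overline\nu(\eta)$ of the measure $\nu$ we have $\mathbf p_*\overline\nu\in PCL(\nu)$. (3) Conversely, for any $\sigma$-finite Borel measure $\widetilde\nu\in PCL(\nu)$ there exists a unique admissible $\sigma$-finite Borel measure $\overline\nu$ on $\mathfrak M^\infty$ such that $\mathbf p_*\overline\nu=\widetilde\nu$ and $$\nu=\int_{\mathfrak M^\infty}\eta\,d\overline\nu(\eta).$$ (4) Let $\nu_1$ and $\nu_2$ be two $\mathfrak T$-invariant $\sigma$-finite Borel measures, each admitting a positive fibrewise continuous integrable function. Then $\nu_1\ll\nu_2$ if and only if $PCL(\nu_1)\ll PCL(\nu_2)$, and $\nu_1\perp\nu_2$ if and only if $PCL(\nu_1)\perp PCL(\nu_2)$. In particular, $PCL(\nu_1)=PCL(\nu_2)$ if and only if $[\nu_1]=[\nu_2]$.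
   Context: A standard Borel space is a pair $(X,\mathcal B)$, $\mathcal B$ a sigma-algebra on $X$, admitting a bijection of $X$ onto the unit interval carrying $\mathcal B$ to the Borel sigma-algebra. An inductively compact group is $G=\bigcup_{n\ge1}K(n)$, where $K(1)\subset K(2)\subset\cdots$ is an ascending chain of metrizable compact groups; $G$ carries the inductive limit topology (a function on $G$ is continuous iff its restriction to every $K(n)$ is continuous) and the Borel sigma-algebra spanned by those of the $K(n)$. A measurable action $\mathfrak T$ of $G$ on $X$ is an action $g\mapsto T_g$ with $(g,x)\mapsto T_gx$ Borel-measurable on $G\times X$. A Borel function $f:X\to\mathbb R$ is fibrewise continuous if for every $x\in X$ the function $g\mapsto f(T_gx)$ is continuous on $G$. $\mathfrak M^\infty=\mathfrak M^\infty(X)$ is the space of $\sigma$-finite (possibly finite) Borel measures on $X$, with the sigma-algebra generated by the sets $\{\nu:\alpha<\nu(A)<\beta\}$, $\alpha,\beta$ real, $A\subset X$ Borel; the zero measure is excluded, as is implicit in forming the projective space. $\mathfrak M^\infty_{\mathrm{erg}}(\mathfrak T)\subset\mathfrak M^\infty$ is the set of $G$-invariant ergodic measures (ergodic: each $G$-invariant Borel set is null or has null complement). $\mathbb P\mathfrak M^\infty$ is the quotient of $\mathfrak M^\infty$ by the relation $\nu_1\sim\nu_2$ iff $\nu_1=\lambda\nu_2$ for some $\lambda>0$; $\mathbf p:\mathfrak M^\infty\to\mathbb P\mathfrak M^\infty$ is the projection, a subset $A\subset \mathbb P\mathfrak M^\infty$ is Borel iff $\mathbf p^{-1}(A)$ is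 Borel, and $\mathbb P\mathfrak M^\infty_{\mathrm{erg}}(\mathfrak T)=\mathbf p(\mathfrak M^\infty_{\mathrm{erg}}(\mathfrak T))$. A measure class is the family of all $\sigma$-finite Borel measures with the same sets of measure zero; $[\nu]$ is the class of $\nu$. Relations $\ll$, $\perp$ between classes mean the corresponding relations between representatives. For $\nu\in\mathfrak M^\infty$ and a $\sigma$-finite Borel measure $\overline\nu$ on $\mathfrak M^\infty$, the equality $\nu=\int_{\mathfrak M^\infty}\eta\,d\overline\nu(\eta)$ means that for every Borel $A\subset X$ with $\nu(A)<+\infty$ the function $\eta\mapsto\eta(A)$ is in $L_1(\mathfrak M^\infty,\overline\nu)$ and $\nu(A)=\int\eta(A)\,d\overline\nu(\eta)$. For $\mathfrak T$-invariant $\nu$ it is called an ergodic decomposition of $\nu$ if $\overline\nu$ is $\sigma$-finite and $\overline\nu$-almost every $\eta$ is $\mathfrak T$-invariant and ergodic. A $\sigma$-finite measure $\overline\nu$ on $\mathfrak M^\infty$ is admissible if $\mathbf p$ is $\overline\nu$-almost surely a bijection (i.e. $\mathbf p$ is injective on a set of full $\overline\nu$-measure); an ergodic decomposition is admissible if its $\overline\nu$ is. *)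

theory Defs
  imports "HOL-Analysis.Analysis" "HOL-Algebra.Group_Action"
begin

text \<open>
  A measurable space is represented, as usual in the library, by a measure \<open>X\<close> of which only
  \<open>space X\<close> and \<open>sets X\<close> are used. A Borel measure on it is a \<open>\<nu>\<close> with \<open>sets \<nu> = sets X\<close>.
\<close>

definition standard_Borel_space :: "'x measure \<Rightarrow> bool" where
  "standard_Borel_space X \<longleftrightarrow>
     (\<exists>f. bij_betw f (space X) {0..1::real} \<and>
          (`) f ` sets X = sets (restrict_space borel {0..1}))"

definition sigma_finite_measures :: "'a measure \<Rightarrow> 'a measure set" where
  "sigma_finite_measures M = {\<mu>. sets \<mu> = sets M \<and> sigma_finite_measure \<mu>}"


section \<open>Inductively compact groups\<close>

text \<open>
  The group \<open>K(n)\<close> is given by its topology \<open>K n\<close>; its elements are \<open>topspace (K n)\<close> and its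
  operations are those of the ambient group. The chain is indexed from 0.
\<close>

locale inductively_compact_group = group G for G (structure) +
  fixes K :: "nat \<Rightarrow> 'a topology"
  assumes subgroup_K: "subgroup (topspace (K n)) G"
    and continuous_mult:
      "continuous_map (prod_topology (K n) (K n)) (K n) (\<lambda>(g, h). g \<otimes> h)"
    and continuous_inv: "continuous_map (K n) (K n) (\<lambda>g. inv g)"
    and compact_K: "compact_space (K n)"
    and metrizable_K: "metrizable_space (K n)"
    and K_subset: "topspace (K n) \<subseteq> topspace (K (Suc n))"
    and K_subtopology: "subtopology (K (Suc n)) (topspace (K n)) = K n"
    and carrier_eq: "carrier G = (\<Union>n. topspace (K n))"

definition inductive_limit_topology :: "(nat \<Rightarrow> 'a topology) \<Rightarrow> 'a topology" where
  "inductive_limit_topology K =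
     topology (\<lambda>U. U \<subseteq> (\<Union>n. topspace (K n)) \<and> (\<forall>n. openin (K n) (U \<inter> topspace (K n))))"

lemma openin_inductive_limit_topology:
  "openin (inductive_limit_topology K) U \<longleftrightarrow>
     U \<subseteq> (\<Union>n. topspace (K n)) \<and> (\<forall>n. openin (K n) (U \<inter> topspace (K n)))"
proof -
  have "istopology (\<lambda>U. U \<subseteq> (\<Union>n. topspace (K n)) \<and> (\<forall>n. openin (K n) (U \<inter> topspace (K n))))"
    unfolding istopology_def
  proof (intro conjI allI impI, goal_cases)
    case (2 S T n)
    have "S \<inter> T \<inter> topspace (K n) = (S \<inter> topspace (K n)) \<inter> (T \<inter> topspace (K n))" by blast
    then show ?case using 2 by (metis openin_Int)
  next
    case (4 \<K> n)
    have "\<Union>\<K> \<inter> topspace (K n) = (\<Union>S\<in>\<K>. S \<inter> topspace (K n))" by blast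
    then show ?case using 4 by (metis (no_types, lifting) openin_Union image_iff)
  qed blast+
  then show ?thesis by (simp add: inductive_limit_topology_def topology_inverse')
qed

context inductively_compact_group
begin

lemma topspace_inductive_limit_topology: "topspace (inductive_limit_topology K) = carrier G"
proof -
  have "openin (K n) ((\<Union>m. topspace (K m)) \<inter> topspace (K n))" for n
  proof -
    have "(\<Union>m. topspace (K m)) \<inter> topspace (K n) = topspace (K n)" by blast
    then show ?thesis by simp
  qed
  then have "openin (inductive_limit_topology K) (carrier G)"
    by (simp add: openin_inductive_limit_topology carrier_eq)
  moreover have "topspace (inductive_limit_topology K) \<subseteq> carrier G"
    using openin_topspace[of "inductive_limit_topology K"]
    unfolding openin_inductive_limit_topology carrier_eq by blast
  ultimately show ?thesis using openin_subset by blast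
qed

lemma continuous_map_inductive_limit_iff:
  "continuous_map (inductive_limit_topology K) Y f \<longleftrightarrow> (\<forall>n. continuous_map (K n) Y f)"
proof -
  have eq: "{x \<in> carrier G. f x \<in> U} \<inter> topspace (K n) = {x \<in> topspace (K n). f x \<in> U}" for U n
    using carrier_eq by blast
  show ?thesis
    unfolding continuous_map topspace_inductive_limit_topology openin_inductive_limit_topology
      carrier_eq[symmetric] eq
    by (auto simp: carrier_eq image_subset_iff)
qed

end

definition group_borel :: "(nat \<Rightarrow> 'a topology) \<Rightarrow> 'a measure" where
  "group_borel K =
     sigma (\<Union>n. topspace (K n)) (\<Union>n. sigma_sets (topspace (K n)) {U. openin (K n) U})"


section \<open>Measurable actions\<close>

definition measurable_action ::
  "('g, 'b) monoid_scheme \<Rightarrow> (nat \<Rightarrow> 'g topology) \<Rightarrow> 'x measure \<Rightarrow> ('g \<Rightarrow> 'x \<Rightarrow> 'x) \<Rightarrow> bool" where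
  "measurable_action G K X T \<longleftrightarrow>
     group_action G (space X) T \<and>
     (\<lambda>(g, x). T g x) \<in> measurable (group_borel K \<Otimes>\<^sub>M X) X"

definition fibrewise_continuous ::
  "(nat \<Rightarrow> 'g topology) \<Rightarrow> 'x measure \<Rightarrow> ('g \<Rightarrow> 'x \<Rightarrow> 'x) \<Rightarrow> ('x \<Rightarrow> real) \<Rightarrow> bool" where
  "fibrewise_continuous K X T f \<longleftrightarrow>
     f \<in> borel_measurable X \<and>
     (\<forall>x\<in>space X. continuous_map (inductive_limit_topology K) euclideanreal (\<lambda>g. f (T g x)))"

definition has_positive_fibrewise_continuous_integrable ::
  "(nat \<Rightarrow> 'g topology) \<Rightarrow> 'x measure \<Rightarrow> ('g \<Rightarrow> 'x \<Rightarrow> 'x) \<Rightarrow> 'x measure \<Rightarrow> bool" where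
  "has_positive_fibrewise_continuous_integrable K X T \<nu> \<longleftrightarrow>
     (\<exists>f. fibrewise_continuous K X T f \<and> (\<forall>x\<in>space X. f x > 0) \<and> integrable \<nu> f)"

definition invariant_measure ::
  "('g, 'b) monoid_scheme \<Rightarrow> 'x measure \<Rightarrow> ('g \<Rightarrow> 'x \<Rightarrow> 'x) \<Rightarrow> 'x measure \<Rightarrow> bool" where
  "invariant_measure G X T \<nu> \<longleftrightarrow> (\<forall>g\<in>carrier G. distr \<nu> X (T g) = \<nu>)"

definition integrable_invariant_measures ::
  "('g, 'b) monoid_scheme \<Rightarrow> (nat \<Rightarrow> 'g topology) \<Rightarrow> 'x measure \<Rightarrow> ('g \<Rightarrow> 'x \<Rightarrow> 'x) \<Rightarrow>
   'x measure set" where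
  "integrable_invariant_measures G K X T =
     {\<nu> \<in> sigma_finite_measures X. invariant_measure G X T \<nu> \<and>
        has_positive_fibrewise_continuous_integrable K X T \<nu>}"

definition ergodic_measure ::
  "('g, 'b) monoid_scheme \<Rightarrow> 'x measure \<Rightarrow> ('g \<Rightarrow> 'x \<Rightarrow> 'x) \<Rightarrow> 'x measure \<Rightarrow> bool" where
  "ergodic_measure G X T \<nu> \<longleftrightarrow>
     (\<forall>A\<in>sets X. (\<forall>g\<in>carrier G. T g ` A = A) \<longrightarrow>
        emeasure \<nu> A = 0 \<or> emeasure \<nu> (space X - A) = 0)"


section \<open>The space of sigma-finite measures and its projectivization\<close>

text \<open>
  Values of measures are compared in \<^typ>\<open>ereal\<close> because the bounds \<open>\<alpha>\<close>, \<open>\<beta>\<close> may be negative.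
\<close>

definition Minf :: "'x measure \<Rightarrow> 'x measure measure" where
  "Minf X =
     (let \<Omega> = {\<nu> \<in> sigma_finite_measures X. emeasure \<nu> (space X) \<noteq> 0}
      in sigma \<Omega>
           {{\<nu> \<in> \<Omega>. ereal \<alpha> < enn2ereal (emeasure \<nu> A) \<and> enn2ereal (emeasure \<nu> A) < ereal \<beta>}
             | \<alpha> \<beta> A. A \<in> sets X})"

definition Minf_erg ::
  "('g, 'b) monoid_scheme \<Rightarrow> 'x measure \<Rightarrow> ('g \<Rightarrow> 'x \<Rightarrow> 'x) \<Rightarrow> 'x measure set" where
  "Minf_erg G X T =
     {\<nu> \<in> space (Minf X). invariant_measure G X T \<nu> \<and> ergodic_measure G X T \<nu>}"

definition proj_rel :: "'x measure \<Rightarrow> ('x measure \<times> 'x measure) set" where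
  "proj_rel X = {(\<nu>1, \<nu>2). \<nu>1 \<in> space (Minf X) \<and> \<nu>2 \<in> space (Minf X) \<and>
     (\<exists>c::real. c > 0 \<and> \<nu>1 = scale_measure (ennreal c) \<nu>2)}"

definition proj :: "'x measure \<Rightarrow> 'x measure \<Rightarrow> 'x measure set" where
  "proj X \<nu> = proj_rel X `` {\<nu>}"

definition PMinf :: "'x measure \<Rightarrow> 'x measure set measure" where
  "PMinf X =
     sigma (space (Minf X) // proj_rel X)
       {A. A \<subseteq> space (Minf X) // proj_rel X \<and> proj X -` A \<inter> space (Minf X) \<in> sets (Minf X)}"

definition PMinf_erg ::
  "('g, 'b) monoid_scheme \<Rightarrow> 'x measure \<Rightarrow> ('g \<Rightarrow> 'x \<Rightarrow> 'x) \<Rightarrow> 'x measure set set" where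
  "PMinf_erg G X T = proj X ` Minf_erg G X T"

lemma equiv_proj_rel: "equiv (space (Minf X)) (proj_rel X)"
proof (rule equivI)
  show "refl_on (space (Minf X)) (proj_rel X)"
    by (auto simp: refl_on_def proj_rel_def intro!: exI[of _ 1] measure_eqI)
  show "sym (proj_rel X)"
  proof (rule symI)
    fix \<mu> \<nu> assume "(\<mu>, \<nu>) \<in> proj_rel X"
    then obtain c :: real where c: "c > 0" "\<mu> = scale_measure (ennreal c) \<nu>"
      and in_space: "\<mu> \<in> space (Minf X)" "\<nu> \<in> space (Minf X)"
      by (auto simp: proj_rel_def)
    have "ennreal (1 / c) * ennreal c = 1"
      using c(1) by (simp flip: ennreal_mult)
    then have "\<nu> = scale_measure (ennreal (1 / c)) \<mu>"
      by (intro measure_eqI) (simp_all add: c(2) flip: mult.assoc)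
    then show "(\<nu>, \<mu>) \<in> proj_rel X"
      using c(1) in_space by (auto simp: proj_rel_def intro!: exI[of _ "1 / c"])
  qed
  show "trans (proj_rel X)"
  proof (rule transI)
    fix \<mu> \<nu> \<rho> assume "(\<mu>, \<nu>) \<in> proj_rel X" "(\<nu>, \<rho>) \<in> proj_rel X"
    then obtain c d :: real where c: "c > 0" "\<mu> = scale_measure (ennreal c) \<nu>"
      and d: "d > 0" "\<nu> = scale_measure (ennreal d) \<rho>"
      and in_space: "\<mu> \<in> space (Minf X)" "\<rho> \<in> space (Minf X)"
      by (auto simp: proj_rel_def)
    have "\<mu> = scale_measure (ennreal (c * d)) \<rho>"
      using c(1) d(1)
      by (intro measure_eqI) (simp_all add: c(2) d(2) ennreal_mult mult.assoc)
    then show "(\<mu>, \<rho>) \<in> proj_rel X"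
      using c(1) d(1) in_space by (auto simp: proj_rel_def intro!: exI[of _ "c * d"])
  qed
qed (auto simp: proj_rel_def)

lemma space_PMinf: "space (PMinf X) = space (Minf X) // proj_rel X"
  unfolding PMinf_def by (rule space_measure_of) blast

lemma sets_PMinf:
  "A \<in> sets (PMinf X) \<longleftrightarrow>
     A \<subseteq> space (PMinf X) \<and> proj X -` A \<inter> space (Minf X) \<in> sets (Minf X)"
proof -
  let ?P = "space (Minf X) // proj_rel X"
  let ?S = "{A. A \<subseteq> ?P \<and> proj X -` A \<inter> space (Minf X) \<in> sets (Minf X)}"
  have in_P: "proj X \<nu> \<in> ?P" if "\<nu> \<in> space (Minf X)" for \<nu>
    using that by (simp add: proj_def quotientI)
  have "sigma_algebra ?P ?S"
    unfolding sigma_algebra_iff2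
  proof (intro conjI ballI allI impI)
    show "?S \<subseteq> Pow ?P" "{} \<in> ?S" by auto
    fix A assume A: "A \<in> ?S"
    have "proj X -` (?P - A) \<inter> space (Minf X) =
        space (Minf X) - (proj X -` A \<inter> space (Minf X))"
      using in_P by blast
    then show "?P - A \<in> ?S" using A by auto
  next
    fix A :: "nat \<Rightarrow> _" assume A: "range A \<subseteq> ?S"
    have "proj X -` \<Union> (range A) \<inter> space (Minf X) = (\<Union>i. proj X -` A i \<inter> space (Minf X))"
      by blast
    moreover have "(\<Union>i. proj X -` A i \<inter> space (Minf X)) \<in> sets (Minf X)"
      using A by (intro sets.countable_UN) auto
    ultimately show "\<Union> (range A) \<in> ?S"
      using A unfolding image_subset_iff mem_Collect_eq by (metis UN_least UNIV_I)
  qed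
  then have "sets (PMinf X) = ?S"
    by (simp add: PMinf_def sigma_algebra.sets_measure_of_eq)
  then show ?thesis by (simp add: space_PMinf)
qed

lemma measurable_proj: "proj X \<in> measurable (Minf X) (PMinf X)"
  by (rule measurableI) (auto simp: sets_PMinf space_PMinf proj_def intro: quotientI)


section \<open>Measure classes\<close>

definition measure_class :: "'a measure \<Rightarrow> 'a measure set" where
  "measure_class \<mu> = {\<nu> \<in> sigma_finite_measures \<mu>. null_sets \<nu> = null_sets \<mu>}"

definition measure_classes :: "'a measure \<Rightarrow> 'a measure set set" where
  "measure_classes M = measure_class ` sigma_finite_measures M"

definition mutually_singular :: "'a measure \<Rightarrow> 'a measure \<Rightarrow> bool" where
  "mutually_singular \<mu> \<nu> \<longleftrightarrow>
     (\<exists>A\<in>sets \<mu>. emeasure \<mu> A = 0 \<and> emeasure \<nu> (space \<mu> - A) = 0)"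

text \<open>
  The library's \<^term>\<open>absolutely_continuous \<nu> \<mu>\<close> is \<open>\<mu> \<lless> \<nu>\<close>, i.e. every \<open>\<nu>\<close>-null set is \<open>\<mu>\<close>-null.
  Classes are nonempty and the relations do not depend on the representatives.
\<close>

definition class_absolutely_continuous :: "'a measure set \<Rightarrow> 'a measure set \<Rightarrow> bool" where
  "class_absolutely_continuous C D \<longleftrightarrow> (\<forall>\<mu>\<in>C. \<forall>\<nu>\<in>D. absolutely_continuous \<nu> \<mu>)"

definition class_mutually_singular :: "'a measure set \<Rightarrow> 'a measure set \<Rightarrow> bool" where
  "class_mutually_singular C D \<longleftrightarrow> (\<forall>\<mu>\<in>C. \<forall>\<nu>\<in>D. mutually_singular \<mu> \<nu>)"


section \<open>Ergodic decompositions\<close>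

text \<open>
  \<open>\<eta> A\<close> may be infinite, so membership in \<open>L\<^sub>1\<close> is expressed by measurability and finiteness of the
  integral of the extended nonnegative function.
\<close>

definition is_measure_integral :: "'x measure \<Rightarrow> 'x measure \<Rightarrow> 'x measure measure \<Rightarrow> bool" where
  "is_measure_integral X \<nu> N \<longleftrightarrow>
     (\<forall>A\<in>sets X. emeasure \<nu> A < \<infinity> \<longrightarrow>
        (\<lambda>\<eta>. emeasure \<eta> A) \<in> borel_measurable N \<and>
        (\<integral>\<^sup>+ \<eta>. emeasure \<eta> A \<partial>N) < \<infinity> \<and>
        emeasure \<nu> A = (\<integral>\<^sup>+ \<eta>. emeasure \<eta> A \<partial>N))"

definition admissible :: "'x measure \<Rightarrow> 'x measure measure \<Rightarrow> bool" where
  "admissible X N \<longleftrightarrow> (\<exists>Z\<in>null_sets N. inj_on (proj X) (space (Minf X) - Z))"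

definition ergodic_decomposition ::
  "('g, 'b) monoid_scheme \<Rightarrow> 'x measure \<Rightarrow> ('g \<Rightarrow> 'x \<Rightarrow> 'x) \<Rightarrow>
   'x measure \<Rightarrow> 'x measure measure \<Rightarrow> bool" where
  "ergodic_decomposition G X T \<nu> N \<longleftrightarrow>
     N \<in> sigma_finite_measures (Minf X) \<and>
     is_measure_integral X \<nu> N \<and>
     (AE \<eta> in N. invariant_measure G X T \<eta> \<and> ergodic_measure G X T \<eta>)"

end

theory Submission
  imports "HOL-Probability.Probability" Defs
begin

text \<open>
  Let \<open>f\<close> be positive and fibrewise continuous. By compactness the averages \<open>A\<^sub>n f\<close> of \<open>f\<close> over \<open>K n\<close>
  (with respect to Haar measure) are finite and positive, and for every invariant \<open>\<nu>\<close> integrating \<open>f\<close>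
  the quotients \<open>A\<^sub>n (f h) / A\<^sub>n f\<close> are conditional expectations of \<open>h\<close> under \<open>f \<nu>\<close> given the
  \<open>K n\<close>-invariant sets. They do not depend on \<open>\<nu>\<close>. Their limit along the decreasing sequence of
  invariant sigma-algebras is a kernel that conditions every such \<open>f \<nu>\<close> on the \<open>G\<close>-invariant sets;
  dividing it by \<open>f\<close> gives a map \<open>\<pi>\<close> from \<open>X\<close> to measures that is almost everywhere equal to \<open>\<eta>\<close>
  for every ergodic \<open>\<eta>\<close> with \<open>\<integral> f d\<eta> = 1\<close>. Hence the image of \<open>f \<nu>\<close> under \<open>\<pi>\<close> is the only
  decomposition of \<open>\<nu>\<close> into such \<open>\<eta>\<close>, and the class of its projection is the class sought.

  An arbitrary admissible decomposition is reduced to this one by normalizing \<open>\<eta>\<close>; admissibility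
  makes the factor \<open>\<integral> f d\<eta>\<close> a measurable function of the projective point, because its graph over
  that point is Borel. A lift of a measure of the class is then determined by a Radon-Nikodym
  derivative. For two measures one takes the minimum of the two functions \<open>f\<close>.
\<close>

text \<open>The weight replaces \<nu>, whose restriction to the invariant sets may fail to be
  sigma-finite, by the finite measure \<open>f \<nu>\<close>, to which conditioning applies. The
  kernel has to serve all \<nu> at once, so it is defined at every point by upper limits, without
  reference to a measure. Upper limits are not additive in the set; hence only their values on
  countably many initial segments are kept, in a coding of \<open>X\<close> by the unit interval,
  and a probability measure is rebuilt from these numbers.

  The same countable family turns invariance and ergodicity of a normalized measure into countably
  many Borel equations. An ergodic measure need not integrate \<open>f\<close>; the ergodic classes
  that do form a Borel set of full measure, and the complement of all ergodic classes is null in the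
  sense of the completion.

  Uniqueness rests on the fact that the kernel recovers a normalized ergodic \<eta> from
  \<eta>-almost every point: in a decomposition into such measures the mass of a Borel set
  \<open>B\<close> is the \<nu>-integral of \<open>f\<close> over the points whose component lies in
  \<open>B\<close>.\<close>

section \<open>Haar measure on a compact group\<close>

text \<open>Normality separates the disjoint closed sets \<open>C - U\<close> and
  \<open>C - V\<close>; removing from \<open>C\<close> one of the two separating open sets at a time
  gives the two pieces. This makes the inner content of open sets subadditive.\<close>

lemma closedin_cover_split:
  assumes "compact_space \<tau>" "Hausdorff_space \<tau>" "closedin \<tau> C" "openin \<tau> U" "openin \<tau> V" "C \<subseteq> U \<union> V"
  obtains A B where "closedin \<tau> A" "closedin \<tau> B" "A \<subseteq> U" "B \<subseteq> V" "C = A \<union> B"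
proof -
  have "normal_space \<tau>"
    using assms(1,2) compact_Hausdorff_or_regular_imp_normal_space by blast
  moreover have "closedin \<tau> (C - U)" "closedin \<tau> (C - V)" "disjnt (C - U) (C - V)"
    using assms by (auto intro: closedin_diff simp: disjnt_def)
  ultimately obtain U' V' where *: "openin \<tau> U'" "openin \<tau> V'" "C - U \<subseteq> U'" "C - V \<subseteq> V'" "disjnt U' V'"
    unfolding normal_space_def by meson
  show ?thesis
    by (rule that[of "C - U'" "C - V'"]) (use * assms in \<open>auto intro: closedin_diff simp: disjnt_def\<close>)
qed

text \<open>The classical passage from a content on closed sets to its inner content on open sets,
  from there to an outer measure by open supersets, and to a measure by Caratheodory's criterion.
  Since \<open>l\<close> is not assumed regular, the measure may differ from \<open>l\<close> on
  closed sets; only its values on open sets are described.\<close>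

lemma content_extends_to_measure:
  fixes l :: "'a set \<Rightarrow> ennreal"
  assumes compact: "compact_space \<tau>" and Hausdorff: "Hausdorff_space \<tau>"
    and empty: "l {} = 0"
    and mono: "\<And>A B. closedin \<tau> A \<Longrightarrow> closedin \<tau> B \<Longrightarrow> A \<subseteq> B \<Longrightarrow> l A \<le> l B"
    and subadd: "\<And>A B. closedin \<tau> A \<Longrightarrow> closedin \<tau> B \<Longrightarrow> l (A \<union> B) \<le> l A + l B"
    and add: "\<And>A B. closedin \<tau> A \<Longrightarrow> closedin \<tau> B \<Longrightarrow> A \<inter> B = {} \<Longrightarrow> l A + l B \<le> l (A \<union> B)"
  obtains m where "space m = topspace \<tau>" "sets m = sigma_sets (topspace \<tau>) {U. openin \<tau> U}"
    "\<And>U. openin \<tau> U \<Longrightarrow> emeasure m U = (SUP C\<in>{C. closedin \<tau> C \<and> C \<subseteq> U}. l C)"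
proof -
  define inn where "inn U = (SUP C\<in>{C. closedin \<tau> C \<and> C \<subseteq> U}. l C)" for U
  define out where "out A = (INF U\<in>{U. openin \<tau> U \<and> A \<subseteq> U}. inn U)" for A
  have l_le_inn: "l C \<le> inn U" if "closedin \<tau> C" "C \<subseteq> U" for C U
    unfolding inn_def by (rule SUP_upper) (use that in auto)
  have inn_mono: "inn U \<le> inn V" if "U \<subseteq> V" for U V
    unfolding inn_def by (rule SUP_subset_mono) (use that in auto)
  have inn_Un: "inn (U \<union> V) \<le> inn U + inn V" if "openin \<tau> U" "openin \<tau> V" for U V
    unfolding inn_def[of "U \<union> V"]
  proof (rule SUP_least)
    fix C assume "C \<in> {C. closedin \<tau> C \<and> C \<subseteq> U \<union> V}"
    then have "closedin \<tau> C" "C \<subseteq> U \<union> V" by auto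
    from closedin_cover_split[OF compact Hausdorff this(1) that this(2)]
    obtain A B where AB: "closedin \<tau> A" "closedin \<tau> B" "A \<subseteq> U" "B \<subseteq> V" "C = A \<union> B"
      by metis
    have "l C \<le> l A + l B" using subadd AB by simp
    also have "\<dots> \<le> inn U + inn V" by (intro add_mono l_le_inn AB)
    finally show "l C \<le> inn U + inn V" .
  qed
  have inn_empty: "inn {} = 0"
    unfolding inn_def by (simp add: empty cong: conj_cong)
  have inn_finite_UN: "inn (\<Union>i<n. U i) \<le> (\<Sum>i<n. inn (U i))" if "\<And>i. openin \<tau> (U i)" for U :: "nat \<Rightarrow> _" and n
  proof (induction n)
    case (Suc n)
    have "inn (\<Union>i<Suc n. U i) = inn ((\<Union>i<n. U i) \<union> U n)"
      by (simp add: lessThan_Suc Un_commute)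
    also have "\<dots> \<le> inn (\<Union>i<n. U i) + inn (U n)"
      by (intro inn_Un openin_Union that) (use that in auto)
    finally show ?case using Suc by (simp add: order_trans add_right_mono)
  qed (simp add: inn_empty)
  have inn_UN: "inn (\<Union>i. U i) \<le> (\<Sum>i. inn (U i))" if U: "\<And>i. openin \<tau> (U i)" for U :: "nat \<Rightarrow> _"
    unfolding inn_def[of "\<Union>i. U i"]
  proof (rule SUP_least)
    fix C assume "C \<in> {C. closedin \<tau> C \<and> C \<subseteq> (\<Union>i. U i)}"
    then have C: "closedin \<tau> C" "C \<subseteq> (\<Union>i. U i)" by auto
    then have "compactin \<tau> C" using compact closedin_compact_space by blast
    moreover have "\<forall>V\<in>range U. openin \<tau> V" using U by blast
    ultimately obtain \<F> where F: "finite \<F>" "\<F> \<subseteq> range U" "C \<subseteq> \<Union>\<F>"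
      using C(2) unfolding compactin_def by meson
    obtain I where I: "finite I" "\<F> = U ` I" using F finite_subset_image by metis
    then obtain n where "I \<subseteq> {..<n}" using finite_nat_bounded by blast
    then have "C \<subseteq> (\<Union>i<n. U i)" using F I by blast
    then have "l C \<le> inn (\<Union>i<n. U i)" by (intro l_le_inn C)
    also have "\<dots> \<le> (\<Sum>i<n. inn (U i))" by (rule inn_finite_UN[OF U])
    also have "\<dots> \<le> (\<Sum>i. inn (U i))" by (rule sum_le_suminf) auto
    finally show "l C \<le> (\<Sum>i. inn (U i))" .
  qed
  have out_open: "out U = inn U" if "openin \<tau> U" for U
    unfolding out_def by (intro antisym INF_lower INF_greatest inn_mono) (use that in auto)
  have out_le: "out A \<le> inn U" if "openin \<tau> U" "A \<subseteq> U" for A U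
    unfolding out_def by (rule INF_lower) (use that in auto)
  have out_mono: "out A \<le> out B" if "A \<subseteq> B" for A B
    unfolding out_def by (rule INF_superset_mono) (use that in auto)
  have oms: "outer_measure_space (Pow (topspace \<tau>)) out"
    unfolding outer_measure_space_def
  proof (intro conjI)
    show "positive (Pow (topspace \<tau>)) out" by (simp add: positive_def out_open inn_empty)
    show "increasing (Pow (topspace \<tau>)) out" by (simp add: increasing_def out_mono)
    show "countably_subadditive (Pow (topspace \<tau>)) out"
      unfolding countably_subadditive_def
    proof (intro allI impI)
      fix A :: "nat \<Rightarrow> _" assume A: "range A \<subseteq> Pow (topspace \<tau>)"
      show "out (\<Union>i. A i) \<le> (\<Sum>i. out (A i))"
      proof (rule ennreal_le_epsilon)
        fix e :: real assume e: "e > 0" and "(\<Sum>i. out (A i)) < Orderings.top"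
        then have fin: "(\<Sum>i. out (A i)) < \<infinity>" by simp
        have "\<exists>U. openin \<tau> U \<and> A i \<subseteq> U \<and> inn U \<le> out (A i) + e * (1/2)^Suc i" for i
        proof -
          have "out (A i) < \<infinity>"
            using ennreal_suminf_lessD[OF fin] by simp
          then have "out (A i) < out (A i) + ennreal (e * (1/2)^Suc i)"
            using e by (simp add: ennreal_add_left_cancel_less flip: infinity_ennreal_def)
          then obtain U where "openin \<tau> U" "A i \<subseteq> U" "inn U < out (A i) + ennreal (e * (1/2)^Suc i)"
            unfolding out_def INF_less_iff by (auto simp: out_def)
          then show ?thesis using less_imp_le by blast
        qed
        then obtain U where U: "\<And>i. openin \<tau> (U i)" "\<And>i. A i \<subseteq> U i"
          "\<And>i. inn (U i) \<le> out (A i) + e * (1/2)^Suc i" by metis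
        have "out (\<Union>i. A i) \<le> inn (\<Union>i. U i)" using U by (intro out_le) auto
        also have "\<dots> \<le> (\<Sum>i. inn (U i))" by (rule inn_UN[OF U(1)])
        also have "\<dots> \<le> (\<Sum>i. out (A i) + ennreal (e * (1/2)^Suc i))" by (intro suminf_le U) auto
        also have "\<dots> = (\<Sum>i. out (A i)) + (\<Sum>i. ennreal e * ennreal ((1/2)^Suc i))"
          using e by (subst suminf_add) (auto simp flip: ennreal_mult)
        also have "(\<Sum>i. ennreal e * ennreal ((1/2)^Suc i)) = ennreal e * (\<Sum>i. ennreal ((1/2)^Suc i))"
          by simp
        also have "(\<Sum>i. ennreal ((1/2)^Suc i)) = ennreal 1"
          by (intro suminf_ennreal_eq power_half_series) auto
        finally show "out (\<Union>i. A i) \<le> (\<Sum>i. out (A i)) + ennreal e" by simp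
      qed
    qed
  qed
  interpret P: sigma_algebra "topspace \<tau>" "Pow (topspace \<tau>)" by (rule sigma_algebra_Pow)
  define L where "L = lambda_system (topspace \<tau>) (Pow (topspace \<tau>)) out"
  have ms: "measure_space (topspace \<tau>) L out"
    unfolding L_def by (rule P.caratheodory_lemma[OF oms])
  then interpret L: sigma_algebra "topspace \<tau>" L by (simp add: measure_space_def)
  have open_L: "W \<in> L" if W: "openin \<tau> W" for W
  proof -
    \<comment> \<open>Test against an open \<open>U\<close> containing \<open>A\<close>. A closed
      \<open>C\<close> inside \<open>U \<inter> W\<close> and a closed \<open>D\<close> inside
      \<open>U - C\<close> are disjoint subsets of \<open>U\<close>, so additivity of
      \<open>l\<close> bounds the sum of their contents by \<open>inn U\<close>. First
      \<open>D\<close> and then \<open>C\<close> exhausts its open set.\<close>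
    have "out (A \<inter> W) + out (A - W) \<le> out A" if "A \<subseteq> topspace \<tau>" for A
      unfolding out_def[of A]
    proof (rule INF_greatest)
      fix U assume "U \<in> {U. openin \<tau> U \<and> A \<subseteq> U}"
      then have U: "openin \<tau> U" "A \<subseteq> U" by auto
      have "out (A \<inter> W) + out (A - W) \<le> inn (U \<inter> W) + out (U - W)"
        using U W by (intro add_mono out_le out_mono) auto
      also have "\<dots> \<le> inn U"
        unfolding inn_def[of "U \<inter> W"]
      proof (subst ennreal_SUP_add_left[symmetric])
        show "{C. closedin \<tau> C \<and> C \<subseteq> U \<inter> W} \<noteq> {}" using closedin_empty by blast
        show "(SUP C\<in>{C. closedin \<tau> C \<and> C \<subseteq> U \<inter> W}. l C + out (U - W)) \<le> inn U"
        proof (rule SUP_least)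
          fix C assume "C \<in> {C. closedin \<tau> C \<and> C \<subseteq> U \<inter> W}"
          then have C: "closedin \<tau> C" "C \<subseteq> U \<inter> W" by auto
          have UC: "openin \<tau> (U - C)" using U C by auto
          have "l C + out (U - W) \<le> l C + inn (U - C)"
            using C UC by (intro add_mono order_refl out_le) auto
          also have "\<dots> = (SUP D\<in>{D. closedin \<tau> D \<and> D \<subseteq> U - C}. l C + l D)"
            unfolding inn_def
            by (subst ennreal_SUP_add_right) (auto intro: exI[of _ "{}"])
          also have "\<dots> \<le> inn U"
          proof (rule SUP_least)
            fix D assume "D \<in> {D. closedin \<tau> D \<and> D \<subseteq> U - C}"
            then have D: "closedin \<tau> D" "D \<subseteq> U - C" by auto
            have "l C + l D \<le> l (C \<union> D)" using C D by (intro add) auto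
            also have "\<dots> \<le> inn U" using C D by (intro l_le_inn) auto
            finally show "l C + l D \<le> inn U" .
          qed
          finally show "l C + out (U - W) \<le> inn U" .
        qed
      qed
      finally show "out (A \<inter> W) + out (A - W) \<le> inn U" .
    qed
    moreover have "out A \<le> out (A \<inter> W) + out (A - W)" if "A \<subseteq> topspace \<tau>" for A
    proof -
      have "subadditive (Pow (topspace \<tau>)) out"
        using oms P.countably_subadditive_subadditive by (simp add: outer_measure_space_def)
      moreover have "A = (A \<inter> W) \<union> (A - W)" "(A \<inter> W) \<inter> (A - W) = {}" by auto
      moreover have "A \<inter> W \<in> Pow (topspace \<tau>)" "A - W \<in> Pow (topspace \<tau>)" using that by auto
      ultimately show ?thesis unfolding subadditive_def by metis
    qed
    ultimately show ?thesis
      using openin_subset[OF W] unfolding L_def P.lambda_system_eq by (auto intro!: antisym)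
  qed
  define S where "S = sigma_sets (topspace \<tau>) {U. openin \<tau> U}"
  have SL: "S \<subseteq> L"
    unfolding S_def by (rule L.sigma_sets_subset) (use open_L in auto)
  have SA: "sigma_algebra (topspace \<tau>) S"
    unfolding S_def by (rule sigma_algebra_sigma_sets) (auto dest: openin_subset)
  have "measure_space (topspace \<tau>) S out"
    using measure_down[OF _ SA SL] ms by simp
  then have em: "A \<in> S \<Longrightarrow> emeasure (measure_of (topspace \<tau>) S out) A = out A" for A
    by (subst emeasure_measure_of_sigma) (auto simp: measure_space_def)
  show ?thesis
  proof (rule that[of "measure_of (topspace \<tau>) S out"])
    show "space (measure_of (topspace \<tau>) S out) = topspace \<tau>"
      using SA by (simp add: sigma_algebra.space_measure_of_eq)
    show "sets (measure_of (topspace \<tau>) S out) = sigma_sets (topspace \<tau>) {U. openin \<tau> U}"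
      using SA by (simp add: sigma_algebra.sets_measure_of_eq S_def)
    fix U assume U: "openin \<tau> U"
    then have "U \<in> S" by (auto simp: S_def)
    then show "emeasure (measure_of (topspace \<tau>) S out) U = (SUP C\<in>{C. closedin \<tau> C \<and> C \<subseteq> U}. l C)"
      using em out_open[OF U] by (simp add: inn_def)
  qed
qed

text \<open>Tychonoff: the functions \<open>u i\<close> are points of a compact cube and cluster
  somewhere along \<open>H\<close>. The exponent may be uncountable, so a finer filter takes the
  place of a convergent subsequence.\<close>

lemma filter_limit_unit_interval:
  fixes u :: "'i \<Rightarrow> 'b \<Rightarrow> real"
  assumes "H \<noteq> bot" "\<And>i b. u i b \<in> {0..1}"
  obtains H' l where "H' \<noteq> bot" "H' \<le> H" "\<And>b. ((\<lambda>i. u i b) \<longlongrightarrow> l b) H'"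
proof -
  have "compactin (product_topology (\<lambda>_. euclidean) UNIV) (PiE UNIV (\<lambda>_::'b. {0..1::real}))"
    by (subst compactin_PiE) auto
  then have "compact (PiE UNIV (\<lambda>_::'b. {0..1::real}))"
    by (simp add: euclidean_product_topology)
  moreover have "filtermap u H \<noteq> bot" using assms(1) by (simp add: filtermap_bot_iff)
  moreover have "eventually (\<lambda>x. x \<in> PiE UNIV (\<lambda>_::'b. {0..1::real})) (filtermap u H)"
    using assms(2) by (simp add: eventually_filtermap PiE_def)
  ultimately obtain l where l: "inf (nhds l) (filtermap u H) \<noteq> bot"
    unfolding compact_filter by blast
  \<comment> \<open>The index filter is refined by the preimages of the neighbourhoods of the
    cluster point; it is proper exactly because \<open>l\<close> is a cluster point.\<close>
  define H' where "H' = inf (filtercomap u (nhds l)) H"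
  have "H' \<noteq> bot"
  proof
    assume "H' = bot"
    then have "eventually (\<lambda>_. False) H'" by simp
    then obtain P Q where P: "eventually P (filtercomap u (nhds l))" and Q: "eventually Q H"
      and PQ: "\<And>x. P x \<Longrightarrow> Q x \<Longrightarrow> False"
      unfolding H'_def eventually_inf by blast
    obtain R where R: "eventually R (nhds l)" "\<And>x. R (u x) \<Longrightarrow> P x"
      using P unfolding eventually_filtercomap by blast
    have "eventually (\<lambda>y. \<not> R y) (filtermap u H)"
      unfolding eventually_filtermap using Q by (rule eventually_mono) (use R PQ in blast)
    then have "eventually (\<lambda>_. False) (inf (nhds l) (filtermap u H))"
      unfolding eventually_inf using R(1) by blast
    then show False using l by (simp add: trivial_limit_def)
  qed
  have "H' \<le> H" by (simp add: H'_def)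
  have "filterlim u (nhds l) H'"
    unfolding H'_def by (metis filterlim_filtercomap filterlim_mono inf.cobounded1 order_refl)
  then have "((\<lambda>i. u i b) \<longlongrightarrow> l b) H'" for b
  proof (intro topological_tendstoI)
    fix S assume S: "open S" "l b \<in> S"
    have "open ((\<lambda>x. x b) -` S :: ('b \<Rightarrow> real) set)"
      using S(1) by (intro open_vimage) auto
    then have "eventually (\<lambda>x. x b \<in> S) (nhds l)"
      using S(2) eventually_nhds_in_open[of "(\<lambda>x. x b) -` S" l] by simp
    then show "eventually (\<lambda>i. u i b \<in> S) H'"
      using \<open>filterlim u (nhds l) H'\<close> by (auto simp: filterlim_iff)
  qed
  with \<open>H' \<noteq> bot\<close> \<open>H' \<le> H\<close> show ?thesis using that by blast
qed

section \<open>Covering numbers and the invariant content of a compact group\<close>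

locale compact_Hausdorff_group = group G for G (structure) +
  fixes \<tau> :: "'a topology"
  assumes topspace_eq: "topspace \<tau> = carrier G"
    and continuous_mult: "continuous_map (prod_topology \<tau> \<tau>) \<tau> (\<lambda>(g, h). g \<otimes> h)"
    and continuous_inv: "continuous_map \<tau> \<tau> (\<lambda>g. inv g)"
    and compact: "compact_space \<tau>"
    and Hausdorff: "Hausdorff_space \<tau>"
begin

abbreviation right_translate :: "'a \<Rightarrow> 'a set \<Rightarrow> 'a set" where
  "right_translate g V \<equiv> (\<lambda>v. v \<otimes> g) ` V"

lemma continuous_map_right_mult: "g \<in> carrier G \<Longrightarrow> continuous_map \<tau> \<tau> (\<lambda>v. v \<otimes> g)"
  using continuous_map_compose[OF _ continuous_mult, of \<tau> "\<lambda>v. (v, g)"]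
  by (simp add: o_def continuous_map_pairwise topspace_eq)

lemma continuous_map_left_mult: "g \<in> carrier G \<Longrightarrow> continuous_map \<tau> \<tau> (\<lambda>v. g \<otimes> v)"
  using continuous_map_compose[OF _ continuous_mult, of \<tau> "\<lambda>v. (g, v)"]
  by (simp add: o_def continuous_map_pairwise topspace_eq)

lemma right_translate_eq_vimage:
  assumes "g \<in> carrier G" "V \<subseteq> carrier G"
  shows "right_translate g V = {v \<in> carrier G. v \<otimes> inv g \<in> V}"
proof safe
  fix v assume "v \<in> carrier G" "v \<otimes> inv g \<in> V"
  then show "v \<in> right_translate g V"
    using assms by (intro image_eqI[of _ _ "v \<otimes> inv g"]) (auto simp: m_assoc)
qed (use assms in \<open>auto simp: m_assoc subset_iff\<close>)

lemma openin_right_translate: "g \<in> carrier G \<Longrightarrow> openin \<tau> V \<Longrightarrow> openin \<tau> (right_translate g V)"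
  using openin_continuous_map_preimage[OF continuous_map_right_mult[of "inv g"], of V] openin_subset[of \<tau> V]
  by (simp add: right_translate_eq_vimage topspace_eq)

lemma closedin_right_translate: "g \<in> carrier G \<Longrightarrow> closedin \<tau> V \<Longrightarrow> closedin \<tau> (right_translate g V)"
  using closedin_continuous_map_preimage[OF continuous_map_right_mult[of "inv g"], of V] closedin_subset[of \<tau> V]
  by (simp add: right_translate_eq_vimage topspace_eq)

definition unit_nbhds :: "'a set set" where
  "unit_nbhds = {V. openin \<tau> V \<and> \<one> \<in> V}"

text \<open>A filter on the family of neighbourhoods, not on the group: a property holds eventually
  if it holds for all sufficiently small neighbourhoods of the unit.\<close>

definition unit_filter :: "'a set filter" where
  "unit_filter = (INF V\<in>unit_nbhds. principal {W \<in> unit_nbhds. W \<subseteq> V})"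

definition covers :: "'a set \<Rightarrow> 'a set \<Rightarrow> 'a set \<Rightarrow> bool" where
  "covers V A F \<longleftrightarrow> finite F \<and> F \<subseteq> carrier G \<and> A \<subseteq> (\<Union>g\<in>F. right_translate g V)"

text \<open>Haar's index of \<open>A\<close> relative to \<open>V\<close>. Translating a cover by
  right translates of \<open>V\<close> gives another such cover, which is the source of right
  invariance.\<close>

definition covering_number :: "'a set \<Rightarrow> 'a set \<Rightarrow> nat" where
  "covering_number V A = (LEAST n. \<exists>F. covers V A F \<and> card F = n)"

lemma carrier_in_unit_nbhds: "carrier G \<in> unit_nbhds"
  using openin_topspace[of \<tau>] by (simp add: unit_nbhds_def topspace_eq)

lemma eventually_unit_filter:
  "eventually P unit_filter \<longleftrightarrow> (\<exists>V\<in>unit_nbhds. \<forall>W\<in>unit_nbhds. W \<subseteq> V \<longrightarrow> P W)"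
  unfolding unit_filter_def
proof (subst eventually_INF_base)
  show "unit_nbhds \<noteq> {}" using carrier_in_unit_nbhds by blast
  fix V W assume "V \<in> unit_nbhds" "W \<in> unit_nbhds"
  then show "\<exists>U\<in>unit_nbhds. principal {Z \<in> unit_nbhds. Z \<subseteq> U} \<le>
      inf (principal {Z \<in> unit_nbhds. Z \<subseteq> V}) (principal {Z \<in> unit_nbhds. Z \<subseteq> W})"
    by (intro bexI[of _ "V \<inter> W"]) (auto simp: unit_nbhds_def)
qed (auto simp: eventually_principal)

lemma unit_filter_neq_bot: "unit_filter \<noteq> bot"
  unfolding trivial_limit_def eventually_unit_filter by blast

lemma covers_exists:
  assumes "V \<in> unit_nbhds" "A \<subseteq> carrier G"
  shows "\<exists>F. covers V A F"
proof -
  have V: "openin \<tau> V" "\<one> \<in> V" using assms by (auto simp: unit_nbhds_def)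
  have "topspace \<tau> \<subseteq> \<Union> ((\<lambda>g. right_translate g V) ` carrier G)"
  proof
    fix g assume "g \<in> topspace \<tau>"
    then have "g \<in> carrier G" "g = \<one> \<otimes> g" by (auto simp: topspace_eq)
    then show "g \<in> \<Union> ((\<lambda>g. right_translate g V) ` carrier G)" using V(2) by blast
  qed
  moreover have "\<forall>U\<in>(\<lambda>g. right_translate g V) ` carrier G. openin \<tau> U"
    using V by (auto intro: openin_right_translate)
  ultimately obtain \<F> where "finite \<F>" "\<F> \<subseteq> (\<lambda>g. right_translate g V) ` carrier G" "topspace \<tau> \<subseteq> \<Union>\<F>"
    using compact unfolding compact_space_def compactin_def by meson
  moreover then obtain F where "F \<subseteq> carrier G" "finite F" "\<F> = (\<lambda>g. right_translate g V) ` F"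
    using finite_subset_image by metis
  ultimately have "covers V A F" using assms(2) by (auto simp: covers_def topspace_eq)
  then show ?thesis by blast
qed

lemma covering_number_le: "covers V A F \<Longrightarrow> covering_number V A \<le> card F"
  unfolding covering_number_def by (rule Least_le) blast

lemma covering_number_witness:
  assumes "V \<in> unit_nbhds" "A \<subseteq> carrier G"
  obtains F where "covers V A F" "card F = covering_number V A"
proof -
  have "\<exists>F. covers V A F \<and> card F = covering_number V A"
    unfolding covering_number_def by (rule LeastI_ex) (use covers_exists[OF assms] in blast)
  then show ?thesis using that by blast
qed

lemma covering_number_empty: "covering_number V {} = 0"
  using covering_number_le[of V "{}" "{}"] by (simp add: covers_def)

lemma covering_number_mono:
  assumes "V \<in> unit_nbhds" "B \<subseteq> carrier G" "A \<subseteq> B"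
  shows "covering_number V A \<le> covering_number V B"
proof -
  obtain F where "covers V B F" "card F = covering_number V B"
    using covering_number_witness assms(1,2) by blast
  then show ?thesis using covering_number_le[of V A F] assms by (auto simp: covers_def)
qed

lemma covering_number_Un:
  assumes "V \<in> unit_nbhds" "A \<subseteq> carrier G" "B \<subseteq> carrier G"
  shows "covering_number V (A \<union> B) \<le> covering_number V A + covering_number V B"
proof -
  obtain E F where "covers V A E" "card E = covering_number V A"
    "covers V B F" "card F = covering_number V B"
    using covering_number_witness assms by metis
  moreover then have "covers V (A \<union> B) (E \<union> F)" unfolding covers_def by blast
  ultimately show ?thesis using covering_number_le[of V "A \<union> B" "E \<union> F"] card_Un_le[of E F]
    by linarith
qed

text \<open>No translate in an optimal cover of the union meets both sets, so the cover splits into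
  disjoint covers of \<open>A\<close> and of \<open>B\<close>.\<close>

lemma covering_number_Un_separated:
  assumes V: "V \<in> unit_nbhds" and "A \<subseteq> carrier G" "B \<subseteq> carrier G"
    and sep: "\<And>g. g \<in> carrier G \<Longrightarrow> right_translate g V \<inter> A = {} \<or> right_translate g V \<inter> B = {}"
  shows "covering_number V A + covering_number V B \<le> covering_number V (A \<union> B)"
proof -
  obtain F where F: "covers V (A \<union> B) F" "card F = covering_number V (A \<union> B)"
    using covering_number_witness[OF V, of "A \<union> B"] assms by blast
  define E where "E = {g \<in> F. right_translate g V \<inter> A \<noteq> {}}"
  define E' where "E' = {g \<in> F. right_translate g V \<inter> B \<noteq> {}}"
  have fin: "finite F" using F by (simp add: covers_def)
  have "A \<subseteq> (\<Union>g\<in>E. right_translate g V)" "B \<subseteq> (\<Union>g\<in>E'. right_translate g V)"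
    using F unfolding covers_def E_def E'_def by blast+
  moreover have "finite E" "finite E'" "E \<subseteq> carrier G" "E' \<subseteq> carrier G"
    using F unfolding covers_def E_def E'_def by auto
  ultimately have "covers V A E" "covers V B E'" by (auto simp: covers_def)
  moreover have "E \<inter> E' = {}" using sep F by (auto simp: E_def E'_def covers_def)
  moreover have "E \<union> E' \<subseteq> F" by (auto simp: E_def E'_def)
  ultimately show ?thesis
    using covering_number_le[of V A E] covering_number_le[of V B E'] F(2)
      card_Un_disjoint[of E E'] card_mono[OF fin, of "E \<union> E'"] finite_subset[OF _ fin, of E]
      finite_subset[OF _ fin, of E'] by simp
qed

lemma covering_number_translate_le:
  assumes V: "V \<in> unit_nbhds" and A: "A \<subseteq> carrier G" and k: "k \<in> carrier G"
  shows "covering_number V (right_translate k A) \<le> covering_number V A"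
proof -
  obtain F where F: "covers V A F" "card F = covering_number V A"
    using covering_number_witness[OF V A] by blast
  have Vc: "V \<subseteq> carrier G" using V openin_subset by (auto simp: unit_nbhds_def simp flip: topspace_eq)
  have "covers V (right_translate k A) (right_translate k F)"
    unfolding covers_def
  proof (intro conjI)
    show "finite (right_translate k F)" "right_translate k F \<subseteq> carrier G"
      using F k by (auto simp: covers_def)
    show "right_translate k A \<subseteq> (\<Union>g\<in>right_translate k F. right_translate g V)"
    proof clarify
      fix a assume "a \<in> A"
      then obtain g v where "g \<in> F" "v \<in> V" "a = v \<otimes> g" using F by (auto simp: covers_def)
      moreover then have "a \<otimes> k = v \<otimes> (g \<otimes> k)"
        using F Vc k by (auto simp: covers_def m_assoc subset_iff)
      ultimately show "a \<otimes> k \<in> (\<Union>g\<in>right_translate k F. right_translate g V)" by blast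
    qed
  qed
  then have "covering_number V (right_translate k A) \<le> card (right_translate k F)"
    by (rule covering_number_le)
  also have "\<dots> \<le> card F" using F by (intro card_image_le) (auto simp: covers_def)
  finally show ?thesis using F by simp
qed

text \<open>The set \<open>D\<close> of quotients of points of \<open>A\<close> by points of
  \<open>B\<close> is compact and misses the unit. If \<open>V\<close> is so small that its own
  quotients avoid \<open>D\<close>, then no right translate meets both sets, because
  \<open>u \<otimes> g\<close> and \<open>v \<otimes> g\<close> have the quotient
  \<open>u \<otimes> inv v\<close>.\<close>

lemma eventually_separated:
  assumes A: "closedin \<tau> A" and B: "closedin \<tau> B" and disj: "A \<inter> B = {}"
  shows "eventually (\<lambda>V. \<forall>g\<in>carrier G. right_translate g V \<inter> A = {} \<or> right_translate g V \<inter> B = {})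
           unit_filter"
proof -
  have quot: "continuous_map (prod_topology \<tau> \<tau>) \<tau> (\<lambda>(a, b). a \<otimes> inv b)"
  proof -
    have "continuous_map (prod_topology \<tau> \<tau>) (prod_topology \<tau> \<tau>) (\<lambda>(a, b). (a, inv b))"
      by (simp add: continuous_map_pairwise case_prod_unfold o_def continuous_map_fst
          continuous_map_compose[OF continuous_map_snd continuous_inv, unfolded o_def])
    from continuous_map_compose[OF this continuous_mult] show ?thesis
      by (simp add: o_def case_prod_unfold)
  qed
  define D where "D = (\<lambda>(a, b). a \<otimes> inv b) ` (A \<times> B)"
  have "compactin (prod_topology \<tau> \<tau>) (A \<times> B)"
    using A B compact by (simp add: compactin_Times closedin_compact_space)
  then have "compactin \<tau> D" unfolding D_def by (rule image_compactin[OF _ quot])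
  then have "closedin \<tau> D" using Hausdorff compactin_imp_closedin by blast
  then have Dopen: "openin \<tau> (topspace \<tau> - D)" by blast
  have Ac: "A \<subseteq> carrier G" "B \<subseteq> carrier G"
    using A B closedin_subset by (auto simp flip: topspace_eq)
  have "\<one> \<notin> D"
  proof
    assume "\<one> \<in> D"
    then obtain a b where ab: "a \<in> A" "b \<in> B" "a \<otimes> inv b = \<one>" by (auto simp: D_def)
    then have "a = b" using Ac by (metis inv_closed inv_equality inv_inv subsetD)
    then show False using ab disj by blast
  qed
  define O' where "O' = {p \<in> topspace (prod_topology \<tau> \<tau>). (\<lambda>(a, b). a \<otimes> inv b) p \<in> topspace \<tau> - D}"
  have O'open: "openin (prod_topology \<tau> \<tau>) O'"
    unfolding O'_def by (rule openin_continuous_map_preimage[OF quot Dopen])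
  have "(\<one>, \<one>) \<in> O'" using \<open>\<one> \<notin> D\<close> by (simp add: O'_def topspace_eq)
  then obtain V W where VW: "openin \<tau> V" "openin \<tau> W" "\<one> \<in> V" "\<one> \<in> W" "V \<times> W \<subseteq> O'"
    using O'open[unfolded openin_prod_topology_alt, rule_format, of \<one> \<one>] by metis
  show ?thesis
    unfolding eventually_unit_filter
  proof (intro bexI[of _ "V \<inter> W"] ballI impI)
    show "V \<inter> W \<in> unit_nbhds" using VW by (auto simp: unit_nbhds_def)
    fix U g assume U: "U \<in> unit_nbhds" "U \<subseteq> V \<inter> W" and g: "g \<in> carrier G"
    have Uc: "U \<subseteq> carrier G" using U(1) openin_subset by (auto simp: unit_nbhds_def simp flip: topspace_eq)
    show "right_translate g U \<inter> A = {} \<or> right_translate g U \<inter> B = {}"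
    proof (rule ccontr)
      assume "\<not> ?thesis"
      then obtain u v where uv: "u \<in> U" "v \<in> U" "u \<otimes> g \<in> A" "v \<otimes> g \<in> B" by blast
      then have uvc: "u \<in> carrier G" "v \<in> carrier G" using Uc by auto
      have "(u \<otimes> g) \<otimes> inv (v \<otimes> g) = u \<otimes> (g \<otimes> (inv g \<otimes> inv v))"
        using uvc g by (simp add: inv_mult_group m_assoc)
      also have "g \<otimes> (inv g \<otimes> inv v) = inv v"
        using uvc g by (simp flip: m_assoc)
      finally have "(u \<otimes> g) \<otimes> inv (v \<otimes> g) = u \<otimes> inv v" .
      then have "u \<otimes> inv v \<in> D" unfolding D_def using uv by (intro image_eqI[of _ _ "(u \<otimes> g, v \<otimes> g)"]) auto
      moreover have "(u, v) \<in> O'" using uv U VW by blast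
      ultimately show False by (simp add: O'_def)
    qed
  qed
qed

lemma right_translate_inverse:
  assumes "k \<in> carrier G" "A \<subseteq> carrier G"
  shows "right_translate (inv k) (right_translate k A) = A" "right_translate k (right_translate (inv k) A) = A"
proof -
  have "a \<otimes> k \<otimes> inv k = a" "a \<otimes> inv k \<otimes> k = a" if "a \<in> A" for a
    using that assms by (simp_all add: m_assoc subsetD)
  then show "right_translate (inv k) (right_translate k A) = A" "right_translate k (right_translate (inv k) A) = A"
    by (simp_all add: image_image)
qed

text \<open>The content is a limit of covering numbers divided by the covering number of the whole
  group, as the neighbourhood shrinks. Each ratio is monotone, subadditive and right invariant;
  additivity on disjoint closed sets holds for it only once the neighbourhood separates the two
  sets, hence in the limit.\<close>

lemma right_invariant_content:
  obtains l :: "'a set \<Rightarrow> ennreal" where "l {} = 0" "l (carrier G) = 1"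
    "\<And>A B. closedin \<tau> A \<Longrightarrow> closedin \<tau> B \<Longrightarrow> A \<subseteq> B \<Longrightarrow> l A \<le> l B"
    "\<And>A B. closedin \<tau> A \<Longrightarrow> closedin \<tau> B \<Longrightarrow> l (A \<union> B) \<le> l A + l B"
    "\<And>A B. closedin \<tau> A \<Longrightarrow> closedin \<tau> B \<Longrightarrow> A \<inter> B = {} \<Longrightarrow> l A + l B \<le> l (A \<union> B)"
    "\<And>A k. closedin \<tau> A \<Longrightarrow> k \<in> carrier G \<Longrightarrow> l (right_translate k A) = l A"
proof -
  \<comment> \<open>The value 0 outside the relevant arguments keeps every ratio in the unit
    interval, as the compactness argument requires.\<close>
  define u where "u V A = (if V \<in> unit_nbhds \<and> closedin \<tau> A
    then real (covering_number V A) / real (covering_number V (carrier G)) else 0)" for V A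
  have pos: "covering_number V (carrier G) > 0" if V: "V \<in> unit_nbhds" for V
  proof -
    obtain F where F: "covers V (carrier G) F" "card F = covering_number V (carrier G)"
      using covering_number_witness[OF V] by blast
    then have "F \<noteq> {}" using one_closed by (auto simp: covers_def)
    then show ?thesis using F by (metis card_gt_0_iff covers_def)
  qed
  have closed_sub: "closedin \<tau> A \<Longrightarrow> A \<subseteq> carrier G" for A
    using closedin_subset topspace_eq by metis
  have u01: "u V A \<in> {0..1}" for V A
    using pos[of V] covering_number_mono[of V "carrier G" A] closed_sub by (auto simp: u_def)
  obtain H l where H: "H \<noteq> bot" "H \<le> unit_filter" and l: "\<And>A. ((\<lambda>V. u V A) \<longlongrightarrow> l A) H"
    by (rule filter_limit_unit_interval[OF unit_filter_neq_bot u01]) (rule that)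
  have ev: "eventually P H" if "eventually P unit_filter" for P
    using that H(2) by (simp add: filter_leD)
  have ev_nbhd: "eventually (\<lambda>V. V \<in> unit_nbhds) H"
    using carrier_in_unit_nbhds by (intro ev) (auto simp: eventually_unit_filter)
  have nonneg: "l A \<ge> 0" for A
    using l[of A] by (rule tendsto_lowerbound[OF _ _ H(1)]) (simp add: u_def)
  have le: "l A \<le> l B" if "\<And>V. V \<in> unit_nbhds \<Longrightarrow> u V A \<le> u V B" for A B
    by (rule tendsto_le[OF H(1) l l]) (rule eventually_mono[OF ev_nbhd that])
  show ?thesis
  proof (rule that[of "\<lambda>A. ennreal (l A)"])
    have "l {} = 0"
      using tendsto_unique[OF H(1) l[of "{}"], of 0] by (simp add: u_def covering_number_empty cong: if_cong)
    then show "ennreal (l {}) = 0" by simp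
    have "closedin \<tau> (carrier G)" using closedin_topspace[of \<tau>] by (simp add: topspace_eq)
    then have "eventually (\<lambda>V. u V (carrier G) = 1) H"
      using ev_nbhd pos by (auto simp: u_def elim: eventually_mono)
    from tendsto_unique[OF H(1) l tendsto_eventually[OF this]] have "l (carrier G) = 1" .
    then show "ennreal (l (carrier G)) = 1" by simp
  next
    fix A B assume AB: "closedin \<tau> A" "closedin \<tau> B" "A \<subseteq> B"
    then show "ennreal (l A) \<le> ennreal (l B)"
      by (intro ennreal_leI le) (simp add: u_def divide_right_mono covering_number_mono closed_sub)
  next
    fix A B assume AB: "closedin \<tau> A" "closedin \<tau> B"
    have "l (A \<union> B) \<le> l A + l B"
    proof (rule tendsto_le[OF H(1) tendsto_add[OF l l] l])
      show "eventually (\<lambda>V. u V (A \<union> B) \<le> u V A + u V B) H"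
        using ev_nbhd
      proof (rule eventually_mono)
        fix V assume V: "V \<in> unit_nbhds"
        have "real (covering_number V (A \<union> B)) \<le> real (covering_number V A) + real (covering_number V B)"
          using covering_number_Un[OF V closed_sub[OF AB(1)] closed_sub[OF AB(2)]] by simp
        from divide_right_mono[OF this, of "real (covering_number V (carrier G))"]
        show "u V (A \<union> B) \<le> u V A + u V B"
          using AB closedin_Un[OF AB] V by (simp add: u_def add_divide_distrib)
      qed
    qed
    then show "ennreal (l (A \<union> B)) \<le> ennreal (l A) + ennreal (l B)"
      using nonneg by (simp add: ennreal_leI flip: ennreal_plus)
    assume disj: "A \<inter> B = {}"
    have "l A + l B \<le> l (A \<union> B)"
    proof (rule tendsto_le[OF H(1) l tendsto_add[OF l l]])
      show "eventually (\<lambda>V. u V A + u V B \<le> u V (A \<union> B)) H"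
        using ev[OF eventually_separated[OF AB disj]] ev_nbhd
      proof eventually_elim
        fix V assume V: "V \<in> unit_nbhds"
          "\<forall>g\<in>carrier G. right_translate g V \<inter> A = {} \<or> right_translate g V \<inter> B = {}"
        then have "covering_number V A + covering_number V B \<le> covering_number V (A \<union> B)"
          using closed_sub[OF AB(1)] closed_sub[OF AB(2)] by (intro covering_number_Un_separated) auto
        then have "real (covering_number V A) + real (covering_number V B) \<le> real (covering_number V (A \<union> B))"
          by simp
        from divide_right_mono[OF this, of "real (covering_number V (carrier G))"]
        show "u V A + u V B \<le> u V (A \<union> B)"
          using AB closedin_Un[OF AB] V by (simp add: u_def add_divide_distrib)
      qed
    qed
    then show "ennreal (l A) + ennreal (l B) \<le> ennreal (l (A \<union> B))"
      using nonneg by (simp add: ennreal_leI flip: ennreal_plus)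
  next
    have *: "l (right_translate k A) \<le> l A" if "closedin \<tau> A" "k \<in> carrier G" for A k
      using that by (intro le) (simp add: u_def closed_sub closedin_right_translate
          divide_right_mono covering_number_translate_le)
    fix A k assume A: "closedin \<tau> A" and k: "k \<in> carrier G"
    have "l A \<le> l (right_translate k A)"
      using *[of "right_translate k A" "inv k"] A k
      by (simp add: closedin_right_translate right_translate_inverse closed_sub)
    then show "ennreal (l (right_translate k A)) = ennreal (l A)" using *[OF A k] by simp
  qed
qed

definition borel_group :: "'a measure" where
  "borel_group = sigma (carrier G) {U. openin \<tau> U}"

lemma space_borel_group [simp]: "space borel_group = carrier G"
  and sets_borel_group: "sets borel_group = sigma_sets (carrier G) {U. openin \<tau> U}"
  unfolding borel_group_def
  using openin_subset topspace_eq by (auto simp: space_measure_of_conv sets_measure_of_conv)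

lemma continuous_map_imp_measurable_borel_group:
  assumes "continuous_map \<tau> \<tau> f"
  shows "f \<in> borel_group \<rightarrow>\<^sub>M borel_group"
proof (rule measurable_sigma_sets[OF sets_borel_group])
  show "{U. openin \<tau> U} \<subseteq> Pow (carrier G)" using openin_subset topspace_eq by auto
  show "f \<in> space borel_group \<rightarrow> carrier G"
    using continuous_map_image_subset_topspace[OF assms] by (auto simp: topspace_eq)
  fix U assume "U \<in> {U. openin \<tau> U}"
  then have "openin \<tau> {x \<in> topspace \<tau>. f x \<in> U}"
    using openin_continuous_map_preimage[OF assms] by blast
  then show "f -` U \<inter> space borel_group \<in> sets borel_group"
    unfolding sets_borel_group by (intro sigma_sets.Basic) (auto simp: topspace_eq vimage_def Int_def conj_commute)
qed

text \<open>Right translation carries the closed subsets of an open set onto those of its translate,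
  so invariance of the content gives invariance of the measure on open sets. These form an
  intersection-stable generator containing the whole group, on which the measure is finite.\<close>

lemma right_Haar_exists:
  obtains m where "sets m = sets borel_group" "emeasure m (carrier G) = 1"
    "\<And>k. k \<in> carrier G \<Longrightarrow> distr m m (\<lambda>g. g \<otimes> k) = m"
proof -
  obtain l :: "'a set \<Rightarrow> ennreal" where l: "l {} = 0" "l (carrier G) = 1"
    "\<And>A B. closedin \<tau> A \<Longrightarrow> closedin \<tau> B \<Longrightarrow> A \<subseteq> B \<Longrightarrow> l A \<le> l B"
    "\<And>A B. closedin \<tau> A \<Longrightarrow> closedin \<tau> B \<Longrightarrow> l (A \<union> B) \<le> l A + l B"
    "\<And>A B. closedin \<tau> A \<Longrightarrow> closedin \<tau> B \<Longrightarrow> A \<inter> B = {} \<Longrightarrow> l A + l B \<le> l (A \<union> B)"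
    "\<And>A k. closedin \<tau> A \<Longrightarrow> k \<in> carrier G \<Longrightarrow> l (right_translate k A) = l A"
    using right_invariant_content by blast
  obtain m where m: "space m = topspace \<tau>" "sets m = sigma_sets (topspace \<tau>) {U. openin \<tau> U}"
    "\<And>U. openin \<tau> U \<Longrightarrow> emeasure m U = (SUP C\<in>{C. closedin \<tau> C \<and> C \<subseteq> U}. l C)"
    using content_extends_to_measure[of \<tau> l, OF compact Hausdorff l(1,3,4,5)] by blast
  have sets_m: "sets m = sets borel_group" by (simp add: m(2) sets_borel_group topspace_eq)
  have total: "emeasure m (carrier G) = 1"
  proof -
    have "openin \<tau> (carrier G)" "closedin \<tau> (carrier G)" by (simp_all flip: topspace_eq)
    then show ?thesis
      using l(2) l(3)[OF _ \<open>closedin \<tau> (carrier G)\<close>]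
      by (subst m(3)) (auto intro!: antisym SUP_least SUP_upper2[of "carrier G"])
  qed
  show ?thesis
  proof (rule that[OF sets_m total])
    fix k assume k: "k \<in> carrier G"
    have meas: "(\<lambda>g. g \<otimes> k) \<in> m \<rightarrow>\<^sub>M m"
      using continuous_map_imp_measurable_borel_group[OF continuous_map_right_mult[OF k]]
      by (simp cong: measurable_cong_sets add: sets_m)
    have agree: "emeasure (distr m m (\<lambda>g. g \<otimes> k)) U = emeasure m U" if "openin \<tau> U" for U
    proof -
      have U: "openin \<tau> U" "U \<subseteq> carrier G" using that openin_subset topspace_eq by auto
      have ik: "inv k \<in> carrier G" using k by simp
      have pre: "(\<lambda>g. g \<otimes> k) -` U \<inter> space m = right_translate (inv k) U"
        using right_translate_eq_vimage[OF ik U(2)] k by (simp add: m topspace_eq vimage_def Int_def conj_commute)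
      have "U \<in> sets m" using U by (simp add: m(2))
      then have "emeasure (distr m m (\<lambda>g. g \<otimes> k)) U = emeasure m (right_translate (inv k) U)"
        using meas pre by (simp add: emeasure_distr)
      also have "\<dots> = (SUP C\<in>{C. closedin \<tau> C \<and> C \<subseteq> right_translate (inv k) U}. l C)"
        by (rule m(3)) (rule openin_right_translate[OF ik U(1)])
      also have "{C. closedin \<tau> C \<and> C \<subseteq> right_translate (inv k) U} =
          right_translate (inv k) ` {C. closedin \<tau> C \<and> C \<subseteq> U}"
      proof (intro equalityI subsetI)
        fix C assume "C \<in> {C. closedin \<tau> C \<and> C \<subseteq> right_translate (inv k) U}"
        then have C: "closedin \<tau> C" "C \<subseteq> right_translate (inv k) U" by auto
        then have "C \<subseteq> carrier G" using closedin_subset topspace_eq by metis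
        then have "C = right_translate (inv k) (right_translate k C)"
          by (rule right_translate_inverse(1)[OF k, symmetric])
        moreover have "right_translate k C \<subseteq> right_translate k (right_translate (inv k) U)"
          using C(2) by (rule image_mono)
        then have "right_translate k C \<subseteq> U" unfolding right_translate_inverse(2)[OF k U(2)] .
        ultimately show "C \<in> right_translate (inv k) ` {C. closedin \<tau> C \<and> C \<subseteq> U}"
          using closedin_right_translate[OF k C(1)] by blast
      next
        fix D assume "D \<in> right_translate (inv k) ` {C. closedin \<tau> C \<and> C \<subseteq> U}"
        then obtain C where C: "D = right_translate (inv k) C" "closedin \<tau> C" "C \<subseteq> U" by blast
        then show "D \<in> {C. closedin \<tau> C \<and> C \<subseteq> right_translate (inv k) U}"
          using closedin_right_translate[OF ik C(2)] by blast
      qed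
      also have "(SUP C\<in>right_translate (inv k) ` {C. closedin \<tau> C \<and> C \<subseteq> U}. l C) =
          (SUP C\<in>{C. closedin \<tau> C \<and> C \<subseteq> U}. l C)"
        unfolding image_image using l(6)[OF _ ik] by (intro SUP_cong) simp_all
      also have "\<dots> = emeasure m U" by (simp add: m U)
      finally show ?thesis .
    qed
    have carrier: "openin \<tau> (carrier G)" "carrier G \<in> sets m"
      using sets.top[of m] by (simp_all add: m(1) flip: topspace_eq)
    have stable: "Int_stable {U. openin \<tau> U}" by (auto simp: Int_stable_def)
    have sub: "{U. openin \<tau> U} \<subseteq> Pow (carrier G)" using openin_subset topspace_eq by auto
    have sets: "sets m = sigma_sets (carrier G) {U. openin \<tau> U}" by (simp add: sets_m sets_borel_group)
    have fin: "emeasure (distr m m (\<lambda>g. g \<otimes> k)) (carrier G) \<noteq> \<infinity>"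
      unfolding agree[OF carrier(1)] total by simp
    have "distr m m (\<lambda>g. g \<otimes> k) = m"
      by (rule measure_eqI_generator_eq_countable[OF stable sub _ _ sets, of _ "{carrier G}"])
        (use agree sets carrier fin in simp_all)
    then show "distr m m (\<lambda>g. g \<otimes> k) = m" .
  qed
qed

end

section \<open>Compact metrizable groups and two-sided Haar measure\<close>

lemma compact_metrizable_imp_second_countable:
  assumes "compact_space X" "metrizable_space X"
  shows "second_countable X"
proof -
  obtain M d where "Metric_space M d" and X: "X = Metric_space.mtopology M d"
    using assms(2) unfolding metrizable_space_def by blast
  then interpret Metric_space M d by simp
  have "\<exists>F. finite F \<and> F \<subseteq> M \<and> M \<subseteq> (\<Union>x\<in>F. mball x (inverse (Suc n)))" for n
  proof -
    have c1: "compactin mtopology M" using assms(1) X by (simp add: compact_space_def)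
    have c2: "openin mtopology U" if "U \<in> (\<lambda>x. mball x (inverse (Suc n))) ` M" for U using that by auto
    have c3: "M \<subseteq> \<Union> ((\<lambda>x. mball x (inverse (Suc n))) ` M)" by auto
    have "\<exists>\<F>. finite \<F> \<and> \<F> \<subseteq> (\<lambda>x. mball x (inverse (Suc n))) ` M \<and> M \<subseteq> \<Union>\<F>"
      by (rule compactinD[OF c1 _ c3]) (rule c2)
    then obtain \<F> where "finite \<F>" "\<F> \<subseteq> (\<lambda>x. mball x (inverse (Suc n))) ` M" "M \<subseteq> \<Union>\<F>"
      by (elim exE conjE) (rule that)
    moreover then obtain F where "F \<subseteq> M" "finite F" "\<F> = (\<lambda>x. mball x (inverse (Suc n))) ` F"
      using finite_subset_image by metis
    ultimately show ?thesis by blast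
  qed
  then obtain F where F: "\<And>n. finite (F n)" "\<And>n. F n \<subseteq> M" "\<And>n. M \<subseteq> (\<Union>x\<in>F n. mball x (inverse (Suc n)))"
    by metis
  define \<B> where "\<B> = (\<Union>n. (\<lambda>x. mball x (inverse (Suc n))) ` F n)"
  have "\<exists>V\<in>\<B>. x \<in> V \<and> V \<subseteq> U" if U: "openin mtopology U" "x \<in> U" for U x
  proof -
    obtain r where r: "r > 0" "mball x r \<subseteq> U" and x: "x \<in> M"
      using U unfolding openin_mtopology by blast
    obtain n where n: "inverse (Suc n) < r / 2" using r(1) reals_Archimedean[of "r/2"] by auto
    obtain y where y: "y \<in> F n" "x \<in> mball y (inverse (Suc n))" using F(3)[of n] x by blast
    have "mball y (inverse (Suc n)) \<subseteq> mball x r"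
    proof
      fix z assume z: "z \<in> mball y (inverse (Suc n))"
      then have "d x z \<le> d x y + d y z" using x y F(2) by (intro triangle) auto
      also have "\<dots> < r" using y z n by (simp add: commute)
      finally show "z \<in> mball x r" using x z by simp
    qed
    then show ?thesis using y r by (intro bexI[of _ "mball y (inverse (Suc n))"]) (auto simp: \<B>_def)
  qed
  moreover have "countable \<B>" using F(1) by (auto simp: \<B>_def intro: countable_finite)
  moreover have "\<forall>V\<in>\<B>. openin mtopology V" by (auto simp: \<B>_def)
  ultimately show ?thesis unfolding second_countable_def X by blast
qed

locale compact_metrizable_group = compact_Hausdorff_group +
  assumes metrizable: "metrizable_space \<tau>"
begin

text \<open>A countable base writes every open set of the product topology as a countable union of
  open rectangles, which places it in the product of the Borel sigma-algebras. Fubini can then be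
  applied to functions of \<open>g \<otimes> h\<close>.\<close>

lemma measurable_mult: "(\<lambda>(g, h). g \<otimes> h) \<in> borel_group \<Otimes>\<^sub>M borel_group \<rightarrow>\<^sub>M borel_group"
proof (rule measurable_sigma_sets[OF sets_borel_group])
  show "{U. openin \<tau> U} \<subseteq> Pow (carrier G)" using openin_subset topspace_eq by auto
  show "(\<lambda>(g, h). g \<otimes> h) \<in> space (borel_group \<Otimes>\<^sub>M borel_group) \<rightarrow> carrier G"
    by (auto simp: space_pair_measure)
  obtain \<B> where \<B>: "countable \<B>" "\<And>V. V \<in> \<B> \<Longrightarrow> openin \<tau> V"
    "\<And>U x. openin \<tau> U \<Longrightarrow> x \<in> U \<Longrightarrow> \<exists>V\<in>\<B>. x \<in> V \<and> V \<subseteq> U"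
    using compact_metrizable_imp_second_countable[OF compact metrizable]
    unfolding second_countable_def by metis
  fix U assume "U \<in> {U. openin \<tau> U}"
  define O' where "O' = {p \<in> topspace (prod_topology \<tau> \<tau>). (\<lambda>(g, h). g \<otimes> h) p \<in> U}"
  have O'open: "openin (prod_topology \<tau> \<tau>) O'"
    unfolding O'_def by (rule openin_continuous_map_preimage[OF continuous_mult]) (use \<open>U \<in> _\<close> in simp)
  define R where "R = {(V, W). V \<in> \<B> \<and> W \<in> \<B> \<and> V \<times> W \<subseteq> O'}"
  have "O' \<subseteq> (\<Union>(V, W)\<in>R. V \<times> W)"
  proof clarify
    fix g h assume "(g, h) \<in> O'"
    then obtain V W where "openin \<tau> V" "openin \<tau> W" "g \<in> V" "h \<in> W" "V \<times> W \<subseteq> O'"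
      using O'open[unfolded openin_prod_topology_alt, rule_format, of g h] by metis
    moreover then obtain V' W' where "V' \<in> \<B>" "g \<in> V'" "V' \<subseteq> V" "W' \<in> \<B>" "h \<in> W'" "W' \<subseteq> W"
      using \<B>(3) by meson
    ultimately have "(V', W') \<in> R" "g \<in> V'" "h \<in> W'" by (auto simp: R_def)
    then show "(g, h) \<in> (\<Union>(V, W)\<in>R. V \<times> W)" by blast
  qed
  then have O'_eq: "O' = (\<Union>(V, W)\<in>R. V \<times> W)" by (auto simp: R_def)
  have "countable R"
    by (rule countable_subset[of _ "\<B> \<times> \<B>"]) (auto simp: R_def \<B>(1))
  then have "O' \<in> sets (borel_group \<Otimes>\<^sub>M borel_group)"
    unfolding O'_eq using \<B>(2)
    by (intro sets.countable_UN') (auto simp: R_def sets_borel_group intro!: pair_measureI)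
  moreover have "(\<lambda>(g, h). g \<otimes> h) -` U \<inter> space (borel_group \<Otimes>\<^sub>M borel_group) = O'"
    by (auto simp: O'_def space_pair_measure topspace_eq)
  ultimately show "(\<lambda>(g, h). g \<otimes> h) -` U \<inter> space (borel_group \<Otimes>\<^sub>M borel_group)
      \<in> sets (borel_group \<Otimes>\<^sub>M borel_group)" by simp
qed

text \<open>
  A right invariant probability measure \<open>m\<close> and the left invariant \<open>m'\<close> obtained from it by inversion
  coincide, because \<open>\<integral>\<integral> u (g \<otimes> h) dm(g) dm'(h)\<close> equals both \<open>\<integral> u dm\<close> and \<open>\<integral> u dm'\<close>.
\<close>

theorem Haar_exists:
  obtains m where "sets m = sets borel_group" "prob_space m"
    "\<And>k. k \<in> carrier G \<Longrightarrow> distr m m (\<lambda>g. g \<otimes> k) = m"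
    "\<And>k. k \<in> carrier G \<Longrightarrow> distr m m (\<lambda>g. k \<otimes> g) = m"
proof -
  obtain m where sets_m[measurable_cong]: "sets m = sets borel_group" and total: "emeasure m (carrier G) = 1"
    and right: "\<And>k. k \<in> carrier G \<Longrightarrow> distr m m (\<lambda>g. g \<otimes> k) = m"
    using right_Haar_exists by metis
  have space_m: "space m = carrier G" using sets_eq_imp_space_eq[OF sets_m] by simp
  have prob: "prob_space m" by (rule prob_spaceI) (simp add: space_m total)
  interpret m: prob_space m by (rule prob)
  have [measurable]: "(\<lambda>g. inv g) \<in> borel_group \<rightarrow>\<^sub>M borel_group"
    by (rule continuous_map_imp_measurable_borel_group[OF continuous_inv])
  note [measurable] = measurable_mult
  have l_meas[measurable]: "(\<lambda>g. k \<otimes> g) \<in> borel_group \<rightarrow>\<^sub>M borel_group"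
    and r_meas[measurable]: "(\<lambda>g. g \<otimes> k) \<in> borel_group \<rightarrow>\<^sub>M borel_group" if "k \<in> carrier G" for k
    using that continuous_map_imp_measurable_borel_group continuous_map_left_mult continuous_map_right_mult
    by auto
  define m' where "m' = distr m m (\<lambda>g. inv g)"
  have sets_m'[measurable_cong]: "sets m' = sets borel_group" by (simp add: m'_def sets_m)
  have space_m': "space m' = carrier G" using sets_eq_imp_space_eq[OF sets_m'] by simp
  have prob': "prob_space m'" unfolding m'_def by (rule m.prob_space_distr) measurable
  interpret m': prob_space m' by (rule prob')
  have left': "distr m' m' (\<lambda>g. k \<otimes> g) = m'" if k: "k \<in> carrier G" for k
  proof -
    have "distr m' m' (\<lambda>g. k \<otimes> g) = distr m m' (\<lambda>g. k \<otimes> inv g)"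
      unfolding m'_def using k by (subst distr_distr) (auto simp: o_def m'_def[symmetric])
    also have "\<dots> = distr m m' (\<lambda>g. inv (g \<otimes> inv k))"
      using k by (intro distr_cong) (auto simp: space_m inv_mult_group)
    also have "\<dots> = distr (distr m m (\<lambda>g. g \<otimes> inv k)) m' (\<lambda>g. inv g)"
      using k by (subst distr_distr) (auto simp: o_def)
    also have "\<dots> = m'" using k right[of "inv k"] by (simp add: m'_def) (rule distr_cong, auto)
    finally show ?thesis .
  qed
  have "m = m'"
  proof (rule measure_eqI)
    show "sets m = sets m'" by (simp add: sets_m sets_m')
    fix A assume "A \<in> sets m"
    then have [measurable]: "A \<in> sets borel_group" by (simp add: sets_m)
    interpret P: pair_sigma_finite m m' by unfold_locales
    have mA: "(\<integral>\<^sup>+ g. indicator A (g \<otimes> h) \<partial>m) = emeasure m A" if "h \<in> carrier G" for h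
    proof -
      have "emeasure m A = (\<integral>\<^sup>+ g. indicator A g \<partial>distr m m (\<lambda>g. g \<otimes> h))"
        using right[OF that] by simp
      also have "\<dots> = (\<integral>\<^sup>+ g. indicator A (g \<otimes> h) \<partial>m)"
        using that by (subst nn_integral_distr) auto
      finally show ?thesis ..
    qed
    have m'A: "(\<integral>\<^sup>+ h. indicator A (g \<otimes> h) \<partial>m') = emeasure m' A" if "g \<in> carrier G" for g
    proof -
      have "emeasure m' A = (\<integral>\<^sup>+ h. indicator A h \<partial>distr m' m' (\<lambda>h. g \<otimes> h))"
        using left'[OF that] by simp
      also have "\<dots> = (\<integral>\<^sup>+ h. indicator A (g \<otimes> h) \<partial>m')"
        using that by (subst nn_integral_distr) auto
      finally show ?thesis ..
    qed
    have "emeasure m A = (\<integral>\<^sup>+ h. \<integral>\<^sup>+ g. indicator A (g \<otimes> h) \<partial>m \<partial>m')"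
    proof -
      have "(\<integral>\<^sup>+ h. \<integral>\<^sup>+ g. indicator A (g \<otimes> h) \<partial>m \<partial>m') = (\<integral>\<^sup>+ h. emeasure m A \<partial>m')"
        by (rule nn_integral_cong) (simp add: mA space_m')
      then show ?thesis by (simp add: m'.emeasure_space_1)
    qed
    also have "\<dots> = (\<integral>\<^sup>+ g. \<integral>\<^sup>+ h. indicator A (g \<otimes> h) \<partial>m' \<partial>m)"
      by (rule P.Fubini') measurable
    also have "\<dots> = emeasure m' A"
    proof -
      have "(\<integral>\<^sup>+ g. \<integral>\<^sup>+ h. indicator A (g \<otimes> h) \<partial>m' \<partial>m) = (\<integral>\<^sup>+ g. emeasure m' A \<partial>m)"
        by (rule nn_integral_cong) (simp add: m'A space_m)
      then show ?thesis by (simp add: m.emeasure_space_1)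
    qed
    finally show "emeasure m A = emeasure m' A" .
  qed
  then have "distr m m (\<lambda>g. k \<otimes> g) = m" if "k \<in> carrier G" for k
    using left'[OF that] by simp
  then show ?thesis using that[OF sets_m prob right] by blast
qed

end

section \<open>The groups \<open>K n\<close>, their Haar measures and the Borel sets of the
  union\<close>

context inductively_compact_group
begin

abbreviation K_group :: "nat \<Rightarrow> _" where
  "K_group n \<equiv> G\<lparr>carrier := topspace (K n)\<rparr>"

lemma inv_K_group: "g \<in> topspace (K n) \<Longrightarrow> inv\<^bsub>K_group n\<^esub> g = inv g"
  using m_inv_consistent[OF subgroup_K] by simp

lemma K_group_compact_metrizable: "compact_metrizable_group (K_group n) (K n)"
proof -
  have "group (K_group n)" by (rule subgroup.subgroup_is_group[OF subgroup_K]) (rule group_axioms)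
  moreover have "continuous_map (K n) (K n) (\<lambda>g. inv\<^bsub>K_group n\<^esub> g)"
    using continuous_inv[of n] by (rule continuous_map_eq) (simp add: inv_K_group)
  ultimately show ?thesis
    using continuous_mult compact_K metrizable_K metrizable_imp_Hausdorff_space[OF metrizable_K]
    unfolding compact_metrizable_group_def compact_Hausdorff_group_def compact_metrizable_group_axioms_def
      compact_Hausdorff_group_axioms_def by simp
qed

definition K_borel :: "nat \<Rightarrow> 'a measure" where
  "K_borel n = sigma (topspace (K n)) {U. openin (K n) U}"

lemma K_borel_eq: "K_borel n = compact_Hausdorff_group.borel_group (K_group n) (K n)"
proof -
  interpret compact_metrizable_group "K_group n" "K n" by (rule K_group_compact_metrizable)
  show ?thesis by (simp add: borel_group_def K_borel_def)
qed

lemma space_K_borel [simp]: "space (K_borel n) = topspace (K n)"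
  and sets_K_borel: "sets (K_borel n) = sigma_sets (topspace (K n)) {U. openin (K n) U}"
  unfolding K_borel_def using openin_subset by (auto simp: space_measure_of_conv sets_measure_of_conv)

definition Haar :: "nat \<Rightarrow> 'a measure" where
  "Haar n = (SOME m. sets m = sets (K_borel n) \<and> prob_space m \<and>
     (\<forall>k\<in>topspace (K n). distr m m (\<lambda>g. g \<otimes> k) = m \<and> distr m m (\<lambda>g. k \<otimes> g) = m))"

lemma Haar:
  shows sets_Haar [measurable_cong]: "sets (Haar n) = sets (K_borel n)"
    and prob_space_Haar: "prob_space (Haar n)"
    and right_invariant_Haar: "k \<in> topspace (K n) \<Longrightarrow> distr (Haar n) (Haar n) (\<lambda>g. g \<otimes> k) = Haar n"
    and left_invariant_Haar: "k \<in> topspace (K n) \<Longrightarrow> distr (Haar n) (Haar n) (\<lambda>g. k \<otimes> g) = Haar n"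
proof -
  interpret compact_metrizable_group "K_group n" "K n" by (rule K_group_compact_metrizable)
  obtain m where "sets m = sets (K_borel n)" "prob_space m"
    "\<And>k. k \<in> topspace (K n) \<Longrightarrow> distr m m (\<lambda>g. g \<otimes> k) = m"
    "\<And>k. k \<in> topspace (K n) \<Longrightarrow> distr m m (\<lambda>g. k \<otimes> g) = m"
    using Haar_exists unfolding K_borel_eq by auto
  then have "\<exists>m. sets m = sets (K_borel n) \<and> prob_space m \<and>
     (\<forall>k\<in>topspace (K n). distr m m (\<lambda>g. g \<otimes> k) = m \<and> distr m m (\<lambda>g. k \<otimes> g) = m)" by blast
  from someI_ex[OF this]
  show "sets (Haar n) = sets (K_borel n)" "prob_space (Haar n)"
    "k \<in> topspace (K n) \<Longrightarrow> distr (Haar n) (Haar n) (\<lambda>g. g \<otimes> k) = Haar n"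
    "k \<in> topspace (K n) \<Longrightarrow> distr (Haar n) (Haar n) (\<lambda>g. k \<otimes> g) = Haar n"
    unfolding Haar_def by blast+
qed

lemma space_Haar [simp]: "space (Haar n) = topspace (K n)"
  using sets_eq_imp_space_eq[OF sets_Haar] by simp

lemma K_mono: "m \<le> n \<Longrightarrow> topspace (K m) \<subseteq> topspace (K n)"
  using K_subset by (rule lift_Suc_mono_le)

lemma K_subtopology_mono: "m \<le> n \<Longrightarrow> subtopology (K n) (topspace (K m)) = K m"
proof (induction n rule: dec_induct)
  case (step n)
  have "subtopology (K (Suc n)) (topspace (K m)) =
      subtopology (subtopology (K (Suc n)) (topspace (K n))) (topspace (K m))"
    using K_mono[OF step(1)] by (simp add: subtopology_subtopology Int_absorb1)
  then show ?case using step K_subtopology by simp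
qed simp

lemma space_group_borel: "space (group_borel K) = carrier G"
  and sets_group_borel: "sets (group_borel K) =
    sigma_sets (carrier G) (\<Union>n. sigma_sets (topspace (K n)) {U. openin (K n) U})"
proof -
  have "(\<Union>n. sigma_sets (topspace (K n)) {U. openin (K n) U}) \<subseteq> Pow (carrier G)"
  proof (intro UN_least subsetI PowI)
    fix n A g assume "A \<in> sigma_sets (topspace (K n)) {U. openin (K n) U}" "g \<in> A"
    then have "g \<in> topspace (K n)"
      using sigma_sets_into_sp[of "{U. openin (K n) U}" "topspace (K n)" A] openin_subset by blast
    then show "g \<in> carrier G" by (auto simp: carrier_eq)
  qed
  then show "space (group_borel K) = carrier G" "sets (group_borel K) =
    sigma_sets (carrier G) (\<Union>n. sigma_sets (topspace (K n)) {U. openin (K n) U})"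
    unfolding group_borel_def carrier_eq[symmetric] by (simp_all add: space_measure_of_conv sets_measure_of_conv)
qed

text \<open>A generator comes from some \<open>K m\<close>. If \<open>m \<le> n\<close>, then
  \<open>K m\<close> is compact, hence closed in \<open>K n\<close>, and its Borel sets are Borel in
  \<open>K n\<close>. Otherwise \<open>K n\<close> carries the subspace topology of
  \<open>K m\<close>, and the trace of a Borel set is Borel.\<close>

lemma measurable_K_inclusion: "(\<lambda>g. g) \<in> K_borel n \<rightarrow>\<^sub>M group_borel K"
proof (rule measurable_sigma_sets[OF sets_group_borel])
  show "(\<Union>n. sigma_sets (topspace (K n)) {U. openin (K n) U}) \<subseteq> Pow (carrier G)"
    using sets.sets_into_space[of _ "group_borel K"]
    by (auto simp: space_group_borel sets_group_borel intro: sigma_sets.Basic)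
  show "(\<lambda>g. g) \<in> space (K_borel n) \<rightarrow> carrier G" by (auto simp: carrier_eq)
  fix A assume "A \<in> (\<Union>n. sigma_sets (topspace (K n)) {U. openin (K n) U})"
  then obtain m where "A \<in> sigma_sets (topspace (K m)) {U. openin (K m) U}" by blast
  then have A: "A \<in> sets (K_borel m)" by (simp add: sets_K_borel)
  have "A \<inter> topspace (K n) \<in> sets (K_borel n)"
  proof (cases "m \<le> n")
    case True
    have "compactin (K n) (topspace (K m))"
      using compact_K[of m] True K_mono[OF True]
      by (metis K_subtopology_mono compactin_subspace)
    then have "closedin (K n) (topspace (K m))"
      using compactin_imp_closedin metrizable_K metrizable_imp_Hausdorff_space by blast
    then have "topspace (K n) - topspace (K m) \<in> sets (K_borel n)"
      by (auto simp: sets_K_borel intro!: sigma_sets.Basic)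
    from sets.compl_sets[OF this] have Km: "topspace (K m) \<in> sets (K_borel n)"
      using K_mono[OF True] by (simp add: double_diff)
    have "A \<in> sets (K_borel n)"
      using A[unfolded sets_K_borel]
    proof (induction rule: sigma_sets.induct)
      case (Basic U)
      then obtain V where "openin (K n) V" "U = V \<inter> topspace (K m)"
        using K_subtopology_mono[OF True] by (metis mem_Collect_eq openin_subtopology)
      then show ?case using Km by (auto simp: sets_K_borel intro: sigma_sets.Basic intro!: sets.Int[of _ "K_borel n", unfolded sets_K_borel])
    qed (use Km in \<open>auto intro: sets.Diff\<close>)
    then show ?thesis using sets.Int[OF _ sets.top[of "K_borel n"]] by simp
  next
    case False
    then have nm: "n \<le> m" by simp
    show ?thesis
      using A[unfolded sets_K_borel]
    proof (induction rule: sigma_sets.induct)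
      case (Basic U)
      then have "openin (K n) (U \<inter> topspace (K n))"
        using K_subtopology_mono[OF nm] by (metis mem_Collect_eq openin_subtopology)
      then show ?case by (auto simp: sets_K_borel intro: sigma_sets.Basic)
    next
      case (Compl a)
      have "(topspace (K m) - a) \<inter> topspace (K n) = topspace (K n) - (a \<inter> topspace (K n))"
        using K_mono[OF nm] by blast
      then show ?case using sets.compl_sets[OF Compl.IH] by simp
    next
      case (Union a)
      then have "(\<Union>i. a i \<inter> topspace (K n)) \<in> sets (K_borel n)" by (intro sets.countable_UN) auto
      moreover have "\<Union> (range a) \<inter> topspace (K n) = (\<Union>i. a i \<inter> topspace (K n))" by blast
      ultimately show ?case by (simp only:)
    qed simp
  qed
  then show "(\<lambda>g. g) -` A \<inter> space (K_borel n) \<in> sets (K_borel n)" by simp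
qed

end

section \<open>Mixtures of measures\<close>

definition mixture :: "'a measure \<Rightarrow> 'x measure \<Rightarrow> ('a \<Rightarrow> 'x measure) \<Rightarrow> 'x measure" where
  "mixture \<mu> X \<kappa> = measure_of (space X) (sets X) (\<lambda>A. \<integral>\<^sup>+x. emeasure (\<kappa> x) A \<partial>\<mu>)"

text \<open>The values may be infinite measures: the identity on \<open>Minf X\<close> is one of
  these kernels, and its values are only sigma-finite.\<close>

locale measure_kernel =
  fixes M :: "'a measure" and X :: "'x measure" and \<kappa> :: "'a \<Rightarrow> 'x measure"
  assumes sets_kernel: "x \<in> space M \<Longrightarrow> sets (\<kappa> x) = sets X"
    and measurable_kernel [measurable]: "A \<in> sets X \<Longrightarrow> (\<lambda>x. emeasure (\<kappa> x) A) \<in> borel_measurable M"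
begin

lemma space_kernel: "x \<in> space M \<Longrightarrow> space (\<kappa> x) = space X"
  using sets_kernel by (rule sets_eq_imp_space_eq)

lemma space_mixture [simp]: "space (mixture \<mu> X \<kappa>) = space X"
  and sets_mixture [simp, measurable_cong]: "sets (mixture \<mu> X \<kappa>) = sets X"
  by (simp_all add: mixture_def)

lemma emeasure_mixture:
  assumes \<mu>: "sets \<mu> = sets M" and A: "A \<in> sets X"
  shows "emeasure (mixture \<mu> X \<kappa>) A = (\<integral>\<^sup>+x. emeasure (\<kappa> x) A \<partial>\<mu>)"
  unfolding mixture_def
proof (rule emeasure_measure_of_sigma[OF _ _ _ A])
  show "sigma_algebra (space X) (sets X)" by (rule sets.sigma_algebra_axioms)
  show "positive (sets X) (\<lambda>A. \<integral>\<^sup>+x. emeasure (\<kappa> x) A \<partial>\<mu>)" by (simp add: positive_def)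
  have sp: "space \<mu> = space M" using \<mu> by (rule sets_eq_imp_space_eq)
  show "countably_additive (sets X) (\<lambda>A. \<integral>\<^sup>+x. emeasure (\<kappa> x) A \<partial>\<mu>)"
  proof (rule countably_additiveI)
    fix A :: "nat \<Rightarrow> _" assume A: "range A \<subseteq> sets X" "disjoint_family A"
    have "(\<Sum>i. \<integral>\<^sup>+x. emeasure (\<kappa> x) (A i) \<partial>\<mu>) = (\<integral>\<^sup>+x. (\<Sum>i. emeasure (\<kappa> x) (A i)) \<partial>\<mu>)"
      using A by (intro nn_integral_suminf[symmetric]) (auto cong: measurable_cong_sets simp: measurable_cong_sets[OF \<mu> refl])
    also have "\<dots> = (\<integral>\<^sup>+x. emeasure (\<kappa> x) (\<Union>i. A i) \<partial>\<mu>)"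
      using A by (intro nn_integral_cong suminf_emeasure) (auto simp: sp sets_kernel)
    finally show "(\<Sum>i. \<integral>\<^sup>+x. emeasure (\<kappa> x) (A i) \<partial>\<mu>) = (\<integral>\<^sup>+x. emeasure (\<kappa> x) (\<Union>i. A i) \<partial>\<mu>)" .
  qed
qed

text \<open>Both claims go through one induction on \<open>h\<close>, because exchanging the outer
  integral with sums, multiples and suprema needs measurability of the inner integral.\<close>

lemma
  assumes [measurable]: "h \<in> borel_measurable X"
  shows measurable_nn_integral_kernel [measurable]: "(\<lambda>x. \<integral>\<^sup>+y. h y \<partial>\<kappa> x) \<in> borel_measurable M"
    and nn_integral_mixture: "sets \<mu> = sets M \<Longrightarrow>
      (\<integral>\<^sup>+y. h y \<partial>mixture \<mu> X \<kappa>) = (\<integral>\<^sup>+x. \<integral>\<^sup>+y. h y \<partial>\<kappa> x \<partial>\<mu>)"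
proof -
  have "(\<lambda>x. \<integral>\<^sup>+y. h y \<partial>\<kappa> x) \<in> borel_measurable M \<and> (\<forall>\<mu>. sets \<mu> = sets M \<longrightarrow>
      (\<integral>\<^sup>+y. h y \<partial>mixture \<mu> X \<kappa>) = (\<integral>\<^sup>+x. \<integral>\<^sup>+y. h y \<partial>\<kappa> x \<partial>\<mu>))"
    using assms
  proof (induction h rule: borel_measurable_induct)
    case (cong f g)
    have "(\<integral>\<^sup>+y. f y \<partial>\<kappa> x) = (\<integral>\<^sup>+y. g y \<partial>\<kappa> x)" if "x \<in> space M" for x
      using cong(3) that by (intro nn_integral_cong) (simp add: space_kernel)
    moreover have "(\<integral>\<^sup>+y. f y \<partial>mixture \<mu> X \<kappa>) = (\<integral>\<^sup>+y. g y \<partial>mixture \<mu> X \<kappa>)" for \<mu>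
      using cong(3) by (intro nn_integral_cong) simp
    moreover have "(\<integral>\<^sup>+x. \<integral>\<^sup>+y. f y \<partial>\<kappa> x \<partial>\<mu>) = (\<integral>\<^sup>+x. \<integral>\<^sup>+y. g y \<partial>\<kappa> x \<partial>\<mu>)" if "sets \<mu> = sets M" for \<mu>
      using calculation(1) by (rule nn_integral_cong) (simp add: sets_eq_imp_space_eq[OF that])
    ultimately show ?case
      using cong(4) by (simp cong: measurable_cong)
  next
    case (set A)
    have ind: "(\<integral>\<^sup>+y. indicator A y \<partial>\<kappa> x) = emeasure (\<kappa> x) A" if "x \<in> space M" for x
      using set that by (simp add: sets_kernel)
    have "(\<lambda>x. \<integral>\<^sup>+y. indicator A y \<partial>\<kappa> x) \<in> borel_measurable M"
      using set by (simp cong: measurable_cong add: ind)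
    moreover have "(\<integral>\<^sup>+y. indicator A y \<partial>mixture \<mu> X \<kappa>) = (\<integral>\<^sup>+x. \<integral>\<^sup>+y. indicator A y \<partial>\<kappa> x \<partial>\<mu>)"
      if \<mu>: "sets \<mu> = sets M" for \<mu>
    proof -
      have "(\<integral>\<^sup>+x. \<integral>\<^sup>+y. indicator A y \<partial>\<kappa> x \<partial>\<mu>) = (\<integral>\<^sup>+x. emeasure (\<kappa> x) A \<partial>\<mu>)"
        by (rule nn_integral_cong) (simp add: ind sets_eq_imp_space_eq[OF \<mu>])
      then show ?thesis using set by (simp add: emeasure_mixture[OF \<mu>])
    qed
    ultimately show ?case by blast
  next
    case (mult u c)
    have eq: "(\<integral>\<^sup>+y. c * u y \<partial>\<kappa> x) = c * (\<integral>\<^sup>+y. u y \<partial>\<kappa> x)" if "x \<in> space M" for x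
      using mult(2) that by (intro nn_integral_cmult) (simp add: measurable_cong_sets[OF sets_kernel refl])
    have m: "(\<lambda>x. \<integral>\<^sup>+y. u y \<partial>\<kappa> x) \<in> borel_measurable M" using mult by blast
    have "(\<lambda>x. \<integral>\<^sup>+y. c * u y \<partial>\<kappa> x) \<in> borel_measurable M"
      using m by (simp cong: measurable_cong add: eq)
    moreover have "(\<integral>\<^sup>+y. c * u y \<partial>mixture \<mu> X \<kappa>) = (\<integral>\<^sup>+x. \<integral>\<^sup>+y. c * u y \<partial>\<kappa> x \<partial>\<mu>)"
      if \<mu>: "sets \<mu> = sets M" for \<mu>
    proof -
      have "(\<integral>\<^sup>+x. \<integral>\<^sup>+y. c * u y \<partial>\<kappa> x \<partial>\<mu>) = (\<integral>\<^sup>+x. c * (\<integral>\<^sup>+y. u y \<partial>\<kappa> x) \<partial>\<mu>)"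
        by (rule nn_integral_cong) (simp add: eq sets_eq_imp_space_eq[OF \<mu>])
      also have "\<dots> = c * (\<integral>\<^sup>+x. \<integral>\<^sup>+y. u y \<partial>\<kappa> x \<partial>\<mu>)"
        using m by (intro nn_integral_cmult) (simp add: measurable_cong_sets[OF \<mu> refl])
      also have "\<dots> = c * (\<integral>\<^sup>+y. u y \<partial>mixture \<mu> X \<kappa>)" using mult \<mu> by simp
      also have "\<dots> = (\<integral>\<^sup>+y. c * u y \<partial>mixture \<mu> X \<kappa>)"
        using mult(2) by (intro nn_integral_cmult[symmetric]) simp
      finally show ?thesis ..
    qed
    ultimately show ?case by blast
  next
    case (add u v)
    have eq: "(\<integral>\<^sup>+y. v y + u y \<partial>\<kappa> x) = (\<integral>\<^sup>+y. v y \<partial>\<kappa> x) + (\<integral>\<^sup>+y. u y \<partial>\<kappa> x)" if "x \<in> space M" for x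
      using add(1,3) that by (intro nn_integral_add) (simp_all add: measurable_cong_sets[OF sets_kernel refl])
    have m: "(\<lambda>x. \<integral>\<^sup>+y. u y \<partial>\<kappa> x) \<in> borel_measurable M" "(\<lambda>x. \<integral>\<^sup>+y. v y \<partial>\<kappa> x) \<in> borel_measurable M"
      using add by blast+
    have "(\<lambda>x. \<integral>\<^sup>+y. v y + u y \<partial>\<kappa> x) \<in> borel_measurable M"
      using m by (simp cong: measurable_cong add: eq)
    moreover have "(\<integral>\<^sup>+y. v y + u y \<partial>mixture \<mu> X \<kappa>) = (\<integral>\<^sup>+x. \<integral>\<^sup>+y. v y + u y \<partial>\<kappa> x \<partial>\<mu>)"
      if \<mu>: "sets \<mu> = sets M" for \<mu>
    proof -
      have "(\<integral>\<^sup>+x. \<integral>\<^sup>+y. v y + u y \<partial>\<kappa> x \<partial>\<mu>) = (\<integral>\<^sup>+x. (\<integral>\<^sup>+y. v y \<partial>\<kappa> x) + (\<integral>\<^sup>+y. u y \<partial>\<kappa> x) \<partial>\<mu>)"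
        by (rule nn_integral_cong) (simp add: eq sets_eq_imp_space_eq[OF \<mu>])
      also have "\<dots> = (\<integral>\<^sup>+x. \<integral>\<^sup>+y. v y \<partial>\<kappa> x \<partial>\<mu>) + (\<integral>\<^sup>+x. \<integral>\<^sup>+y. u y \<partial>\<kappa> x \<partial>\<mu>)"
        using m by (intro nn_integral_add) (simp_all add: measurable_cong_sets[OF \<mu> refl])
      also have "\<dots> = (\<integral>\<^sup>+y. v y \<partial>mixture \<mu> X \<kappa>) + (\<integral>\<^sup>+y. u y \<partial>mixture \<mu> X \<kappa>)" using add \<mu> by simp
      also have "\<dots> = (\<integral>\<^sup>+y. v y + u y \<partial>mixture \<mu> X \<kappa>)"
        using add(1,3) by (intro nn_integral_add[symmetric]) simp_all
      finally show ?thesis ..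
    qed
    ultimately show ?case by blast
  next
    case (seq U)
    have eq: "(\<integral>\<^sup>+y. Sup (range U) y \<partial>\<kappa> x) = (SUP i. \<integral>\<^sup>+y. U i y \<partial>\<kappa> x)" if "x \<in> space M" for x
      using seq(1,3) that unfolding SUP_apply
      by (intro nn_integral_monotone_convergence_SUP) (simp_all add: measurable_cong_sets[OF sets_kernel refl])
    have m: "(\<lambda>x. \<integral>\<^sup>+y. U i y \<partial>\<kappa> x) \<in> borel_measurable M" for i using seq by blast
    have "(\<lambda>x. \<integral>\<^sup>+y. Sup (range U) y \<partial>\<kappa> x) \<in> borel_measurable M"
      using m by (simp cong: measurable_cong add: eq del: Sup_apply SUP_apply)
    moreover have "(\<integral>\<^sup>+y. Sup (range U) y \<partial>mixture \<mu> X \<kappa>) = (\<integral>\<^sup>+x. \<integral>\<^sup>+y. Sup (range U) y \<partial>\<kappa> x \<partial>\<mu>)"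
      if \<mu>: "sets \<mu> = sets M" for \<mu>
    proof -
      have "(\<integral>\<^sup>+x. \<integral>\<^sup>+y. Sup (range U) y \<partial>\<kappa> x \<partial>\<mu>) = (\<integral>\<^sup>+x. (SUP i. \<integral>\<^sup>+y. U i y \<partial>\<kappa> x) \<partial>\<mu>)"
        by (rule nn_integral_cong) (simp add: eq sets_eq_imp_space_eq[OF \<mu>] del: Sup_apply SUP_apply)
      also have "\<dots> = (SUP i. \<integral>\<^sup>+x. \<integral>\<^sup>+y. U i y \<partial>\<kappa> x \<partial>\<mu>)"
      proof (rule nn_integral_monotone_convergence_SUP)
        show "incseq (\<lambda>i x. \<integral>\<^sup>+y. U i y \<partial>\<kappa> x)"
          using seq(3) by (intro monoI le_funI nn_integral_mono) (auto dest: monoD le_funD)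
      qed (use m in \<open>simp add: measurable_cong_sets[OF \<mu> refl]\<close>)
      also have "\<dots> = (SUP i. \<integral>\<^sup>+y. U i y \<partial>mixture \<mu> X \<kappa>)" using seq \<mu> by simp
      also have "\<dots> = (\<integral>\<^sup>+y. Sup (range U) y \<partial>mixture \<mu> X \<kappa>)"
        using seq(1,3) unfolding SUP_apply by (intro nn_integral_monotone_convergence_SUP[symmetric]) simp_all
      finally show ?thesis ..
    qed
    ultimately show ?case by blast
  qed
  then show "(\<lambda>x. \<integral>\<^sup>+y. h y \<partial>\<kappa> x) \<in> borel_measurable M" "sets \<mu> = sets M \<Longrightarrow>
      (\<integral>\<^sup>+y. h y \<partial>mixture \<mu> X \<kappa>) = (\<integral>\<^sup>+x. \<integral>\<^sup>+y. h y \<partial>\<kappa> x \<partial>\<mu>)" by blast+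
qed

end

section \<open>Reconstruction of a probability measure from its distribution function\<close>

definition rational_enum :: "nat \<Rightarrow> real" where
  "rational_enum j = of_rat (nat_to_rat_surj j)"

lemma rational_enum_dense: "a < b \<Longrightarrow> \<exists>j. a < rational_enum j \<and> rational_enum j < b"
  using of_rat_dense[of a b] surj_nat_to_rat_surj unfolding rational_enum_def by (metis surjD)

text \<open>Only the range and the values outside the unit interval are corrected here. Monotonicity
  is supplied later by taking an infimum.\<close>

definition clipped :: "(nat \<Rightarrow> real) \<Rightarrow> nat \<Rightarrow> real" where
  "clipped z j = (if rational_enum j < 0 then 0 else if rational_enum j > 1 then 1 else max 0 (min 1 (z j)))"

text \<open>
  For every sequence \<open>z\<close> whatsoever this is a distribution function of a probability on \<open>[0,1]\<close>;
  if \<open>z\<close> lists the values of such a distribution function at the rationals, that function is recovered.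
\<close>

definition sequence_cdf :: "(nat \<Rightarrow> real) \<Rightarrow> real \<Rightarrow> real" where
  "sequence_cdf z t = (INF j\<in>{j. t < rational_enum j}. clipped z j)"

lemma clipped_bounds: "0 \<le> clipped z j" "clipped z j \<le> 1"
  by (auto simp: clipped_def)

lemma bdd_below_clipped: "bdd_below (clipped z ` A)"
  using clipped_bounds by (intro bdd_belowI2[of _ 0]) auto

lemma rational_above: "{j. t < rational_enum j} \<noteq> {}"
  using rational_enum_dense[of t "t + 1"] by auto

lemma sequence_cdf_le: "t < rational_enum j \<Longrightarrow> sequence_cdf z t \<le> clipped z j"
  unfolding sequence_cdf_def by (rule cINF_lower[OF bdd_below_clipped]) simp

lemma sequence_cdf_greatest: "(\<And>j. t < rational_enum j \<Longrightarrow> c \<le> clipped z j) \<Longrightarrow> c \<le> sequence_cdf z t"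
  unfolding sequence_cdf_def by (rule cINF_greatest[OF rational_above]) simp

lemma sequence_cdf_less:
  assumes "sequence_cdf z t < c"
  obtains j where "t < rational_enum j" "clipped z j < c"
  using assms sequence_cdf_greatest[of t c z] by (meson not_le)

lemma sequence_cdf_bounds: "0 \<le> sequence_cdf z t" "sequence_cdf z t \<le> 1"
proof -
  obtain j where "t < rational_enum j" using rational_above by blast
  from sequence_cdf_le[OF this, of z] show "sequence_cdf z t \<le> 1"
    using clipped_bounds(2)[of z j] by linarith
qed (auto intro: sequence_cdf_greatest clipped_bounds)

lemma sequence_cdf_mono: "s \<le> t \<Longrightarrow> sequence_cdf z s \<le> sequence_cdf z t"
  by (auto intro!: sequence_cdf_greatest sequence_cdf_le)

text \<open>A rational above \<open>t\<close> that nearly attains the infimum is still above every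
  \<open>s\<close> slightly larger than \<open>t\<close>, so it bounds the values there as well. The
  strict inequality in the infimum is what makes this work.\<close>

lemma sequence_cdf_right_continuous: "continuous (at_right t) (sequence_cdf z)"
  unfolding continuous_within
proof (rule order_tendstoI)
  fix c assume "c < sequence_cdf z t"
  then show "eventually (\<lambda>s. c < sequence_cdf z s) (at_right t)"
    using sequence_cdf_mono by (auto simp: eventually_at_right_less intro!: eventually_at_rightI[of t "t+1"] intro: less_le_trans)
next
  fix c assume "sequence_cdf z t < c"
  then obtain j where j: "t < rational_enum j" "clipped z j < c" by (rule sequence_cdf_less)
  then show "eventually (\<lambda>s. sequence_cdf z s < c) (at_right t)"
    by (intro eventually_at_rightI[of t "rational_enum j"]) (auto intro: le_less_trans[OF sequence_cdf_le])
qed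

lemma sequence_cdf_neg: "t < 0 \<Longrightarrow> sequence_cdf z t = 0"
proof -
  assume "t < 0"
  then obtain j where "t < rational_enum j" "rational_enum j < 0" using rational_enum_dense by blast
  then show ?thesis using sequence_cdf_le[of t j z] sequence_cdf_bounds(1)[of z t] by (simp add: clipped_def)
qed

lemma sequence_cdf_ge1: "1 \<le> t \<Longrightarrow> sequence_cdf z t = 1"
  using sequence_cdf_bounds(2)[of z t] sequence_cdf_greatest[of t 1 z] by (force simp: clipped_def)

lemma
  shows sequence_cdf_at_bot: "(sequence_cdf z \<longlongrightarrow> 0) at_bot"
    and sequence_cdf_at_top: "(sequence_cdf z \<longlongrightarrow> 1) at_top"
  by (intro tendsto_eventually eventually_mono[OF eventually_gt_at_bot[of 0]]
      eventually_mono[OF eventually_ge_at_top[of 1]] sequence_cdf_neg sequence_cdf_ge1; assumption)+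

lemma measurable_sequence_cdf [measurable]: "(\<lambda>z. sequence_cdf z t) \<in> borel_measurable borel"
  unfolding sequence_cdf_def
proof (rule borel_measurable_cINF)
  show "(\<lambda>z. clipped z j) \<in> borel_measurable borel" for j
    unfolding clipped_def by measurable
qed (auto intro: bdd_below_clipped)

definition sequence_measure :: "(nat \<Rightarrow> real) \<Rightarrow> real measure" where
  "sequence_measure z = interval_measure (sequence_cdf z)"

lemma real_distribution_sequence_measure: "real_distribution (sequence_measure z)"
  unfolding sequence_measure_def
  by (intro real_distribution_interval_measure sequence_cdf_mono sequence_cdf_right_continuous
      sequence_cdf_at_bot sequence_cdf_at_top)

lemma emeasure_sequence_measure: "emeasure (sequence_measure z) {..t} = ennreal (sequence_cdf z t)"
  unfolding sequence_measure_def
  by (intro emeasure_interval_measure_Iic sequence_cdf_mono sequence_cdf_right_continuous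
      sequence_cdf_at_bot)

lemma cdf_sequence_measure: "cdf (sequence_measure z) = sequence_cdf z"
  unfolding sequence_measure_def
  by (intro cdf_interval_measure sequence_cdf_mono sequence_cdf_right_continuous
      sequence_cdf_at_bot sequence_cdf_at_top)

lemma measurable_sequence_measure: "sequence_measure \<in> borel \<rightarrow>\<^sub>M prob_algebra borel"
proof (rule measurable_prob_algebra_generated)
  show "sets borel = sigma_sets UNIV (range (\<lambda>a::real. {..a}))"
    by (simp add: borel_eq_atMost)
  show "Int_stable (range (\<lambda>a::real. {..a}))" by (auto simp: Int_stable_def)
  fix z show "prob_space (sequence_measure z)" "sets (sequence_measure z) = sets borel"
    using real_distribution_sequence_measure[of z] by (auto simp: real_distribution_def real_distribution_axioms_def)
qed (auto simp: emeasure_sequence_measure)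

text \<open>\<open>code\<close> is a Borel isomorphism onto the unit interval and
  \<open>decode\<close> its inverse, extended to the whole line by clamping, so that every Borel
  measure on the line can be pushed forward to \<open>X\<close>.\<close>

locale coded_space =
  fixes X :: "'x measure" and code :: "'x \<Rightarrow> real" and decode :: "real \<Rightarrow> 'x"
  assumes measurable_code [measurable]: "code \<in> borel_measurable X"
    and measurable_decode [measurable]: "decode \<in> borel \<rightarrow>\<^sub>M X"
    and code_bounds: "x \<in> space X \<Longrightarrow> 0 \<le> code x" "x \<in> space X \<Longrightarrow> code x \<le> 1"
    and decode_code: "x \<in> space X \<Longrightarrow> decode (code x) = x"
    and code_decode: "code (decode t) = max 0 (min 1 t)"
begin

definition initial :: "nat \<Rightarrow> 'x set" where
  "initial j = {x \<in> space X. code x \<le> rational_enum j}"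

lemma sets_initial [measurable]: "initial j \<in> sets X"
  unfolding initial_def by measurable

lemma initial_mono: "rational_enum i \<le> rational_enum j \<Longrightarrow> initial i \<subseteq> initial j"
  by (auto simp: initial_def)

lemma initial_trivial:
  "rational_enum j < 0 \<Longrightarrow> initial j = {}" "rational_enum j > 1 \<Longrightarrow> initial j = space X"
  using code_bounds by (force simp: initial_def)+

definition reconstruct :: "(nat \<Rightarrow> real) \<Rightarrow> 'x measure" where
  "reconstruct z = distr (sequence_measure z) X decode"

lemma measurable_reconstruct [measurable]: "reconstruct \<in> borel \<rightarrow>\<^sub>M prob_algebra X"
  unfolding reconstruct_def
  by (rule measurable_compose[OF measurable_sequence_measure measurable_distr_prob_space]) simp

lemma prob_space_reconstruct: "prob_space (reconstruct z)"
  and sets_reconstruct [simp, measurable_cong]: "sets (reconstruct z) = sets X"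
  using measurable_space[OF measurable_reconstruct, of z] by (auto simp: space_prob_algebra)

lemma space_reconstruct [simp]: "space (reconstruct z) = space X"
  by (rule sets_eq_imp_space_eq) simp

lemma measure_distr_code:
  assumes "sets P = sets X"
  shows "distr (distr P borel code) X decode = P"
proof -
  have sp: "space P = space X" using assms by (rule sets_eq_imp_space_eq)
  have [measurable]: "code \<in> borel_measurable P" by (simp add: measurable_cong_sets[OF assms refl])
  have "distr (distr P borel code) X decode = distr P X (\<lambda>x. decode (code x))"
    by (subst distr_distr) (auto simp: o_def)
  also have "\<dots> = distr P P (\<lambda>x. x)"
    by (rule distr_cong) (auto simp: assms decode_code sp)
  finally show ?thesis by (simp add: distr_id2 distr_id)
qed

text \<open>The numbers are the values at the rationals of the distribution function of the coded
  measure. Clipping leaves them unchanged, right continuity recovers the function from them, and a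
  distribution function determines its measure.\<close>

lemma reconstruct_measure:
  assumes P: "prob_space P" and sets_P: "sets P = sets X"
  shows "reconstruct (\<lambda>j. measure P (initial j)) = P"
proof -
  define D where "D = distr P borel code"
  have sp: "space P = space X" using sets_P by (rule sets_eq_imp_space_eq)
  have [measurable]: "code \<in> borel_measurable P" by (simp add: measurable_cong_sets[OF sets_P refl])
  interpret P: prob_space P by (rule P)
  interpret D: real_distribution D unfolding D_def by (rule P.real_distribution_distr) measurable
  have init: "measure P (initial j) = cdf D (rational_enum j)" for j
    unfolding cdf_def D_def initial_def
    by (subst measure_distr) (auto simp: sp intro!: arg_cong[where f="measure P"])
  have clip: "clipped (\<lambda>j. measure P (initial j)) j = cdf D (rational_enum j)" for j
    using initial_trivial[of j] P.prob_space init[of j] P.prob_le_1[of "initial j"]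
      measure_nonneg[of P "initial j"] by (auto simp: clipped_def sp)
  have "sequence_cdf (\<lambda>j. measure P (initial j)) t = cdf D t" for t
  proof (rule antisym)
    show "cdf D t \<le> sequence_cdf (\<lambda>j. measure P (initial j)) t"
      by (rule sequence_cdf_greatest) (auto simp: clip intro: D.cdf_nondecreasing)
    show "sequence_cdf (\<lambda>j. measure P (initial j)) t \<le> cdf D t"
    proof (rule dense_ge)
      fix c assume "cdf D t < c"
      then have "eventually (\<lambda>s. cdf D s < c) (at_right t)"
        using D.cdf_is_right_cont[of t] by (intro order_tendstoD(2)) (auto simp: continuous_within)
      then obtain b where b: "b > t" "\<And>s. t < s \<Longrightarrow> s < b \<Longrightarrow> cdf D s < c"
        by (auto simp: eventually_at_right[of t "t + 1"])
      obtain j where "t < rational_enum j" "rational_enum j < b" using rational_enum_dense[OF b(1)] by blast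
      then show "sequence_cdf (\<lambda>j. measure P (initial j)) t \<le> c"
        using sequence_cdf_le[of t j "\<lambda>j. measure P (initial j)"] b(2)[of "rational_enum j"] by (simp add: clip)
    qed
  qed
  then have "sequence_measure (\<lambda>j. measure P (initial j)) = D"
    using cdf_sequence_measure real_distribution_sequence_measure D.real_distribution_axioms
    by (intro cdf_unique) (auto simp: fun_eq_iff)
  then show ?thesis unfolding reconstruct_def D_def by (simp add: measure_distr_code[OF sets_P])
qed

text \<open>Countably many test sets suffice, so equality of measures almost everywhere can be
  checked for one initial segment at a time.\<close>

lemma prob_measure_eqI:
  assumes "prob_space P" "sets P = sets X" "prob_space Q" "sets Q = sets X"
    and "\<And>j. measure P (initial j) = measure Q (initial j)"
  shows "P = Q"
proof -
  have "P = reconstruct (\<lambda>j. measure P (initial j))" by (rule reconstruct_measure[OF assms(1,2), symmetric])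
  also have "(\<lambda>j. measure P (initial j)) = (\<lambda>j. measure Q (initial j))" using assms(5) by (rule ext)
  also have "reconstruct \<dots> = Q" by (rule reconstruct_measure[OF assms(3,4)])
  finally show ?thesis .
qed

end

lemma standard_Borel_space_coded:
  assumes "standard_Borel_space X"
  obtains code decode where "coded_space X code decode"
proof -
  obtain f where f: "bij_betw f (space X) {0..1::real}"
    and sets: "(`) f ` sets X = sets (restrict_space borel {0..1})"
    using assms unfolding standard_Borel_space_def by blast
  define g where "g = (\<lambda>t. the_inv_into (space X) f (max 0 (min 1 t)))"
  have inj: "inj_on f (space X)" and img: "f ` space X = {0..1}" using f by (auto simp: bij_betw_def)
  have "coded_space X f g"
  proof
    show "f \<in> borel_measurable X"
    proof (rule measurableI)
      fix A :: "real set" assume "A \<in> sets borel"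
      then have "A \<inter> {0..1} \<in> (`) f ` sets X" unfolding sets by (auto simp: sets_restrict_space)
      then obtain B where B: "B \<in> sets X" "f ` B = A \<inter> {0..1}" by auto
      have BX: "B \<subseteq> space X" using B(1) by (rule sets.sets_into_space)
      have "f -` A \<inter> space X = B"
      proof (intro equalityI subsetI)
        fix x assume x: "x \<in> f -` A \<inter> space X"
        then have "f x \<in> A \<inter> {0..1}" using img by blast
        then show "x \<in> B" using x BX inj_on_image_mem_iff[OF inj] unfolding B(2)[symmetric] by blast
      qed (use B(2) BX in blast)
      then show "f -` A \<inter> space X \<in> sets X" using B by simp
    qed simp
    have g: "g t \<in> space X" "f (g t) = max 0 (min 1 t)" for t
    proof -
      have "max 0 (min 1 t) \<in> f ` space X" unfolding img by auto
      then show "g t \<in> space X" "f (g t) = max 0 (min 1 t)"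
        unfolding g_def using the_inv_into_into[OF inj] f_the_inv_into_f[OF inj] by auto
    qed
    show "g \<in> borel \<rightarrow>\<^sub>M X"
    proof (rule measurableI)
      fix A assume A: "A \<in> sets X"
      have "f ` A \<in> sets (restrict_space borel {0..1})" unfolding sets[symmetric] using A by blast
      then have fA: "f ` A \<in> sets borel" by (auto simp: sets_restrict_space)
      have "g -` A = (\<lambda>t. max 0 (min 1 t)) -` (f ` A)"
      proof (rule Set.set_eqI)
        fix t
        show "t \<in> g -` A \<longleftrightarrow> t \<in> (\<lambda>t. max 0 (min 1 t)) -` (f ` A)"
          using inj_on_image_mem_iff[OF inj g(1)[of t] sets.sets_into_space[OF A]] by (simp add: g(2))
      qed
      moreover have "(\<lambda>t::real. max 0 (min 1 t)) -` (f ` A) \<inter> space borel \<in> sets borel"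
        using fA by (intro measurable_sets[where A=borel]) auto
      ultimately show "g -` A \<inter> space borel \<in> sets borel" by simp
    qed (simp add: g)
    show "f (g t) = max 0 (min 1 t)" for t by (rule g)
    fix x assume x: "x \<in> space X"
    then have "f x \<in> {0..1}" using img by blast
    then show "0 \<le> f x" "f x \<le> 1" by auto
    then show "g (f x) = x" using x by (simp add: g_def min_absorb2 max_absorb2 the_inv_into_f_f[OF inj])
  qed
  then show ?thesis by (rule that)
qed

section \<open>Averaging over the compact subgroups\<close>

locale coded_action = inductively_compact_group G K + coded_space X code decode
  for G :: "('g, 'b) monoid_scheme" (structure) and K and X :: "'x measure" and code decode +
  fixes T :: "'g \<Rightarrow> 'x \<Rightarrow> 'x"
  assumes measurable_action: "measurable_action G K X T"
begin

sublocale group_action G "space X" T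
  using measurable_action by (simp add: measurable_action_def)

lemma T_closed [simp]: "g \<in> carrier G \<Longrightarrow> x \<in> space X \<Longrightarrow> T g x \<in> space X"
  using element_image by blast

lemma T_mult: "g \<in> carrier G \<Longrightarrow> h \<in> carrier G \<Longrightarrow> x \<in> space X \<Longrightarrow> T (g \<otimes> h) x = T g (T h x)"
  using composition_rule by blast

lemma T_one: "x \<in> space X \<Longrightarrow> T \<one> x = x"
  using id_eq_one by (metis restrict_apply')

lemma T_inv: "g \<in> carrier G \<Longrightarrow> x \<in> space X \<Longrightarrow> T (inv g) (T g x) = x" "g \<in> carrier G \<Longrightarrow> x \<in> space X \<Longrightarrow> T g (T (inv g) x) = x"
  using T_mult[of "inv g" g x] T_mult[of g "inv g" x] T_one by simp_all

lemma K_in_carrier: "k \<in> topspace (K n) \<Longrightarrow> k \<in> carrier G"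
  by (auto simp: carrier_eq)

lemma measurable_T_pair: "(\<lambda>(g, x). T g x) \<in> K_borel n \<Otimes>\<^sub>M X \<rightarrow>\<^sub>M X"
proof -
  have m: "(\<lambda>(g, x). T g x) \<in> group_borel K \<Otimes>\<^sub>M X \<rightarrow>\<^sub>M X"
    using measurable_action by (simp add: measurable_action_def)
  have "(\<lambda>p. (fst p, snd p)) \<in> K_borel n \<Otimes>\<^sub>M X \<rightarrow>\<^sub>M group_borel K \<Otimes>\<^sub>M X"
    by (rule measurable_Pair[OF measurable_compose[OF measurable_fst measurable_K_inclusion] measurable_snd])
  from measurable_compose[OF this m] show ?thesis by (simp add: case_prod_unfold)
qed

lemma measurable_T_compose [measurable]:
  assumes "g \<in> M \<rightarrow>\<^sub>M K_borel n" "h \<in> M \<rightarrow>\<^sub>M X"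
  shows "(\<lambda>x. T (g x) (h x)) \<in> M \<rightarrow>\<^sub>M X"
  using measurable_compose[OF measurable_Pair[OF assms] measurable_T_pair] by simp

lemma measurable_T [measurable]:
  assumes "g \<in> carrier G"
  shows "T g \<in> X \<rightarrow>\<^sub>M X"
proof -
  obtain n where "g \<in> space (K_borel n)" using assms by (auto simp: carrier_eq)
  then show ?thesis using measurable_T_compose[of "\<lambda>_. g" X n "\<lambda>x. x"] by simp
qed

definition K_invariant :: "nat \<Rightarrow> ('x \<Rightarrow> 'c) \<Rightarrow> bool" where
  "K_invariant n h \<longleftrightarrow> (\<forall>k\<in>topspace (K n). \<forall>x\<in>space X. h (T k x) = h x)"

definition average :: "nat \<Rightarrow> ('x \<Rightarrow> ennreal) \<Rightarrow> 'x \<Rightarrow> ennreal" where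
  "average n h x = (\<integral>\<^sup>+g. h (T g x) \<partial>Haar n)"

lemma measurable_average [measurable]:
  assumes [measurable]: "h \<in> borel_measurable X"
  shows "average n h \<in> borel_measurable X"
proof -
  interpret prob_space "Haar n" by (rule prob_space_Haar)
  show ?thesis unfolding average_def by measurable
qed

text \<open>Right invariance of Haar measure is the relevant one: replacing \<open>g\<close> by
  \<open>g \<otimes> k\<close> replaces \<open>x\<close> by \<open>T k x\<close>.\<close>

lemma K_invariant_average:
  assumes [measurable]: "h \<in> borel_measurable X"
  shows "K_invariant n (average n h)"
  unfolding K_invariant_def
proof (intro ballI)
  fix k x assume k: "k \<in> topspace (K n)" and x: "x \<in> space X"
  have [measurable]: "(\<lambda>g. g \<otimes> k) \<in> K_borel n \<rightarrow>\<^sub>M K_borel n"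
  proof -
    interpret C: compact_metrizable_group "K_group n" "K n" by (rule K_group_compact_metrizable)
    show ?thesis
      using C.continuous_map_imp_measurable_borel_group[OF C.continuous_map_right_mult] k
      by (simp add: K_borel_eq)
  qed
  have [measurable]: "(\<lambda>g. T g x) \<in> K_borel n \<rightarrow>\<^sub>M X"
    using x by (intro measurable_T_compose[of "\<lambda>g. g" _ n]) auto
  have "average n h x = (\<integral>\<^sup>+g. h (T g x) \<partial>distr (Haar n) (Haar n) (\<lambda>g. g \<otimes> k))"
    using right_invariant_Haar[OF k] by (simp add: average_def)
  also have "\<dots> = (\<integral>\<^sup>+g. h (T (g \<otimes> k) x) \<partial>Haar n)"
    by (subst nn_integral_distr) auto
  also have "\<dots> = average n h (T k x)"
    unfolding average_def using k x by (intro nn_integral_cong) (simp add: T_mult K_in_carrier)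
  finally show "average n h (T k x) = average n h x" ..
qed

lemma nn_integral_invariant_measure:
  assumes \<nu>: "invariant_measure G X T \<nu>" "sets \<nu> = sets X" and g: "g \<in> carrier G"
    and h: "h \<in> borel_measurable X"
  shows "(\<integral>\<^sup>+x. h (T g x) \<partial>\<nu>) = (\<integral>\<^sup>+x. h x \<partial>\<nu>)"
proof -
  have "T g \<in> \<nu> \<rightarrow>\<^sub>M X" using measurable_T[OF g] by (simp add: measurable_cong_sets[OF \<nu>(2) refl])
  then have "(\<integral>\<^sup>+x. h (T g x) \<partial>\<nu>) = (\<integral>\<^sup>+x. h x \<partial>distr \<nu> X (T g))"
    using h by (simp add: nn_integral_distr)
  also have "distr \<nu> X (T g) = \<nu>" using \<nu>(1) g by (simp add: invariant_measure_def)
  finally show ?thesis .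
qed

text \<open>After Fubini, which uses sigma-finiteness, \<open>w x\<close> may be written as
  \<open>w (T g x)\<close>, and invariance of \<nu> removes \<open>g\<close> from the inner
  integral. This is the defining property of a conditional expectation given the
  \<open>K n\<close>-invariant sets.\<close>

lemma nn_integral_average:
  assumes \<nu>: "invariant_measure G X T \<nu>" "\<nu> \<in> sigma_finite_measures X"
    and w: "w \<in> borel_measurable X" "K_invariant n w" and h: "h \<in> borel_measurable X"
  shows "(\<integral>\<^sup>+x. w x * average n h x \<partial>\<nu>) = (\<integral>\<^sup>+x. w x * h x \<partial>\<nu>)"
proof -
  have sets_\<nu>[measurable_cong]: "sets \<nu> = sets X" and sf: "sigma_finite_measure \<nu>"
    using \<nu>(2) by (auto simp: sigma_finite_measures_def)
  have sp: "space \<nu> = space X" using sets_\<nu> by (rule sets_eq_imp_space_eq)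
  note [measurable] = w(1) h
  interpret H: prob_space "Haar n" by (rule prob_space_Haar)
  interpret \<nu>: sigma_finite_measure \<nu> by (rule sf)
  interpret P: pair_sigma_finite "Haar n" \<nu> by unfold_locales
  have "(\<integral>\<^sup>+x. w x * average n h x \<partial>\<nu>) = (\<integral>\<^sup>+x. \<integral>\<^sup>+g. w x * h (T g x) \<partial>Haar n \<partial>\<nu>)"
    unfolding average_def by (rule nn_integral_cong, rule nn_integral_cmult[symmetric]) (simp add: sp)
  also have "\<dots> = (\<integral>\<^sup>+g. \<integral>\<^sup>+x. w x * h (T g x) \<partial>\<nu> \<partial>Haar n)"
    by (rule P.Fubini') measurable
  also have "\<dots> = (\<integral>\<^sup>+g. \<integral>\<^sup>+x. w (T g x) * h (T g x) \<partial>\<nu> \<partial>Haar n)"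
    using w(2) by (intro nn_integral_cong) (simp add: K_invariant_def sp)
  also have "\<dots> = (\<integral>\<^sup>+g. (\<integral>\<^sup>+x. w x * h x \<partial>\<nu>) \<partial>Haar n)"
  proof (rule nn_integral_cong)
    fix g assume "g \<in> space (Haar n)"
    then show "(\<integral>\<^sup>+x. w (T g x) * h (T g x) \<partial>\<nu>) = (\<integral>\<^sup>+x. w x * h x \<partial>\<nu>)"
      by (intro nn_integral_invariant_measure[OF \<nu>(1) sets_\<nu>]) (auto simp: K_in_carrier)
  qed
  also have "\<dots> = (\<integral>\<^sup>+x. w x * h x \<partial>\<nu>)" using H.emeasure_space_1 by simp
  finally show ?thesis .
qed

text \<open>Invariance is strict, not up to null sets, so this sigma-algebra is common to all
  measures. The pointwise form makes closure under set operations immediate;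
  \<open>invariant_set_iff\<close> relates it to the images used in
  \<open>ergodic_measure\<close>.\<close>

definition invariant_sets :: "'x measure" where
  "invariant_sets = sigma (space X) {J \<in> sets X. \<forall>g\<in>carrier G. \<forall>x\<in>space X. T g x \<in> J \<longleftrightarrow> x \<in> J}"

lemma space_invariant_sets [simp]: "space invariant_sets = space X"
  and sets_invariant_sets:
    "sets invariant_sets = {J \<in> sets X. \<forall>g\<in>carrier G. \<forall>x\<in>space X. T g x \<in> J \<longleftrightarrow> x \<in> J}" (is "_ = ?I")
proof -
  have "?I \<subseteq> Pow (space X)" using sets.sets_into_space by blast
  moreover have "sigma_algebra (space X) ?I"
    unfolding sigma_algebra_iff2
  proof (intro conjI ballI allI impI)
    fix A :: "nat \<Rightarrow> _" assume "range A \<subseteq> ?I"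
    then show "(\<Union>i. A i) \<in> ?I" by (auto intro!: sets.countable_UN)
  qed (use \<open>?I \<subseteq> _\<close> in auto)
  ultimately show "space invariant_sets = space X" "sets invariant_sets = ?I"
    unfolding invariant_sets_def
    by (simp_all only: space_measure_of_conv sigma_algebra.sets_measure_of_eq)
qed

lemma invariant_sets_subset: "J \<in> sets invariant_sets \<Longrightarrow> J \<in> sets X"
  by (simp add: sets_invariant_sets)

lemma measurable_invariant_setsI:
  assumes h: "h \<in> X \<rightarrow>\<^sub>M N" and inv: "\<And>g x. g \<in> carrier G \<Longrightarrow> x \<in> space X \<Longrightarrow> h (T g x) = h x"
  shows "h \<in> invariant_sets \<rightarrow>\<^sub>M N"
proof (rule measurableI)
  fix A assume "A \<in> sets N"
  then have "h -` A \<inter> space X \<in> sets X" by (rule measurable_sets[OF h])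
  then show "h -` A \<inter> space invariant_sets \<in> sets invariant_sets"
    by (auto simp: sets_invariant_sets inv)
qed (use measurable_space[OF h] in simp)

lemma measurable_invariant_setsD:
  assumes h: "h \<in> invariant_sets \<rightarrow>\<^sub>M N"
  shows "h \<in> X \<rightarrow>\<^sub>M N"
proof (rule measurableI)
  fix A assume "A \<in> sets N"
  from invariant_sets_subset[OF measurable_sets[OF h this]] show "h -` A \<inter> space X \<in> sets X" by simp
qed (use measurable_space[OF h] in simp)

lemma K_invariant_indicator: "J \<in> sets invariant_sets \<Longrightarrow> K_invariant n (indicator J :: _ \<Rightarrow> ennreal)"
  by (auto simp: K_invariant_def sets_invariant_sets K_in_carrier split: split_indicator)

end

section \<open>Orbit averages weighted by \<open>f\<close>\<close>

locale weighted_action = coded_action G K X code decode T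
  for G :: "('g, 'b) monoid_scheme" (structure) and K and X :: "'x measure" and code decode T +
  fixes f :: "'x \<Rightarrow> real"
  assumes fibrewise_continuous: "fibrewise_continuous K X T f"
    and f_pos: "x \<in> space X \<Longrightarrow> 0 < f x"
begin

abbreviation fe :: "'x \<Rightarrow> ennreal" where "fe x \<equiv> ennreal (f x)"

lemma measurable_f [measurable]: "f \<in> borel_measurable X"
  using fibrewise_continuous by (simp add: fibrewise_continuous_def)

lemma fe_pos: "x \<in> space X \<Longrightarrow> 0 < fe x" "x \<in> space X \<Longrightarrow> fe x \<noteq> 0"
  using f_pos[of x] by auto

text \<open>This is where fibrewise continuity enters: \<open>f\<close> is bounded along the compact
  orbit, although it may be unbounded on \<open>X\<close> and no measure on \<open>X\<close> is in
  play.\<close>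

lemma average_f_finite:
  assumes x: "x \<in> space X"
  shows "average n fe x < \<infinity>"
proof -
  interpret H: prob_space "Haar n" by (rule prob_space_Haar)
  have "continuous_map (K n) euclideanreal (\<lambda>g. f (T g x))"
    using fibrewise_continuous x
    by (simp add: fibrewise_continuous_def continuous_map_inductive_limit_iff)
  then have "compactin euclideanreal ((\<lambda>g. f (T g x)) ` topspace (K n))"
    using compact_K[of n] unfolding compact_space_def by (intro image_compactin)
  then have "bounded ((\<lambda>g. f (T g x)) ` topspace (K n))" by (simp add: compact_imp_bounded)
  then obtain M where M: "\<And>g. g \<in> topspace (K n) \<Longrightarrow> \<bar>f (T g x)\<bar> \<le> M"
    by (auto simp: bounded_iff)
  have "average n fe x \<le> (\<integral>\<^sup>+g. ennreal M \<partial>Haar n)"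
    unfolding average_def using M by (intro nn_integral_mono ennreal_leI) force
  also have "\<dots> = ennreal M" using H.emeasure_space_1 by simp
  finally show ?thesis by (simp add: le_less_trans)
qed

lemma measurable_orbit: "x \<in> space X \<Longrightarrow> (\<lambda>g. T g x) \<in> Haar n \<rightarrow>\<^sub>M X"
  by (intro measurable_T_compose[of "\<lambda>g. g" _ n]) (auto simp: measurable_cong_sets[OF sets_Haar refl])

lemma average_f_pos:
  assumes x: "x \<in> space X"
  shows "average n fe x \<noteq> 0"
proof
  interpret H: prob_space "Haar n" by (rule prob_space_Haar)
  assume "average n fe x = 0"
  moreover have "(\<lambda>g. fe (T g x)) \<in> borel_measurable (Haar n)"
    using measurable_orbit[OF x] by measurable
  ultimately have "AE g in Haar n. fe (T g x) = 0" by (simp add: average_def nn_integral_0_iff_AE)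
  then have "AE g in Haar n. False"
  proof (rule AE_mp, intro AE_I2 impI)
    fix g assume "g \<in> space (Haar n)" "fe (T g x) = 0"
    then show False using fe_pos(2)[of "T g x"] x by (simp add: K_in_carrier)
  qed
  then show False by simp
qed

text \<open>Haar measure transported to the orbit and reweighted by \<open>f\<close>, as Bayes'
  formula demands when \<open>f \<nu>\<close> instead of \<nu> is conditioned. Integrating
  \<open>h\<close> gives the quotient of the averages of \<open>f h\<close> and of
  \<open>f\<close>.\<close>

definition orbit_kernel :: "nat \<Rightarrow> 'x \<Rightarrow> 'x measure" where
  "orbit_kernel n x = distr (density (Haar n) (\<lambda>g. fe (T g x) / average n fe x)) X (\<lambda>g. T g x)"

lemma sets_orbit_kernel [simp, measurable_cong]: "sets (orbit_kernel n x) = sets X"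
  by (simp add: orbit_kernel_def)

lemma space_orbit_kernel [simp]: "space (orbit_kernel n x) = space X"
  by (simp add: orbit_kernel_def)

lemma nn_integral_orbit_kernel:
  assumes h[measurable]: "h \<in> borel_measurable X" and x: "x \<in> space X"
  shows "(\<integral>\<^sup>+y. h y \<partial>orbit_kernel n x) = average n (\<lambda>y. fe y * h y) x / average n fe x"
proof -
  note [measurable] = measurable_orbit[OF x]
  have "(\<integral>\<^sup>+y. h y \<partial>orbit_kernel n x) = (\<integral>\<^sup>+g. fe (T g x) / average n fe x * h (T g x) \<partial>Haar n)"
    unfolding orbit_kernel_def by (subst nn_integral_distr) (auto simp: nn_integral_density)
  also have "\<dots> = (\<integral>\<^sup>+g. (fe (T g x) * h (T g x)) / average n fe x \<partial>Haar n)"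
    by (intro nn_integral_cong) (simp add: ennreal_times_divide mult.commute)
  also have "\<dots> = average n (\<lambda>y. fe y * h y) x / average n fe x"
    unfolding average_def by (rule nn_integral_divide) measurable
  finally show ?thesis .
qed

lemma emeasure_orbit_kernel:
  assumes [measurable]: "B \<in> sets X" and x: "x \<in> space X"
  shows "emeasure (orbit_kernel n x) B = average n (\<lambda>y. fe y * indicator B y) x / average n fe x"
  using nn_integral_orbit_kernel[of "indicator B" x n] x by simp

lemma prob_space_orbit_kernel: "x \<in> space X \<Longrightarrow> prob_space (orbit_kernel n x)"
  using nn_integral_orbit_kernel[of "\<lambda>_. 1" x n] average_f_pos[of x n] average_f_finite[of x n]
  by (intro prob_spaceI) (simp add: ennreal_divide_self)

sublocale orbit_kernel: measure_kernel X X "orbit_kernel n" for n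
  by unfold_locales (simp_all add: emeasure_orbit_kernel cong: measurable_cong)

lemma orbit_kernel_invariant:
  assumes "k \<in> topspace (K n)" "x \<in> space X"
  shows "orbit_kernel n (T k x) = orbit_kernel n x"
proof (rule measure_eqI)
  fix B assume "B \<in> sets (orbit_kernel n (T k x))"
  then have [measurable]: "B \<in> sets X" by simp
  show "emeasure (orbit_kernel n (T k x)) B = emeasure (orbit_kernel n x) B"
    using assms K_invariant_average[of "\<lambda>y. fe y * indicator B y" n] K_invariant_average[of fe n]
    by (simp add: emeasure_orbit_kernel K_in_carrier K_invariant_def)
qed simp

definition integrable_invariant :: "'x measure \<Rightarrow> bool" where
  "integrable_invariant \<nu> \<longleftrightarrow> invariant_measure G X T \<nu> \<and> \<nu> \<in> sigma_finite_measures X \<and> (\<integral>\<^sup>+x. fe x \<partial>\<nu>) < \<infinity>"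

abbreviation weighted :: "'x measure \<Rightarrow> 'x measure" where
  "weighted \<nu> \<equiv> density \<nu> fe"

context
  fixes \<nu> assumes \<nu>: "integrable_invariant \<nu>"
begin

lemma sets_inv [measurable_cong]: "sets \<nu> = sets X"
  using \<nu> by (simp add: integrable_invariant_def sigma_finite_measures_def)

lemma space_inv: "space \<nu> = space X"
  using sets_inv by (rule sets_eq_imp_space_eq)

lemma finite_measure_weighted: "finite_measure (weighted \<nu>)"
proof (rule finite_measureI)
  have "emeasure (weighted \<nu>) (space X) = (\<integral>\<^sup>+x. fe x * indicator (space X) x \<partial>\<nu>)"
    by (rule emeasure_density) measurable
  also have "\<dots> = (\<integral>\<^sup>+x. fe x \<partial>\<nu>)" by (rule nn_integral_cong) (simp add: space_inv)
  finally show "emeasure (weighted \<nu>) (space (weighted \<nu>)) \<noteq> \<infinity>"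
    using \<nu> by (auto simp: space_inv integrable_invariant_def)
qed

lemma AE_weighted: "(AE x in weighted \<nu>. P x) \<longleftrightarrow> (AE x in \<nu>. P x)"
proof -
  have "(AE x in weighted \<nu>. P x) \<longleftrightarrow> (AE x in \<nu>. 0 < fe x \<longrightarrow> P x)" by (rule AE_density) measurable
  also have "\<dots> \<longleftrightarrow> (AE x in \<nu>. P x)" using f_pos by (intro AE_cong) (simp add: space_inv)
  finally show ?thesis .
qed

lemma orbit_kernel_conditional:
  assumes w[measurable]: "w \<in> borel_measurable X" and winv: "K_invariant n w"
    and h[measurable]: "h \<in> borel_measurable X"
  shows "(\<integral>\<^sup>+x. w x * (\<integral>\<^sup>+y. h y \<partial>orbit_kernel n x) \<partial>weighted \<nu>) = (\<integral>\<^sup>+x. w x * h x \<partial>weighted \<nu>)"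
proof -
  have inv: "invariant_measure G X T \<nu>" "\<nu> \<in> sigma_finite_measures X"
    using \<nu> by (auto simp: integrable_invariant_def)
  \<comment> \<open>The quotient of averages is \<open>K n\<close>-invariant and can be absorbed
    into the weight. Averaging \<open>f\<close> under this weight cancels the denominator, which is
    positive and finite; the averaging identity is then used backwards to remove the average from
    \<open>f h\<close>.\<close>
  define w' where "w' = (\<lambda>x. w x * (average n (\<lambda>y. fe y * h y) x / average n fe x))"
  have w'[measurable]: "w' \<in> borel_measurable X" unfolding w'_def by measurable
  have w'inv: "K_invariant n w'"
    using winv K_invariant_average[of "\<lambda>y. fe y * h y" n] K_invariant_average[of fe n]
    by (simp add: w'_def K_invariant_def)
  have "(\<integral>\<^sup>+x. w x * (\<integral>\<^sup>+y. h y \<partial>orbit_kernel n x) \<partial>weighted \<nu>) = (\<integral>\<^sup>+x. fe x * (w x * (\<integral>\<^sup>+y. h y \<partial>orbit_kernel n x)) \<partial>\<nu>)"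
    by (rule nn_integral_density) measurable
  also have "\<dots> = (\<integral>\<^sup>+x. w' x * fe x \<partial>\<nu>)"
    by (rule nn_integral_cong) (simp add: space_inv nn_integral_orbit_kernel w'_def mult.commute)
  also have "\<dots> = (\<integral>\<^sup>+x. w' x * average n fe x \<partial>\<nu>)"
    by (rule nn_integral_average[symmetric, OF inv w' w'inv]) measurable
  also have "\<dots> = (\<integral>\<^sup>+x. w x * average n (\<lambda>y. fe y * h y) x \<partial>\<nu>)"
  proof (rule nn_integral_cong)
    fix x assume "x \<in> space \<nu>"
    then have "average n fe x \<noteq> 0" "average n fe x < \<infinity>"
      using average_f_pos average_f_finite by (auto simp: space_inv)
    then show "w' x * average n fe x = w x * average n (\<lambda>y. fe y * h y) x"
      by (simp add: w'_def mult.assoc ennreal_divide_times)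
  qed
  also have "\<dots> = (\<integral>\<^sup>+x. w x * (fe x * h x) \<partial>\<nu>)"
    by (rule nn_integral_average[OF inv w winv]) measurable
  also have "\<dots> = (\<integral>\<^sup>+x. w x * h x \<partial>weighted \<nu>)"
    by (subst nn_integral_density) (auto intro!: nn_integral_cong simp: ac_simps)
  finally show ?thesis .
qed

end

end

section \<open>Convergence of the averages\<close>

context weighted_action
begin

text \<open>It exists at every point and mentions no measure. It is invariant exactly, not only
  almost everywhere, because each \<open>g\<close> lies in all \<open>K n\<close> from some index on
  and then leaves the orbit kernels unchanged.\<close>

definition upper_limit :: "'x set \<Rightarrow> 'x \<Rightarrow> ennreal" where
  "upper_limit B x = limsup (\<lambda>n. emeasure (orbit_kernel n x) B)"

definition lower_limit :: "'x set \<Rightarrow> 'x \<Rightarrow> ennreal" where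
  "lower_limit B x = liminf (\<lambda>n. emeasure (orbit_kernel n x) B)"

lemma eventually_orbit_kernel_invariant:
  assumes "g \<in> carrier G" "x \<in> space X"
  shows "eventually (\<lambda>n. orbit_kernel n (T g x) = orbit_kernel n x) sequentially"
proof -
  obtain m where m: "g \<in> topspace (K m)" using assms(1) by (auto simp: carrier_eq)
  show ?thesis
    unfolding eventually_sequentially
    by (intro exI[of _ m] allI impI orbit_kernel_invariant assms(2)) (use m K_mono in blast)
qed

lemma measurable_upper_limit [measurable]:
  assumes [measurable]: "B \<in> sets X" shows "upper_limit B \<in> borel_measurable invariant_sets"
proof (rule measurable_invariant_setsI)
  show "upper_limit B \<in> borel_measurable X" unfolding upper_limit_def by measurable
  fix g x assume "g \<in> carrier G" "x \<in> space X"
  from eventually_orbit_kernel_invariant[OF this] show "upper_limit B (T g x) = upper_limit B x"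
    unfolding upper_limit_def by (intro Limsup_eq) (auto elim: eventually_mono)
qed

lemma measurable_lower_limit [measurable]:
  assumes [measurable]: "B \<in> sets X" shows "lower_limit B \<in> borel_measurable invariant_sets"
proof (rule measurable_invariant_setsI)
  show "lower_limit B \<in> borel_measurable X" unfolding lower_limit_def by measurable
  fix g x assume "g \<in> carrier G" "x \<in> space X"
  from eventually_orbit_kernel_invariant[OF this] show "lower_limit B (T g x) = lower_limit B x"
    unfolding lower_limit_def by (intro Liminf_eq) (auto elim: eventually_mono)
qed

lemma limits_le_1:
  assumes x: "x \<in> space X"
  shows "lower_limit B x \<le> upper_limit B x" "upper_limit B x \<le> 1" "emeasure (orbit_kernel n x) B \<le> 1"
proof -
  have le: "emeasure (orbit_kernel n x) B \<le> 1" for n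
    using prob_space_orbit_kernel[OF x] by (rule subprob_space.subprob_emeasure_le_1[OF prob_space_imp_subprob_space])
  then show "emeasure (orbit_kernel n x) B \<le> 1" .
  show "lower_limit B x \<le> upper_limit B x"
    unfolding lower_limit_def upper_limit_def by (rule Liminf_le_Limsup) simp
  show "upper_limit B x \<le> 1"
    unfolding upper_limit_def by (rule Limsup_bounded) (simp add: le)
qed

context
  fixes \<nu> assumes \<nu>: "integrable_invariant \<nu>"
begin

lemma orbit_kernel_conditional_set:
  assumes D[measurable]: "D \<in> sets X" and inv: "K_invariant n (indicator D :: _ \<Rightarrow> ennreal)"
    and B[measurable]: "B \<in> sets X"
  shows "(\<integral>\<^sup>+x. indicator D x * emeasure (orbit_kernel n x) B \<partial>weighted \<nu>) = emeasure (weighted \<nu>) (D \<inter> B)"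
proof -
  have sp: "space \<nu> = space X" by (rule space_inv[OF \<nu>])
  have "(\<integral>\<^sup>+x. indicator D x * emeasure (orbit_kernel n x) B \<partial>weighted \<nu>)
      = (\<integral>\<^sup>+x. indicator D x * (\<integral>\<^sup>+y. indicator B y \<partial>orbit_kernel n x) \<partial>weighted \<nu>)"
    by simp
  also have "\<dots> = (\<integral>\<^sup>+x. indicator D x * indicator B x \<partial>weighted \<nu>)"
    by (rule orbit_kernel_conditional[OF \<nu> _ inv]) measurable
  also have "\<dots> = (\<integral>\<^sup>+x. indicator (D \<inter> B) x \<partial>weighted \<nu>)"
    by (simp add: indicator_inter_arith)
  also have "\<dots> = emeasure (weighted \<nu>) (D \<inter> B)"
    by (rule nn_integral_indicator) (simp add: sets_inv[OF \<nu>])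
  finally show ?thesis .
qed

text \<open>
  The averages form a reverse martingale because the \<open>K n\<close> increase, so one decomposes according
  to the last index at which the level is exceeded.
\<close>

lemma maximal_inequality:
  assumes J: "J \<in> sets invariant_sets" and B[measurable]: "B \<in> sets X"
    and exceed: "\<And>x. x \<in> J \<Longrightarrow> \<exists>n. c < emeasure (orbit_kernel n x) B"
  shows "c * emeasure (weighted \<nu>) J \<le> emeasure (weighted \<nu>) (J \<inter> B)"
proof -
  let ?P = "weighted \<nu>"
  have sets_P[measurable_cong]: "sets \<nu> = sets X" by (rule sets_inv[OF \<nu>])
  have JX[measurable]: "J \<in> sets X" using J by (rule invariant_sets_subset)
  define J' where "J' N = {x \<in> J. \<exists>n\<le>N. c < emeasure (orbit_kernel n x) B}" for N :: nat
  define D where "D N j = {x \<in> J. c < emeasure (orbit_kernel j x) B \<and>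
      (\<forall>i\<in>{j<..N}. emeasure (orbit_kernel i x) B \<le> c)}" for N j :: nat
  have JX': "J = {x \<in> space X. x \<in> J}" using sets.sets_into_space[OF JX] by auto
  have [measurable]: "J' N \<in> sets X" for N
  proof -
    have "J' N = {x \<in> space X. x \<in> J \<and> (\<exists>n\<in>{..N}. c < emeasure (orbit_kernel n x) B)}"
      using JX' by (auto simp: J'_def)
    also have "\<dots> \<in> sets X" by measurable
    finally show ?thesis .
  qed
  have [measurable]: "D N j \<in> sets X" for N j
  proof -
    have "D N j = {x \<in> space X. x \<in> J \<and> c < emeasure (orbit_kernel j x) B \<and>
      (\<forall>i\<in>{j<..N}. emeasure (orbit_kernel i x) B \<le> c)}"
      using JX' by (auto simp: D_def)
    also have "\<dots> \<in> sets X" by measurable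
    finally show ?thesis .
  qed
  \<comment> \<open>Only kernels of index at least \<open>j\<close> occur in \<open>D N j\<close>.
    They are constant on \<open>K j\<close>-orbits because the groups increase, so
    \<open>D N j\<close> is a legitimate test set for conditioning at stage
    \<open>j\<close>.\<close>
  have D_inv: "K_invariant j (indicator (D N j) :: _ \<Rightarrow> ennreal)" for N j
  proof -
    have "T k x \<in> D N j \<longleftrightarrow> x \<in> D N j" if k: "k \<in> topspace (K j)" and x: "x \<in> space X" for k x
    proof -
      have "T k x \<in> J \<longleftrightarrow> x \<in> J" using J x K_in_carrier[OF k] by (auto simp: sets_invariant_sets)
      moreover have "orbit_kernel i (T k x) = orbit_kernel i x" if "j \<le> i" for i
        using k x K_mono[OF that] by (intro orbit_kernel_invariant) auto
      ultimately show ?thesis by (simp add: D_def)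
    qed
    then show ?thesis by (auto simp: K_invariant_def split: split_indicator)
  qed
  have D_le: "c * emeasure ?P (D N j) \<le> emeasure ?P (D N j \<inter> B)" for N j
  proof -
    have "c * emeasure ?P (D N j) = (\<integral>\<^sup>+x. c * indicator (D N j) x \<partial>?P)"
      by (rule nn_integral_cmult_indicator[symmetric]) (simp add: sets_P)
    also have "\<dots> \<le> (\<integral>\<^sup>+x. indicator (D N j) x * emeasure (orbit_kernel j x) B \<partial>?P)"
      by (intro nn_integral_mono) (auto simp: D_def split: split_indicator)
    also have "\<dots> = emeasure ?P (D N j \<inter> B)"
      by (rule orbit_kernel_conditional_set[OF _ D_inv]) measurable
    finally show ?thesis .
  qed
  have J'_eq: "J' N = (\<Union>j\<in>{..N}. D N j)" for N
  proof (intro equalityI subsetI)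
    fix x assume x: "x \<in> J' N"
    define S where "S = {n. n \<le> N \<and> c < emeasure (orbit_kernel n x) B}"
    have S: "finite S" "S \<noteq> {}" using x by (auto simp: S_def J'_def)
    have "Max S \<in> S" using S by (rule Max_in)
    moreover have "emeasure (orbit_kernel i x) B \<le> c" if "Max S < i" "i \<le> N" for i
      using Max_ge[OF S(1), of i] that by (force simp: S_def not_less[symmetric])
    ultimately have "x \<in> D N (Max S)" "Max S \<le> N" using x by (auto simp: D_def J'_def S_def)
    then show "x \<in> (\<Union>j\<in>{..N}. D N j)" by blast
  qed (auto simp: J'_def D_def)
  have disj: "disjoint_family_on (D N) {..N}" for N
    unfolding disjoint_family_on_def
  proof (intro ballI impI)
    fix i j assume "i \<in> {..N}" "j \<in> {..N}" "i \<noteq> j"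
    then show "D N i \<inter> D N j = {}" by (cases i j rule: linorder_cases) (force simp: D_def)+
  qed
  have J'_le: "c * emeasure ?P (J' N) \<le> emeasure ?P (J \<inter> B)" for N
  proof -
    have "c * emeasure ?P (J' N) = (\<Sum>j\<in>{..N}. c * emeasure ?P (D N j))"
      unfolding J'_eq
      by (subst sum_emeasure[symmetric]) (auto simp: sets_P disj sum_distrib_left)
    also have "\<dots> \<le> (\<Sum>j\<in>{..N}. emeasure ?P (D N j \<inter> B))"
      by (rule sum_mono) (rule D_le)
    also have "\<dots> = emeasure ?P (\<Union>j\<in>{..N}. D N j \<inter> B)"
      using disj[of N] by (intro sum_emeasure) (auto simp: sets_P disjoint_family_on_def)
    also have "\<dots> \<le> emeasure ?P (J \<inter> B)"
      by (intro emeasure_mono) (auto simp: sets_P D_def)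
    finally show ?thesis .
  qed
  have "J = (\<Union>N. J' N)" using exceed by (fastforce simp: J'_def)
  moreover have "(SUP N. emeasure ?P (J' N)) = emeasure ?P (\<Union>N. J' N)"
    by (rule SUP_emeasure_incseq) (auto simp: sets_P incseq_def J'_def intro: order_trans)
  ultimately have "c * emeasure ?P J = (SUP N. c * emeasure ?P (J' N))"
    by (metis SUP_mult_left_ennreal)
  also have "\<dots> \<le> emeasure ?P (J \<inter> B)" by (rule SUP_least) (rule J'_le)
  finally show ?thesis .
qed

text \<open>Let \<open>J\<close> be the invariant set where the lower limit is below
  \<open>a\<close> and the upper limit above \<open>b\<close>, with \<open>a < b\<close>. The
  maximal inequality for \<open>B\<close> with level \<open>b\<close> and for its complement with
  level \<open>1 - a\<close> bounds the two parts of \<open>J\<close> from below; adding them gives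
  \<open>(b - a) * measure ?P J \<le> 0\<close>. Countably many rational pairs suffice.\<close>

lemma AE_limits_eq:
  assumes B[measurable]: "B \<in> sets X"
  shows "AE x in weighted \<nu>. lower_limit B x = upper_limit B x"
proof -
  let ?P = "weighted \<nu>"
  interpret P: finite_measure ?P by (rule finite_measure_weighted[OF \<nu>])
  have sets_P[measurable_cong]: "sets \<nu> = sets X" by (rule sets_inv[OF \<nu>])
  have space_P: "space \<nu> = space X" using sets_P by (rule sets_eq_imp_space_eq)
  have "AE x in ?P. \<not> (lower_limit B x < ennreal a \<and> ennreal b < upper_limit B x)"
    if ab: "0 < a" "a < b" "b < 1" for a b :: real
  proof -
    define J where "J = {x \<in> space invariant_sets. lower_limit B x < ennreal a \<and> ennreal b < upper_limit B x}"
    have J: "J \<in> sets invariant_sets" unfolding J_def by measurable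
    have JX: "J \<in> sets X" using J by (rule invariant_sets_subset)
    have "ennreal b * emeasure ?P J \<le> emeasure ?P (J \<inter> B)"
    proof (rule maximal_inequality[OF J B])
      fix x assume "x \<in> J"
      then have "ennreal b < upper_limit B x" by (simp add: J_def)
      then show "\<exists>n. ennreal b < emeasure (orbit_kernel n x) B"
        unfolding upper_limit_def
        by (metis (mono_tags, lifting) Limsup_bounded always_eventually not_le)
    qed
    then have b: "b * measure ?P J \<le> measure ?P (J \<inter> B)"
      using ab by (simp add: P.emeasure_eq_measure ennreal_mult[symmetric])
    have "ennreal (1 - a) * emeasure ?P J \<le> emeasure ?P (J \<inter> (space X - B))"
    proof (rule maximal_inequality[OF J])
      fix x assume "x \<in> J"
      then have x: "x \<in> space X" and "lower_limit B x < ennreal a" by (auto simp: J_def)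
      then obtain n where n: "emeasure (orbit_kernel n x) B < ennreal a"
        unfolding lower_limit_def by (metis (mono_tags, lifting) Liminf_bounded always_eventually not_le)
      interpret R: prob_space "orbit_kernel n x" by (rule prob_space_orbit_kernel[OF x])
      have "measure (orbit_kernel n x) (space X - B) = 1 - measure (orbit_kernel n x) B"
        using R.prob_compl[of B] by simp
      moreover have "measure (orbit_kernel n x) B < a"
        using n ab by (simp add: R.emeasure_eq_measure ennreal_less_iff)
      ultimately have "ennreal (1 - a) < emeasure (orbit_kernel n x) (space X - B)"
        using ab by (simp add: R.emeasure_eq_measure ennreal_less_iff)
      then show "\<exists>n. ennreal (1 - a) < emeasure (orbit_kernel n x) (space X - B)" ..
    qed measurable
    then have a: "(1 - a) * measure ?P J \<le> measure ?P (J \<inter> (space X - B))"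
      using ab by (simp add: P.emeasure_eq_measure ennreal_mult[symmetric])
    have "measure ?P J = measure ?P (J \<inter> B) + measure ?P (J \<inter> (space X - B))"
    proof -
      have "J = (J \<inter> B) \<union> (J \<inter> (space X - B))" using sets.sets_into_space[OF JX] by auto
      moreover have "measure ?P ((J \<inter> B) \<union> (J \<inter> (space X - B))) = measure ?P (J \<inter> B) + measure ?P (J \<inter> (space X - B))"
        by (rule P.finite_measure_Union) (auto simp: sets_P JX)
      ultimately show ?thesis by simp
    qed
    with a b have "(b - a) * measure ?P J \<le> 0" by (simp add: algebra_simps)
    then have "measure ?P J = 0" using ab measure_nonneg[of ?P J] by (simp add: mult_le_0_iff)
    then have "J \<in> null_sets ?P" by (simp add: null_sets_def P.emeasure_eq_measure sets_P JX)
    then show ?thesis by (rule AE_I') (auto simp: J_def space_P)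
  qed
  then have "AE x in ?P. \<forall>i j. 0 < rational_enum i \<and> rational_enum i < rational_enum j \<and> rational_enum j < 1 \<longrightarrow>
      \<not> (lower_limit B x < ennreal (rational_enum i) \<and> ennreal (rational_enum j) < upper_limit B x)"
    by (simp add: AE_all_countable)
  then show ?thesis
  proof (rule AE_mp, intro AE_I2 impI)
    fix x assume "x \<in> space ?P"
    then have x: "x \<in> space X" by (simp add: space_P)
    assume *: "\<forall>i j. 0 < rational_enum i \<and> rational_enum i < rational_enum j \<and> rational_enum j < 1 \<longrightarrow>
      \<not> (lower_limit B x < ennreal (rational_enum i) \<and> ennreal (rational_enum j) < upper_limit B x)"
    define l where "l = enn2real (lower_limit B x)"
    define u where "u = enn2real (upper_limit B x)"
    have fin: "upper_limit B x \<le> 1" "lower_limit B x \<le> 1" using limits_le_1(1,2)[OF x, where B=B] by auto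
    then have eq: "lower_limit B x = ennreal l" "upper_limit B x = ennreal u"
      unfolding l_def u_def by (metis ennreal_enn2real ennreal_one_less_top le_less_trans)+
    have b: "0 \<le> l" "0 \<le> u" by (simp_all add: l_def u_def)
    have b': "u \<le> 1" using fin(1) unfolding eq(2) by (simp add: ennreal_le_1)
    show "lower_limit B x = upper_limit B x"
    proof (rule ccontr)
      assume "lower_limit B x \<noteq> upper_limit B x"
      then have "l < u" using limits_le_1(1)[OF x, where B=B] b by (cases "l = u") (auto simp: eq ennreal_le_iff2)
      then obtain j where j: "l < rational_enum j" "rational_enum j < u" using rational_enum_dense by blast
      obtain i where i: "l < rational_enum i" "rational_enum i < rational_enum j" using rational_enum_dense[OF j(1)] by blast
      show False using *[rule_format, of i j] i j b b' by (simp add: eq ennreal_less_iff)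
    qed
  qed
qed

lemma AE_LIMSEQ_orbit_kernel:
  assumes B: "B \<in> sets X"
  shows "AE x in weighted \<nu>. (\<lambda>n. emeasure (orbit_kernel n x) B) \<longlonglongrightarrow> upper_limit B x"
  using AE_limits_eq[OF B]
  by eventually_elim (auto simp: lower_limit_def upper_limit_def intro: Liminf_eq_Limsup)

text \<open>An invariant set is invariant under every \<open>K n\<close>, so the integrals of the
  orbit kernels over it do not depend on \<open>n\<close>. Dominated convergence passes their common
  value to the limit.\<close>

lemma upper_limit_conditional:
  assumes J: "J \<in> sets invariant_sets" and B[measurable]: "B \<in> sets X"
  shows "(\<integral>\<^sup>+x. indicator J x * upper_limit B x \<partial>weighted \<nu>) = emeasure (weighted \<nu>) (J \<inter> B)"
proof -
  interpret P: finite_measure "weighted \<nu>" by (rule finite_measure_weighted[OF \<nu>])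
  note [measurable_cong] = sets_inv[OF \<nu>]
  have JX[measurable]: "J \<in> sets X" using J by (rule invariant_sets_subset)
  have [measurable]: "upper_limit B \<in> borel_measurable X"
    by (rule measurable_invariant_setsD) (rule measurable_upper_limit[OF B])
  have "(\<lambda>n. \<integral>\<^sup>+x. indicator J x * emeasure (orbit_kernel n x) B \<partial>weighted \<nu>)
      \<longlonglongrightarrow> (\<integral>\<^sup>+x. indicator J x * upper_limit B x \<partial>weighted \<nu>)"
  proof (rule nn_integral_dominated_convergence[where w="\<lambda>_. 1"])
    show "AE x in weighted \<nu>. indicator J x * emeasure (orbit_kernel n x) B \<le> 1" for n
      using limits_le_1(3) by (intro AE_I2) (auto simp: space_inv[OF \<nu>] split: split_indicator)
    show "AE x in weighted \<nu>. (\<lambda>n. indicator J x * emeasure (orbit_kernel n x) B) \<longlonglongrightarrow> indicator J x * upper_limit B x"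
      using AE_LIMSEQ_orbit_kernel[OF B] by eventually_elim (auto split: split_indicator)
    show "(\<integral>\<^sup>+x. 1 \<partial>weighted \<nu>) < \<infinity>" by (simp add: less_top[symmetric])
  qed (simp_all add: measurable_cong_sets[OF sets_inv[OF \<nu>] refl])
  moreover have "(\<integral>\<^sup>+x. indicator J x * emeasure (orbit_kernel n x) B \<partial>weighted \<nu>) = emeasure (weighted \<nu>) (J \<inter> B)" for n
    by (rule orbit_kernel_conditional_set[OF JX K_invariant_indicator[OF J] B])
  ultimately show ?thesis by (simp add: LIMSEQ_const_iff)
qed

end

section \<open>The limiting kernel\<close>

definition limit_sequence :: "'x \<Rightarrow> nat \<Rightarrow> real" where
  "limit_sequence x j = enn2real (upper_limit (initial j) x)"

text \<open>The regular conditional probability given the invariant sets, for all integrable invariant measures at once.\<close>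

definition limit_kernel :: "'x \<Rightarrow> 'x measure" where
  "limit_kernel x = reconstruct (limit_sequence x)"

lemma measurable_limit_kernel: "limit_kernel \<in> invariant_sets \<rightarrow>\<^sub>M prob_algebra X"
proof -
  have "limit_sequence \<in> borel_measurable invariant_sets"
    unfolding limit_sequence_def
    by (intro measurable_coordinatewise_then_product) measurable
  then show ?thesis unfolding limit_kernel_def by measurable
qed

lemma prob_space_limit_kernel: "prob_space (limit_kernel x)"
  and sets_limit_kernel [simp, measurable_cong]: "sets (limit_kernel x) = sets X"
  and space_limit_kernel [simp]: "space (limit_kernel x) = space X"
  by (simp_all add: limit_kernel_def prob_space_reconstruct)

sublocale limit_kernel: measure_kernel invariant_sets X limit_kernel
proof
  fix A assume "A \<in> sets X"
  then have "(\<lambda>P. emeasure P A) \<in> borel_measurable (subprob_algebra X)"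
    by (rule measurable_emeasure_subprob_algebra)
  moreover have "limit_kernel \<in> invariant_sets \<rightarrow>\<^sub>M subprob_algebra X"
    using measurable_limit_kernel by (rule measurable_prob_algebraD)
  ultimately show "(\<lambda>x. emeasure (limit_kernel x) A) \<in> borel_measurable invariant_sets"
    by (rule measurable_compose[rotated])
qed simp

text \<open>The upper limits already lie in the unit interval and have the right values on the empty
  and on the full initial segments, so clipping changes nothing.\<close>

lemma clipped_limit_sequence:
  assumes x: "x \<in> space X"
  shows "ennreal (clipped (limit_sequence x) j) = upper_limit (initial j) x"
proof -
  interpret R: prob_space "orbit_kernel n x" for n by (rule prob_space_orbit_kernel[OF x])
  have "upper_limit (initial j) x \<le> 1" by (rule limits_le_1(2)[OF x])
  moreover then have "ennreal (limit_sequence x j) = upper_limit (initial j) x"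
    unfolding limit_sequence_def by (metis ennreal_enn2real ennreal_one_less_top le_less_trans)
  moreover have "limit_sequence x j \<ge> 0" by (simp add: limit_sequence_def)
  moreover have "upper_limit (initial j) x = 0" if "rational_enum j < 0"
    using initial_trivial(1)[OF that] by (simp add: upper_limit_def Limsup_const)
  moreover have "upper_limit (initial j) x = 1" if "rational_enum j > 1"
    using initial_trivial(2)[OF that] R.emeasure_space_1 by (simp add: upper_limit_def Limsup_const)
  ultimately show ?thesis
    by (auto simp: clipped_def min_absorb2 max_absorb2 ennreal_le_1 simp flip: ennreal_le_1)
qed

lemma clipped_limit_sequence_mono:
  assumes x: "x \<in> space X" and "rational_enum i \<le> rational_enum j"
  shows "clipped (limit_sequence x) i \<le> clipped (limit_sequence x) j"
proof -
  have "upper_limit (initial i) x \<le> upper_limit (initial j) x"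
    unfolding upper_limit_def using initial_mono[OF assms(2)]
    by (intro Limsup_mono always_eventually allI emeasure_mono) auto
  then show ?thesis
    using clipped_limit_sequence[OF x] clipped_bounds(1) by (metis ennreal_le_iff)
qed

text \<open>The conditional identity is known for the upper limits of initial segments, but the
  kernel is rebuilt from right limits of these numbers. It is therefore proved first for all
  half-lines in the code and then extended to every \<open>B\<close>, both sides being finite
  measures in \<open>B\<close>.\<close>

theorem limit_kernel_conditional_set:
  assumes \<nu>: "integrable_invariant \<nu>" and J: "J \<in> sets invariant_sets" and B: "B \<in> sets X"
  shows "(\<integral>\<^sup>+x. indicator J x * emeasure (limit_kernel x) B \<partial>weighted \<nu>) = emeasure (weighted \<nu>) (J \<inter> B)"
proof -
  let ?P = "weighted \<nu>"
  interpret P: finite_measure ?P by (rule finite_measure_weighted[OF \<nu>])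
  note sets_P[measurable_cong] = sets_inv[OF \<nu>]
  have sp: "space \<nu> = space X" by (rule space_inv[OF \<nu>])
  have JX[measurable]: "J \<in> sets X" using J by (rule invariant_sets_subset)
  have meas_ker: "(\<lambda>x. emeasure (limit_kernel x) A) \<in> borel_measurable X" if "A \<in> sets X" for A
    using limit_kernel.measurable_kernel[OF that] by (rule measurable_invariant_setsD)
  have meas_clip: "(\<lambda>x. ennreal (clipped (limit_sequence x) j)) \<in> borel_measurable X" for j
  proof -
    have "upper_limit (initial j) \<in> borel_measurable X"
      by (rule measurable_invariant_setsD) measurable
    then show ?thesis by (simp cong: measurable_cong add: clipped_limit_sequence)
  qed
  have meas_cdf: "(\<lambda>x. ennreal (sequence_cdf (limit_sequence x) t)) \<in> borel_measurable X" for t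
  proof -
    have "limit_sequence \<in> borel_measurable invariant_sets"
      unfolding limit_sequence_def by (intro measurable_coordinatewise_then_product) measurable
    then have "(\<lambda>x. ennreal (sequence_cdf (limit_sequence x) t)) \<in> borel_measurable invariant_sets" by measurable
    then show ?thesis by (rule measurable_invariant_setsD)
  qed
  define L where "L t = {x \<in> space X. code x \<le> t}" for t
  have [measurable]: "L t \<in> sets X" for t unfolding L_def by measurable
  \<comment> \<open>Rationals \<open>rational_enum (j k)\<close> decreasing to \<open>t\<close> only
    in the limit suffice: on one side monotonicity makes the clipped values converge to the infimum,
    on the other the initial segments converge to \<open>L t\<close> pointwise. Both sides pass to
    the limit by dominated convergence.\<close>
  have cdf: "(\<integral>\<^sup>+x. indicator J x * ennreal (sequence_cdf (limit_sequence x) t) \<partial>?P) = emeasure ?P (J \<inter> L t)" for t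
  proof -
    have "\<exists>j. t < rational_enum j \<and> rational_enum j < t + 1 / Suc k" for k
      by (rule rational_enum_dense) simp
    then obtain j where j: "\<And>k. t < rational_enum (j k)" "\<And>k. rational_enum (j k) < t + 1 / Suc k" by metis
    have ev: "eventually (\<lambda>k. rational_enum (j k) < s) sequentially" if "t < s" for s
    proof -
      have "(\<lambda>k. t + 1 / real (Suc k)) \<longlonglongrightarrow> t + 0"
        by (intro tendsto_add tendsto_const LIMSEQ_inverse_real_of_nat[unfolded inverse_eq_divide])
      then have "eventually (\<lambda>k. t + 1 / real (Suc k) < s) sequentially" using that by (intro order_tendstoD(2)) auto
      then show ?thesis by eventually_elim (use j(2) less_trans in blast)
    qed
    have "(\<lambda>k. \<integral>\<^sup>+x. indicator J x * ennreal (clipped (limit_sequence x) (j k)) \<partial>?P)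
        \<longlonglongrightarrow> (\<integral>\<^sup>+x. indicator J x * ennreal (sequence_cdf (limit_sequence x) t) \<partial>?P)"
    proof (rule nn_integral_dominated_convergence[where w="\<lambda>_. 1"])
      show "AE x in ?P. indicator J x * ennreal (clipped (limit_sequence x) (j k)) \<le> 1" for k
        using clipped_bounds(2) by (intro AE_I2) (auto split: split_indicator simp: ennreal_le_1)
      show "AE x in ?P. (\<lambda>k. indicator J x * ennreal (clipped (limit_sequence x) (j k)))
          \<longlonglongrightarrow> indicator J x * ennreal (sequence_cdf (limit_sequence x) t)"
      proof (rule AE_I2)
        fix x assume "x \<in> space ?P"
        then have x: "x \<in> space X" by (simp add: sp)
        have "(\<lambda>k. clipped (limit_sequence x) (j k)) \<longlonglongrightarrow> sequence_cdf (limit_sequence x) t"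
        proof (rule order_tendstoI)
          fix c assume "c < sequence_cdf (limit_sequence x) t"
          then show "eventually (\<lambda>k. c < clipped (limit_sequence x) (j k)) sequentially"
            using sequence_cdf_le[OF j(1)] by (intro always_eventually allI) (rule less_le_trans)
        next
          fix c assume "sequence_cdf (limit_sequence x) t < c"
          then obtain i where i: "t < rational_enum i" "clipped (limit_sequence x) i < c"
            by (rule sequence_cdf_less)
          show "eventually (\<lambda>k. clipped (limit_sequence x) (j k) < c) sequentially"
            using ev[OF i(1)]
            by eventually_elim (use i(2) clipped_limit_sequence_mono[OF x] le_less_trans less_imp_le in metis)
        qed
        then show "(\<lambda>k. indicator J x * ennreal (clipped (limit_sequence x) (j k)))
          \<longlonglongrightarrow> indicator J x * ennreal (sequence_cdf (limit_sequence x) t)"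
          by (auto split: split_indicator)
      qed
    qed (use meas_clip meas_cdf in \<open>simp_all add: less_top[symmetric] measurable_cong_sets[OF sets_P refl]\<close>)
    moreover have "(\<integral>\<^sup>+x. indicator J x * ennreal (clipped (limit_sequence x) (j k)) \<partial>?P)
        = (\<integral>\<^sup>+x. indicator J x * indicator (initial (j k)) x \<partial>?P)" for k
    proof -
      have "(\<integral>\<^sup>+x. indicator J x * ennreal (clipped (limit_sequence x) (j k)) \<partial>?P)
          = (\<integral>\<^sup>+x. indicator J x * upper_limit (initial (j k)) x \<partial>?P)"
        by (rule nn_integral_cong) (simp add: clipped_limit_sequence sp)
      also have "\<dots> = emeasure ?P (J \<inter> initial (j k))"
        by (rule upper_limit_conditional[OF \<nu> J]) simp
      also have "\<dots> = (\<integral>\<^sup>+x. indicator J x * indicator (initial (j k)) x \<partial>?P)"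
        by (simp add: indicator_inter_arith[symmetric] sets_P)
      finally show ?thesis .
    qed
    moreover have "(\<lambda>k. \<integral>\<^sup>+x. indicator J x * indicator (initial (j k)) x \<partial>?P)
        \<longlonglongrightarrow> (\<integral>\<^sup>+x. indicator J x * indicator (L t) x \<partial>?P)"
    proof (rule nn_integral_dominated_convergence[where w="\<lambda>_. 1"])
      show "AE x in ?P. (\<lambda>k. indicator J x * indicator (initial (j k)) x)
          \<longlonglongrightarrow> indicator J x * (indicator (L t) x :: ennreal)"
      proof (rule AE_I2)
        fix x assume "x \<in> space ?P"
        then have x: "x \<in> space X" by (simp add: sp)
        have "eventually (\<lambda>k. indicator (initial (j k)) x = (indicator (L t) x :: ennreal)) sequentially"
        proof (cases "code x \<le> t")
          case True
          then show ?thesis using x j(1) by (intro always_eventually allI) (auto simp: initial_def L_def indicator_def intro: order_trans less_imp_le)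
        next
          case False
          then have "eventually (\<lambda>k. rational_enum (j k) < code x) sequentially" by (intro ev) simp
          then show ?thesis by eventually_elim (use False in \<open>auto simp: initial_def L_def\<close>)
        qed
        then have "eventually (\<lambda>k. indicator J x * indicator (initial (j k)) x = indicator J x * (indicator (L t) x :: ennreal)) sequentially"
          by eventually_elim simp
        then show "(\<lambda>k. indicator J x * indicator (initial (j k)) x)
          \<longlonglongrightarrow> indicator J x * (indicator (L t) x :: ennreal)" by (rule tendsto_eventually)
      qed
      show "AE x in ?P. indicator J x * indicator (initial (j k)) x \<le> (1 :: ennreal)" for k
        by (intro AE_I2) (auto split: split_indicator)
    qed (simp_all add: less_top[symmetric] measurable_cong_sets[OF sets_P refl])
    ultimately have "(\<integral>\<^sup>+x. indicator J x * ennreal (sequence_cdf (limit_sequence x) t) \<partial>?P)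
        = (\<integral>\<^sup>+x. indicator J x * indicator (L t) x \<partial>?P)"
      using LIMSEQ_unique by (simp only:)
    also have "\<dots> = emeasure ?P (J \<inter> L t)"
      by (simp add: indicator_inter_arith[symmetric] sets_P)
    finally show ?thesis .
  qed
  have [measurable]: "indicator J \<in> borel_measurable \<nu>" by (simp add: measurable_cong_sets[OF sets_P refl])
  \<comment> \<open>\<mu> and \<open>\<mu>'\<close> are the right and left side of the claim, read
    as measures in \<open>B\<close>.\<close>
  define \<mu> where "\<mu> = density ?P (indicator J)"
  have sets_\<mu>[measurable_cong]: "sets \<mu> = sets X" by (simp add: \<mu>_def sets_P)
  define \<mu>' where "\<mu>' = mixture \<mu> X limit_kernel"
  interpret LK: measure_kernel X X limit_kernel
    by unfold_locales (use meas_ker in auto)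
  have em': "emeasure \<mu>' A = (\<integral>\<^sup>+x. indicator J x * emeasure (limit_kernel x) A \<partial>?P)" if "A \<in> sets X" for A
  proof -
    have "emeasure \<mu>' A = (\<integral>\<^sup>+x. emeasure (limit_kernel x) A \<partial>\<mu>)"
      unfolding \<mu>'_def by (rule LK.emeasure_mixture[OF sets_\<mu> that])
    also have "\<dots> = (\<integral>\<^sup>+x. indicator J x * emeasure (limit_kernel x) A \<partial>?P)"
      unfolding \<mu>_def using meas_ker[OF that]
      by (intro nn_integral_density) (simp_all add: measurable_cong_sets[OF sets_P refl])
    finally show ?thesis .
  qed
  have em: "emeasure \<mu> A = emeasure ?P (J \<inter> A)" if "A \<in> sets X" for A
    unfolding \<mu>_def using that by (subst emeasure_density) (simp_all add: sets_P indicator_inter_arith[symmetric])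
  have sets_\<mu>': "sets \<mu>' = sets X" by (simp add: \<mu>'_def)
  have sp\<mu>: "space \<mu> = space X" "space \<mu>' = space X"
    using sets_eq_imp_space_eq[OF sets_\<mu>] sets_eq_imp_space_eq[OF sets_\<mu>'] by simp_all
  have "distr \<mu>' borel code = distr \<mu> borel code"
  proof (rule measure_eqI_generator_eq[where E="range atMost" and A="\<lambda>i. {.. real i}"])
    show "Int_stable (range atMost :: real set set)" by (auto simp: Int_stable_def)
    show "sets (distr \<mu>' borel code) = sigma_sets UNIV (range atMost)"
      "sets (distr \<mu> borel code) = sigma_sets UNIV (range atMost)" by (simp_all add: borel_eq_atMost)
    show "(\<Union>i. {.. real i}) = UNIV" by (auto intro: real_arch_simple)
    have L: "emeasure (distr M borel code) {..t} = emeasure M (L t)" if "sets M = sets X" for M t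
    proof -
      have "code -` {..t} \<inter> space M = L t" using sets_eq_imp_space_eq[OF that] by (auto simp: L_def)
      then show ?thesis using that by (subst emeasure_distr) (simp_all add: measurable_cong_sets[OF that refl])
    qed
    have "emeasure (distr \<mu>' borel code) {..t} = emeasure (distr \<mu> borel code) {..t}" for t
    proof -
      have "emeasure (limit_kernel x) (L t) = ennreal (sequence_cdf (limit_sequence x) t)" if "x \<in> space X" for x
      proof -
        have sp_seq: "space (sequence_measure z) = UNIV" "sets (sequence_measure z) = sets borel" "prob_space (sequence_measure z)" for z
          using real_distribution.space_eq_univ[OF real_distribution_sequence_measure[of z]]
            real_distribution_sequence_measure[of z]
          by (simp_all add: real_distribution_def real_distribution_axioms_def)
        have "emeasure (limit_kernel x) (L t) = emeasure (sequence_measure (limit_sequence x)) (decode -` L t)"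
          unfolding limit_kernel_def reconstruct_def
          by (subst emeasure_distr) (simp_all add: sp_seq measurable_cong_sets[OF sp_seq(2) refl])
        \<comment> \<open>Because of the clamping this set is empty for negative \<open>t\<close>
          and the whole line for \<open>t\<close> at least 1; there the distribution function is 0
          and 1, and in between the set is a half-line.\<close>
        also have "decode -` L t = {s. max 0 (min 1 s) \<le> t}"
          using measurable_space[OF measurable_decode] by (auto simp: L_def code_decode)
        also have "emeasure (sequence_measure (limit_sequence x)) \<dots> = ennreal (sequence_cdf (limit_sequence x) t)"
        proof -
          consider "t < 0" | "1 \<le> t" | "0 \<le> t" "t < 1" by linarith
          then show ?thesis
          proof cases
            case 1
            then have "{s::real. max 0 (min 1 s) \<le> t} = {}" by auto
            then show ?thesis using 1 by (simp add: sequence_cdf_neg)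
          next
            case 2
            then have "{s::real. max 0 (min 1 s) \<le> t} = UNIV" by auto
            then show ?thesis using 2 prob_space.emeasure_space_1[OF sp_seq(3)[of "limit_sequence x"]]
              by (simp add: sequence_cdf_ge1 sp_seq)
          next
            case 3
            then have "{s::real. max 0 (min 1 s) \<le> t} = {..t}" by auto
            then show ?thesis by (simp add: emeasure_sequence_measure)
          qed
        qed
        finally show ?thesis .
      qed
      then have "emeasure \<mu>' (L t) = (\<integral>\<^sup>+x. indicator J x * ennreal (sequence_cdf (limit_sequence x) t) \<partial>?P)"
        by (subst em') (auto intro!: nn_integral_cong simp: sp)
      also have "\<dots> = emeasure \<mu> (L t)" by (simp add: cdf em)
      finally show ?thesis by (simp add: L sets_\<mu> sets_\<mu>')
    qed
    then show "\<And>A. A \<in> range atMost \<Longrightarrow> emeasure (distr \<mu>' borel code) A = emeasure (distr \<mu> borel code) A"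
      by blast
    then have "emeasure (distr \<mu>' borel code) {..real i} = emeasure ?P (J \<inter> L (real i))" for i
      by (simp add: L sets_\<mu> em)
    then show "\<And>i. emeasure (distr \<mu>' borel code) {..real i} \<noteq> \<infinity>" by simp
  qed auto
  then have "\<mu>' = \<mu>" using measure_distr_code[OF sets_\<mu>] measure_distr_code[OF sets_\<mu>'] by metis
  then show ?thesis using em em' B by metis
qed

end

section \<open>The space of sigma-finite measures\<close>

lemma space_Minf: "\<eta> \<in> space (Minf X) \<longleftrightarrow> \<eta> \<in> sigma_finite_measures X \<and> emeasure \<eta> (space X) \<noteq> 0"
  by (simp add: Minf_def Let_def space_measure_of_conv)

lemma sets_Minf: "sets (Minf X) = sigma_sets (space (Minf X))
    {{\<nu> \<in> space (Minf X). ereal \<alpha> < enn2ereal (emeasure \<nu> A) \<and> enn2ereal (emeasure \<nu> A) < ereal \<beta>}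
       | \<alpha> \<beta> A. A \<in> sets X}"
proof -
  have sp: "space (Minf X) = {\<nu> \<in> sigma_finite_measures X. emeasure \<nu> (space X) \<noteq> 0}"
    using space_Minf by blast
  show ?thesis unfolding sp unfolding Minf_def Let_def by (subst sets_measure_of) auto
qed

lemma sets_of_Minf: "\<eta> \<in> space (Minf X) \<Longrightarrow> sets \<eta> = sets X"
  by (simp add: space_Minf sigma_finite_measures_def)

lemma space_of_Minf: "\<eta> \<in> space (Minf X) \<Longrightarrow> space \<eta> = space X"
  using sets_of_Minf by (rule sets_eq_imp_space_eq)

lemma sigma_finite_of_Minf: "\<eta> \<in> space (Minf X) \<Longrightarrow> sigma_finite_measure \<eta>"
  by (simp add: space_Minf sigma_finite_measures_def)

lemma measurable_emeasure_Minf [measurable]: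
  assumes A: "A \<in> sets X"
  shows "(\<lambda>\<eta>. emeasure \<eta> A) \<in> borel_measurable (Minf X)"
proof (rule borel_measurableI_less)
  have less: "{\<eta> \<in> space (Minf X). emeasure \<eta> A < ennreal r} \<in> sets (Minf X)" for r
  proof (cases "r \<ge> 0")
    case True
    \<comment> \<open>The generators carry two strict bounds. The lower bound -1 is vacuous, whereas
      0 would lose the measures that vanish on \<open>A\<close>.\<close>
    have "{\<eta> \<in> space (Minf X). emeasure \<eta> A < ennreal r} =
        {\<eta> \<in> space (Minf X). ereal (- 1) < enn2ereal (emeasure \<eta> A) \<and> enn2ereal (emeasure \<eta> A) < ereal r}"
      using True by (auto simp: less_ennreal.rep_eq intro: less_le_trans[of "ereal (-1)" 0])
    then show ?thesis unfolding sets_Minf using A by (intro sigma_sets.Basic) blast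
  qed (simp add: ennreal_neg)
  fix y :: ennreal
  show "{\<eta> \<in> space (Minf X). emeasure \<eta> A < y} \<in> sets (Minf X)"
  proof (cases y)
    case (real r)
    then show ?thesis using less by simp
  next
    case top
    have "{\<eta> \<in> space (Minf X). emeasure \<eta> A < y} = (\<Union>n::nat. {\<eta> \<in> space (Minf X). emeasure \<eta> A < ennreal (real n)})"
      using top by (auto simp: ennreal_of_nat_eq_real_of_nat[symmetric] ennreal_Ex_less_of_nat order_less_trans[OF _ of_nat_less_top])
    then show ?thesis using less by auto
  qed
qed

lemma measurable_MinfI:
  assumes "\<And>x. x \<in> space M \<Longrightarrow> \<kappa> x \<in> space (Minf X)"
    and m: "\<And>A. A \<in> sets X \<Longrightarrow> (\<lambda>x. emeasure (\<kappa> x) A) \<in> borel_measurable M"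
  shows "\<kappa> \<in> M \<rightarrow>\<^sub>M Minf X"
proof (rule measurable_sigma_sets[OF sets_Minf])
  fix Y assume "Y \<in> {{\<nu> \<in> space (Minf X). ereal \<alpha> < enn2ereal (emeasure \<nu> A) \<and> enn2ereal (emeasure \<nu> A) < ereal \<beta>}
       | \<alpha> \<beta> A. A \<in> sets X}"
  then obtain \<alpha> \<beta> A where A: "A \<in> sets X" and
    Y: "Y = {\<nu> \<in> space (Minf X). ereal \<alpha> < enn2ereal (emeasure \<nu> A) \<and> enn2ereal (emeasure \<nu> A) < ereal \<beta>}" by blast
  note [measurable] = m[OF A]
  have "\<kappa> -` Y \<inter> space M = {x \<in> space M. ereal \<alpha> < enn2ereal (emeasure (\<kappa> x) A) \<and> enn2ereal (emeasure (\<kappa> x) A) < ereal \<beta>}"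
    using assms(1) by (auto simp: Y)
  also have "\<dots> \<in> sets M" by measurable
  finally show "\<kappa> -` Y \<inter> space M \<in> sets M" .
qed (use assms(1) in auto)

text \<open>With the identity as a kernel, sending \<eta> to the \<eta>-integral of a fixed
  nonnegative function is a measurable map on \<open>Minf X\<close>. The Borel descriptions of sets
  of measures below rely on this.\<close>

interpretation Minf_kernel: measure_kernel "Minf X" X "\<lambda>\<eta>. \<eta>" for X
  by unfold_locales (auto simp: sets_of_Minf)

lemma scale_in_Minf:
  assumes "\<eta> \<in> space (Minf X)" "0 < c"
  shows "scale_measure (ennreal c) \<eta> \<in> space (Minf X)"
proof -
  have "sigma_finite_measure (density \<eta> (\<lambda>_. ennreal c))"
    using sigma_finite_of_Minf[OF assms(1)]
    by (subst sigma_finite_measure.sigma_finite_iff_density_finite) auto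
  moreover have "density \<eta> (\<lambda>_. ennreal c) = scale_measure (ennreal c) \<eta>"
    by (rule measure_eqI) (simp_all add: emeasure_density nn_integral_cmult_indicator)
  ultimately show ?thesis using assms by (simp add: space_Minf sigma_finite_measures_def)
qed

text \<open>The second moment equals the square of the mean, so the variance is zero. The moments
  are stated as extended integrals, the form in which they appear in
  \<open>normalized_ergodic\<close>.\<close>

lemma prob_AE_const:
  fixes u :: "'a \<Rightarrow> real"
  assumes P: "prob_space P" and u[measurable]: "u \<in> borel_measurable P"
    and bounds: "\<And>x. 0 \<le> u x" "\<And>x. u x \<le> 1" and c: "0 \<le> c"
    and 1: "(\<integral>\<^sup>+x. ennreal (u x) \<partial>P) = ennreal c" and 2: "(\<integral>\<^sup>+x. (ennreal (u x))\<^sup>2 \<partial>P) = (ennreal c)\<^sup>2"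
  shows "AE x in P. u x = c"
proof -
  interpret prob_space P by (rule P)
  have i1: "integrable P u" using bounds by (intro integrable_const_bound[of _ 1]) auto
  have i2: "integrable P (\<lambda>x. (u x)\<^sup>2)"
    using bounds by (intro integrable_const_bound[of _ 1]) (auto simp: power_le_one)
  have e1: "(\<integral>x. u x \<partial>P) = c"
    using 1 bounds c by (subst integral_eq_nn_integral) auto
  have e2: "(\<integral>x. (u x)\<^sup>2 \<partial>P) = c\<^sup>2"
    using 2 bounds c by (subst integral_eq_nn_integral) (auto simp: ennreal_power)
  have eq: "(u x - c)\<^sup>2 = (u x)\<^sup>2 - 2 * c * u x + c\<^sup>2" for x
    by (simp add: power2_eq_square algebra_simps)
  have "(\<integral>x. (u x - c)\<^sup>2 \<partial>P) = (\<integral>x. (u x)\<^sup>2 - 2 * c * u x + c\<^sup>2 \<partial>P)" by (simp only: eq)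
  also have "\<dots> = c\<^sup>2 - 2 * c * c + c\<^sup>2"
    using i1 i2 by (simp add: e1 e2 prob_space)
  finally have "(\<integral>x. (u x - c)\<^sup>2 \<partial>P) = 0" by (simp add: power2_eq_square)
  moreover have "integrable P (\<lambda>x. (u x - c)\<^sup>2)" unfolding eq using i1 i2 by simp
  ultimately have "AE x in P. (u x - c)\<^sup>2 = 0"
    by (subst (asm) integral_nonneg_eq_0_iff_AE) auto
  then show ?thesis by eventually_elim simp
qed

section \<open>Ergodic components\<close>

context weighted_action
begin

lemma measurable_limit_kernel_X [measurable]:
  assumes "A \<in> sets X" shows "(\<lambda>x. emeasure (limit_kernel x) A) \<in> borel_measurable X"
  using limit_kernel.measurable_kernel[OF assms] by (rule measurable_invariant_setsD)

sublocale limit_kernel_X: measure_kernel X X limit_kernel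
  by unfold_locales (simp_all add: measurable_limit_kernel_X)

text \<open>The identity for sets says that the kernel fixes the restriction of
  \<open>f \<nu>\<close> to each invariant set. In this form it passes from sets to nonnegative
  functions.\<close>

lemma mixture_limit_kernel:
  assumes \<nu>: "integrable_invariant \<nu>" and J: "J \<in> sets invariant_sets"
  shows "mixture (density (weighted \<nu>) (indicator J)) X limit_kernel = density (weighted \<nu>) (indicator J)"
proof (rule measure_eqI)
  note sets_\<nu>[measurable_cong] = sets_inv[OF \<nu>]
  have [measurable]: "J \<in> sets X" using J by (rule invariant_sets_subset)
  show "sets (mixture (density (weighted \<nu>) (indicator J)) X limit_kernel) = sets (density (weighted \<nu>) (indicator J))"
    by (simp add: sets_\<nu>)
  have ind[measurable]: "indicator J \<in> borel_measurable \<nu>" by (simp add: measurable_cong_sets[OF sets_\<nu> refl])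
  fix A assume "A \<in> sets (mixture (density (weighted \<nu>) (indicator J)) X limit_kernel)"
  then have A: "A \<in> sets X" by simp
  have "emeasure (mixture (density (weighted \<nu>) (indicator J)) X limit_kernel) A =
      (\<integral>\<^sup>+x. emeasure (limit_kernel x) A \<partial>density (weighted \<nu>) (indicator J))"
    by (rule limit_kernel_X.emeasure_mixture) (simp_all add: sets_\<nu> A)
  also have "\<dots> = (\<integral>\<^sup>+x. indicator J x * emeasure (limit_kernel x) A \<partial>weighted \<nu>)"
    using measurable_limit_kernel_X[OF A] ind
    by (intro nn_integral_density) (simp_all add: measurable_cong_sets[OF sets_\<nu> refl])
  also have "\<dots> = emeasure (weighted \<nu>) (J \<inter> A)" by (rule limit_kernel_conditional_set[OF \<nu> J A])
  also have "\<dots> = emeasure (density (weighted \<nu>) (indicator J)) A"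
    using A ind by (subst emeasure_density) (simp_all add: sets_\<nu> indicator_inter_arith[symmetric])
  finally show "emeasure (mixture (density (weighted \<nu>) (indicator J)) X limit_kernel) A =
      emeasure (density (weighted \<nu>) (indicator J)) A" .
qed

lemma limit_kernel_conditional:
  assumes \<nu>: "integrable_invariant \<nu>" and J: "J \<in> sets invariant_sets" and h: "h \<in> borel_measurable X"
  shows "(\<integral>\<^sup>+x. indicator J x * (\<integral>\<^sup>+y. h y \<partial>limit_kernel x) \<partial>weighted \<nu>) = (\<integral>\<^sup>+x. indicator J x * h x \<partial>weighted \<nu>)"
proof -
  note sets_\<nu>[measurable_cong] = sets_inv[OF \<nu>]
  have [measurable]: "J \<in> sets X" using J by (rule invariant_sets_subset)
  have ind[measurable]: "indicator J \<in> borel_measurable \<nu>" by (simp add: measurable_cong_sets[OF sets_\<nu> refl])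
  have d: "(\<integral>\<^sup>+x. w x \<partial>density (weighted \<nu>) (indicator J)) = (\<integral>\<^sup>+x. indicator J x * w x \<partial>weighted \<nu>)"
    if "w \<in> borel_measurable X" for w
    using that ind by (intro nn_integral_density) (simp_all add: measurable_cong_sets[OF sets_\<nu> refl])
  have "(\<integral>\<^sup>+x. \<integral>\<^sup>+y. h y \<partial>limit_kernel x \<partial>density (weighted \<nu>) (indicator J)) =
      (\<integral>\<^sup>+y. h y \<partial>mixture (density (weighted \<nu>) (indicator J)) X limit_kernel)"
    by (rule limit_kernel_X.nn_integral_mixture[symmetric, OF h]) (simp add: sets_\<nu>)
  then show ?thesis
    unfolding mixture_limit_kernel[OF \<nu> J] by (simp add: d h limit_kernel_X.measurable_nn_integral_kernel)
qed

text \<open>Restricted to the invariant sets, \<open>u\<close> and \<open>v\<close> are densities of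
  the same measure. The restriction is taken of \<open>f \<nu>\<close>, which is finite; that of
  \<nu> itself might not be sigma-finite, and densities would not be unique.\<close>

lemma AE_eq_if_invariant:
  fixes u v :: "'x \<Rightarrow> ennreal"
  assumes \<nu>: "integrable_invariant \<nu>"
    and u[measurable]: "u \<in> borel_measurable invariant_sets" and v[measurable]: "v \<in> borel_measurable invariant_sets"
    and eq: "\<And>J. J \<in> sets invariant_sets \<Longrightarrow>
      (\<integral>\<^sup>+x. indicator J x * u x \<partial>weighted \<nu>) = (\<integral>\<^sup>+x. indicator J x * v x \<partial>weighted \<nu>)"
  shows "AE x in \<nu>. u x = v x"
proof -
  have sub: "subalgebra (weighted \<nu>) invariant_sets"
    using invariant_sets_subset by (auto simp: subalgebra_def space_inv[OF \<nu>] sets_inv[OF \<nu>])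
  define M where "M = restr_to_subalg (weighted \<nu>) invariant_sets"
  have sets_M[measurable_cong]: "sets M = sets invariant_sets" by (simp add: M_def sets_restr_to_subalg[OF sub])
  interpret P: finite_measure "weighted \<nu>" by (rule finite_measure_weighted[OF \<nu>])
  interpret M: finite_measure M
    unfolding M_def by (rule finite_measure_restr_to_subalg[OF sub]) (rule P.finite_measure_axioms)
  have "density M u = density M v"
  proof (rule measure_eqI)
    fix J assume "J \<in> sets (density M u)"
    then have J[measurable]: "J \<in> sets invariant_sets" by (simp add: sets_M)
    have *: "emeasure (density M w) J = (\<integral>\<^sup>+x. indicator J x * w x \<partial>weighted \<nu>)"
      if [measurable]: "w \<in> borel_measurable invariant_sets" for w
    proof -
      have "emeasure (density M w) J = (\<integral>\<^sup>+x. w x * indicator J x \<partial>M)"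
        by (rule emeasure_density) (simp_all add: J sets_M measurable_cong_sets[OF sets_M refl])
      also have "\<dots> = (\<integral>\<^sup>+x. w x * indicator J x \<partial>weighted \<nu>)"
        unfolding M_def by (rule nn_integral_subalgebra2[OF sub]) measurable
      finally show ?thesis by (simp add: mult.commute)
    qed
    show "emeasure (density M u) J = emeasure (density M v) J" using eq[OF J] by (simp add: *)
  qed simp
  then have "AE x in M. u x = v x" by (intro M.density_unique) (simp_all add: measurable_cong_sets[OF sets_M refl])
  then have "AE x in weighted \<nu>. u x = v x" unfolding M_def by (rule AE_restr_to_subalg[OF sub])
  then show ?thesis using AE_weighted[OF \<nu>] by blast
qed

section \<open>Passage between \<eta> and \<open>f \<eta>\<close>\<close>

definition unweighted :: "'x measure \<Rightarrow> 'x measure" where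
  "unweighted P = density P (\<lambda>x. ennreal (1 / f x))"

lemma nn_integral_weighted:
  assumes "sets \<eta> = sets X" "h \<in> borel_measurable X"
  shows "(\<integral>\<^sup>+x. h x \<partial>weighted \<eta>) = (\<integral>\<^sup>+x. fe x * h x \<partial>\<eta>)"
  using assms(2) by (intro nn_integral_density) (simp_all add: measurable_cong_sets[OF assms(1) refl])

lemma nn_integral_unweighted:
  assumes "sets P = sets X" "h \<in> borel_measurable X"
  shows "(\<integral>\<^sup>+x. h x \<partial>unweighted P) = (\<integral>\<^sup>+x. ennreal (1 / f x) * h x \<partial>P)"
  unfolding unweighted_def
  using assms(2) by (intro nn_integral_density) (simp_all add: measurable_cong_sets[OF assms(1) refl])

lemma fe_mult_inverse: "x \<in> space X \<Longrightarrow> fe x * ennreal (1 / f x) = 1"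
  using f_pos[of x] by (simp flip: ennreal_mult)

lemma weighted_unweighted:
  assumes "sets P = sets X" shows "weighted (unweighted P) = P" "unweighted (weighted P) = P"
proof -
  have sp: "space P = space X" using assms by (rule sets_eq_imp_space_eq)
  have "density P (\<lambda>x. fe x * ennreal (1 / f x)) = density P (\<lambda>_. 1)"
    by (rule density_cong) (auto intro!: AE_I2 simp: measurable_cong_sets[OF assms refl] sp fe_mult_inverse)
  then show "weighted (unweighted P) = P" "unweighted (weighted P) = P"
    by (simp_all add: unweighted_def density_density_eq measurable_cong_sets[OF assms refl] density_1 mult.commute)
qed

lemma unweighted_in_Minf:
  assumes P: "prob_space P" and sets: "sets P = sets X"
  shows "unweighted P \<in> space (Minf X)"
proof -
  interpret prob_space P by (rule P)
  have sp: "space P = space X" using sets by (rule sets_eq_imp_space_eq)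
  have "sigma_finite_measure (unweighted P)"
    unfolding unweighted_def by (subst sigma_finite_iff_density_finite) (auto simp: measurable_cong_sets[OF sets refl])
  moreover have "emeasure (unweighted P) (space X) \<noteq> 0"
  proof
    assume "emeasure (unweighted P) (space X) = 0"
    then have "AE x in P. ennreal (1 / f x) * indicator (space X) x = 0"
      unfolding unweighted_def
      by (subst (asm) emeasure_density) (auto simp: measurable_cong_sets[OF sets refl] sets nn_integral_0_iff_AE)
    then have "AE x in P. False"
    proof (rule AE_mp, intro AE_I2 impI)
      fix x assume "x \<in> space P" "ennreal (1 / f x) * indicator (space X) x = 0"
      then show False using fe_mult_inverse[of x] by (auto simp: sp)
    qed
    then show False by simp
  qed
  ultimately show ?thesis by (simp add: space_Minf sigma_finite_measures_def unweighted_def sets)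
qed

text \<open>This is the map \<pi> announced at the beginning.\<close>

definition component :: "'x \<Rightarrow> 'x measure" where
  "component x = unweighted (limit_kernel x)"

lemma nn_integral_component:
  "h \<in> borel_measurable X \<Longrightarrow> (\<integral>\<^sup>+y. h y \<partial>component x) = (\<integral>\<^sup>+y. ennreal (1 / f y) * h y \<partial>limit_kernel x)"
  unfolding component_def by (rule nn_integral_unweighted) simp_all

lemma component_in_Minf: "component x \<in> space (Minf X)"
  unfolding component_def by (rule unweighted_in_Minf) (simp_all add: prob_space_limit_kernel)

lemma sets_component [simp, measurable_cong]: "sets (component x) = sets X"
  by (rule sets_of_Minf) (rule component_in_Minf)

lemma nn_integral_fe_component:
  assumes "h \<in> borel_measurable X"
  shows "(\<integral>\<^sup>+y. fe y * h y \<partial>component x) = (\<integral>\<^sup>+y. h y \<partial>limit_kernel x)"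
  using nn_integral_weighted[of "component x" h] assms
  by (simp add: component_def weighted_unweighted[OF sets_limit_kernel] del: sets_component)
    (simp add: component_def[symmetric])

lemma measurable_component_map: "component \<in> invariant_sets \<rightarrow>\<^sub>M Minf X"
proof (rule measurable_MinfI)
  fix A assume A[measurable]: "A \<in> sets X"
  have "(\<lambda>x. \<integral>\<^sup>+y. ennreal (1 / f y) * indicator A y \<partial>limit_kernel x) \<in> borel_measurable invariant_sets"
    by measurable
  moreover have "emeasure (component x) A = (\<integral>\<^sup>+y. ennreal (1 / f y) * indicator A y \<partial>limit_kernel x)" for x
    using nn_integral_component[of "indicator A" x] by simp
  ultimately show "(\<lambda>x. emeasure (component x) A) \<in> borel_measurable invariant_sets" by simp
qed (rule component_in_Minf)

lemma measurable_component_X [measurable]: "component \<in> X \<rightarrow>\<^sub>M Minf X"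
  using measurable_component_map by (rule measurable_invariant_setsD)

section \<open>A Borel description of the normalized ergodic measures\<close>

text \<open>
  A manifestly measurable description of the ergodic invariant measures \<open>\<eta>\<close> with \<open>\<integral> f d\<eta> = 1\<close>: that \<open>f \<eta>\<close>
  is a mixture of orbit kernels encodes invariance under \<open>K n\<close>, and that the limit kernel has
  variance zero encodes ergodicity.
\<close>

definition normalized_ergodic :: "'x measure set" where
  "normalized_ergodic = {\<eta> \<in> space (Minf X). (\<integral>\<^sup>+x. fe x \<partial>\<eta>) = 1 \<and>
     (\<forall>n j. (\<integral>\<^sup>+x. fe x * indicator (initial j) x \<partial>\<eta>) = (\<integral>\<^sup>+x. fe x * emeasure (orbit_kernel n x) (initial j) \<partial>\<eta>)) \<and>
     (\<forall>j. (\<integral>\<^sup>+x. fe x * (emeasure (limit_kernel x) (initial j))\<^sup>2 \<partial>\<eta>) = (\<integral>\<^sup>+x. fe x * indicator (initial j) x \<partial>\<eta>)\<^sup>2)}"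

lemma sets_normalized_ergodic [measurable]: "normalized_ergodic \<in> sets (Minf X)"
  unfolding normalized_ergodic_def by measurable

text \<open>Left invariance of Haar measure: the image of Haar measure on an orbit is itself
  \<open>K n\<close>-invariant. It is needed to recover invariance of a measure from its
  representation by orbit kernels.\<close>

lemma average_left_translate:
  assumes h[measurable]: "h \<in> borel_measurable X" and k: "k \<in> topspace (K n)" and x: "x \<in> space X"
  shows "average n (\<lambda>y. h (T k y)) x = average n h x"
proof -
  have [measurable]: "(\<lambda>g. k \<otimes> g) \<in> K_borel n \<rightarrow>\<^sub>M K_borel n"
  proof -
    interpret C: compact_metrizable_group "K_group n" "K n" by (rule K_group_compact_metrizable)
    show ?thesis
      using C.continuous_map_imp_measurable_borel_group[OF C.continuous_map_left_mult] k
      by (simp add: K_borel_eq)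
  qed
  have [measurable]: "(\<lambda>g. T g x) \<in> K_borel n \<rightarrow>\<^sub>M X"
    using x by (intro measurable_T_compose[of "\<lambda>g. g" _ n]) auto
  have "average n h x = (\<integral>\<^sup>+g. h (T g x) \<partial>distr (Haar n) (Haar n) (\<lambda>g. k \<otimes> g))"
    using left_invariant_Haar[OF k] by (simp add: average_def)
  also have "\<dots> = (\<integral>\<^sup>+g. h (T (k \<otimes> g) x) \<partial>Haar n)"
    by (subst nn_integral_distr) auto
  also have "\<dots> = average n (\<lambda>y. h (T k y)) x"
    unfolding average_def using k x by (intro nn_integral_cong) (simp add: T_mult K_in_carrier)
  finally show ?thesis ..
qed

context
  fixes \<eta> assumes \<eta>: "\<eta> \<in> space (Minf X)" and normalized: "(\<integral>\<^sup>+x. fe x \<partial>\<eta>) = 1"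
begin

lemma prob_space_weighted: "prob_space (weighted \<eta>)"
proof (rule prob_spaceI)
  have "emeasure (weighted \<eta>) (space (weighted \<eta>)) = (\<integral>\<^sup>+x. 1 \<partial>weighted \<eta>)" by simp
  also have "\<dots> = 1" using normalized nn_integral_weighted[OF sets_of_Minf[OF \<eta>], of "\<lambda>_. 1"] by simp
  finally show "emeasure (weighted \<eta>) (space (weighted \<eta>)) = 1" .
qed

lemma emeasure_weighted: "A \<in> sets X \<Longrightarrow> emeasure (weighted \<eta>) A = (\<integral>\<^sup>+x. fe x * indicator A x \<partial>\<eta>)"
  using nn_integral_weighted[OF sets_of_Minf[OF \<eta>], of "indicator A"] by (simp add: sets_of_Minf[OF \<eta>])

lemma integrable_invariant_if_normalized:
  "invariant_measure G X T \<eta> \<Longrightarrow> integrable_invariant \<eta>"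
  using \<eta> normalized by (simp add: integrable_invariant_def space_Minf)

text \<open>The hypothesis makes \<open>f \<eta>\<close> a mixture of orbit kernels, since
  probability measures agreeing on initial segments coincide. Dividing by \<open>f\<close> exhibits
  \<eta> as a mixture of multiples of Haar images on orbits, each invariant under
  \<open>K n\<close>. Letting \<open>n\<close> vary reaches all of the group.\<close>

lemma invariant_if_orbit_mixture:
  assumes mix: "\<And>n j. (\<integral>\<^sup>+x. fe x * indicator (initial j) x \<partial>\<eta>) =
      (\<integral>\<^sup>+x. fe x * emeasure (orbit_kernel n x) (initial j) \<partial>\<eta>)"
  shows "invariant_measure G X T \<eta>"
  unfolding invariant_measure_def
proof
  fix k assume "k \<in> carrier G"
  then obtain n where k: "k \<in> topspace (K n)" by (auto simp: carrier_eq)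
  note sets_\<eta> = sets_of_Minf[OF \<eta>]
  have sp: "space \<eta> = space X" by (rule space_of_Minf[OF \<eta>])
  let ?P = "weighted \<eta>"
  have sets_P: "sets ?P = sets X" by (simp add: sets_\<eta>)
  interpret P: prob_space ?P by (rule prob_space_weighted)
  have em: "emeasure (mixture ?P X (orbit_kernel n)) A = (\<integral>\<^sup>+x. fe x * emeasure (orbit_kernel n x) A \<partial>\<eta>)"
    if "A \<in> sets X" for A
    using that by (simp add: orbit_kernel.emeasure_mixture[OF sets_P] nn_integral_weighted[OF sets_\<eta>])
  have mixP: "mixture ?P X (orbit_kernel n) = ?P"
  proof (rule prob_measure_eqI)
    have "emeasure (mixture ?P X (orbit_kernel n)) (space X) = (\<integral>\<^sup>+x. fe x \<partial>\<eta>)"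
      unfolding em[OF sets.top]
      by (rule nn_integral_cong) (simp add: sp prob_space.emeasure_space_1[OF prob_space_orbit_kernel, simplified])
    then show "prob_space (mixture ?P X (orbit_kernel n))"
      by (intro prob_spaceI) (simp add: normalized)
    show "measure (mixture ?P X (orbit_kernel n)) (initial j) = measure ?P (initial j)" for j
      by (simp add: measure_def em emeasure_weighted mix[of j n])
  qed (simp_all add: P.prob_space_axioms sets_\<eta>)
  \<comment> \<open>The factor \<open>1 / f\<close> cancels the weight inside the orbit kernel and
    leaves the plain average of \<open>h\<close>, divided by the average of
    \<open>f\<close>.\<close>
  have int: "(\<integral>\<^sup>+x. h x \<partial>\<eta>) = (\<integral>\<^sup>+x. average n h x / average n fe x \<partial>?P)" if h: "h \<in> borel_measurable X" for h
  proof -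
    have "(\<integral>\<^sup>+x. h x \<partial>\<eta>) = (\<integral>\<^sup>+x. fe x * (ennreal (1 / f x) * h x) \<partial>\<eta>)"
      by (rule nn_integral_cong) (simp add: sp mult.assoc[symmetric] fe_mult_inverse)
    also have "\<dots> = (\<integral>\<^sup>+x. ennreal (1 / f x) * h x \<partial>mixture ?P X (orbit_kernel n))"
      using h by (subst nn_integral_weighted[OF sets_\<eta>, symmetric])
        (simp_all add: mixP)
    also have "\<dots> = (\<integral>\<^sup>+x. \<integral>\<^sup>+y. ennreal (1 / f y) * h y \<partial>orbit_kernel n x \<partial>?P)"
      using h by (intro orbit_kernel.nn_integral_mixture) (simp_all add: sets_\<eta>)
    also have "\<dots> = (\<integral>\<^sup>+x. average n h x / average n fe x \<partial>?P)"
    proof (rule nn_integral_cong)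
      fix x assume "x \<in> space ?P"
      then have x: "x \<in> space X" by (simp add: sp)
      have "average n (\<lambda>y. fe y * (ennreal (1 / f y) * h y)) x = average n h x"
        unfolding average_def
        by (rule nn_integral_cong) (simp add: mult.assoc[symmetric] fe_mult_inverse x K_in_carrier)
      then show "(\<integral>\<^sup>+y. ennreal (1 / f y) * h y \<partial>orbit_kernel n x) = average n h x / average n fe x"
        using h x by (simp add: nn_integral_orbit_kernel)
    qed
    finally show ?thesis .
  qed
  have Tk[measurable]: "T k \<in> X \<rightarrow>\<^sub>M X" by (rule measurable_T) (rule K_in_carrier[OF k])
  then have Tk': "T k \<in> \<eta> \<rightarrow>\<^sub>M X" by (simp add: measurable_cong_sets[OF sets_\<eta> refl])
  show "distr \<eta> X (T k) = \<eta>"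
  proof (rule measure_eqI)
    fix A assume "A \<in> sets (distr \<eta> X (T k))"
    then have A[measurable]: "A \<in> sets X" by simp
    have "emeasure (distr \<eta> X (T k)) A = (\<integral>\<^sup>+x. indicator A x \<partial>distr \<eta> X (T k))" using A by simp
    also have "\<dots> = (\<integral>\<^sup>+x. indicator A (T k x) \<partial>\<eta>)" using Tk' by (rule nn_integral_distr) simp
    also have "\<dots> = (\<integral>\<^sup>+x. average n (\<lambda>y. indicator A (T k y)) x / average n fe x \<partial>?P)"
      by (intro int) measurable
    also have "\<dots> = (\<integral>\<^sup>+x. average n (indicator A) x / average n fe x \<partial>?P)"
      using A k by (intro nn_integral_cong) (simp add: average_left_translate sp)
    also have "\<dots> = (\<integral>\<^sup>+x. indicator A x \<partial>\<eta>)" by (intro int[symmetric]) measurable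
    finally show "emeasure (distr \<eta> X (T k)) A = emeasure \<eta> A" using A by (simp add: sets_\<eta>)
  qed (simp add: sets_\<eta>)
qed

text \<open>For each initial segment the kernel value has mean equal to the mass of the segment
  under \<open>f \<eta>\<close>, and by hypothesis no variance. Countably many segments determine
  the measure.\<close>

lemma limit_kernel_eq_if_no_variance:
  assumes inv: "invariant_measure G X T \<eta>"
    and var: "\<And>j. (\<integral>\<^sup>+x. fe x * (emeasure (limit_kernel x) (initial j))\<^sup>2 \<partial>\<eta>) = (\<integral>\<^sup>+x. fe x * indicator (initial j) x \<partial>\<eta>)\<^sup>2"
  shows "AE x in \<eta>. limit_kernel x = weighted \<eta>"
proof -
  note sets_\<eta> = sets_of_Minf[OF \<eta>]
  let ?P = "weighted \<eta>"
  have ii: "integrable_invariant \<eta>" by (rule integrable_invariant_if_normalized[OF inv])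
  interpret P: prob_space ?P by (rule prob_space_weighted)
  interpret L: prob_space "limit_kernel x" for x by (rule prob_space_limit_kernel)
  have "AE x in ?P. measure (limit_kernel x) (initial j) = measure ?P (initial j)" for j
  proof (rule prob_AE_const[OF P.prob_space_axioms])
    show "(\<lambda>x. measure (limit_kernel x) (initial j)) \<in> borel_measurable ?P"
      unfolding measure_def using measurable_limit_kernel_X[OF sets_initial, of j]
      by (simp add: measurable_cong_sets[OF sets_\<eta> refl])
    have "(\<integral>\<^sup>+x. emeasure (limit_kernel x) (initial j) \<partial>?P) =
        (\<integral>\<^sup>+x. indicator (space X) x * emeasure (limit_kernel x) (initial j) \<partial>?P)"
      by (rule nn_integral_cong) (simp add: space_of_Minf[OF \<eta>])
    also have "\<dots> = emeasure ?P (space X \<inter> initial j)"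
      using sets.top[of invariant_sets] by (intro limit_kernel_conditional_set[OF ii]) simp_all
    also have "space X \<inter> initial j = initial j" using sets.sets_into_space[OF sets_initial] by blast
    finally show "(\<integral>\<^sup>+x. ennreal (measure (limit_kernel x) (initial j)) \<partial>?P) = ennreal (measure ?P (initial j))"
      by (simp add: L.emeasure_eq_measure P.emeasure_eq_measure)
    have "(\<integral>\<^sup>+x. (emeasure (limit_kernel x) (initial j))\<^sup>2 \<partial>?P) = (emeasure ?P (initial j))\<^sup>2"
      using var[of j] by (simp add: nn_integral_weighted[OF sets_\<eta>] emeasure_weighted)
    then show "(\<integral>\<^sup>+x. (ennreal (measure (limit_kernel x) (initial j)))\<^sup>2 \<partial>?P) = (ennreal (measure ?P (initial j)))\<^sup>2"
      by (simp add: L.emeasure_eq_measure P.emeasure_eq_measure)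
  qed (simp_all add: L.prob_le_1)
  then have "AE x in ?P. \<forall>j. measure (limit_kernel x) (initial j) = measure ?P (initial j)"
    by (simp add: AE_all_countable)
  then have "AE x in ?P. limit_kernel x = ?P"
  proof eventually_elim
    case (elim x)
    then show ?case
      by (intro prob_measure_eqI) (simp_all add: L.prob_space_axioms P.prob_space_axioms sets_\<eta>)
  qed
  then show ?thesis using AE_weighted[OF ii] by blast
qed

lemma invariant_set_iff:
  assumes "A \<in> sets X"
  shows "A \<in> sets invariant_sets \<longleftrightarrow> (\<forall>g\<in>carrier G. T g ` A = A)"
proof
  assume A: "A \<in> sets invariant_sets"
  show "\<forall>g\<in>carrier G. T g ` A = A"
  proof
    fix g assume g: "g \<in> carrier G"
    have AX: "A \<subseteq> space X" using sets.sets_into_space[OF assms] .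
    have iff: "T g x \<in> A \<longleftrightarrow> x \<in> A" if "g \<in> carrier G" "x \<in> space X" for g x
      using A that by (simp add: sets_invariant_sets)
    show "T g ` A = A"
    proof (intro equalityI subsetI)
      fix x assume x: "x \<in> A"
      then have "T (inv g) x \<in> A" using iff[of "inv g" x] g AX by auto
      moreover have "x = T g (T (inv g) x)" using T_inv(2)[OF g] x AX by auto
      ultimately show "x \<in> T g ` A" by blast
    qed (use iff g AX in auto)
  qed
next
  assume *: "\<forall>g\<in>carrier G. T g ` A = A"
  have "T g x \<in> A \<longleftrightarrow> x \<in> A" if g: "g \<in> carrier G" and x: "x \<in> space X" for g x
  proof
    assume "T g x \<in> A"
    then have "T (inv g) (T g x) \<in> A" using *[rule_format, of "inv g"] g by blast
    then show "x \<in> A" using T_inv(1)[OF g x] by simp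
  next
    assume "x \<in> A" then show "T g x \<in> A" using * g by blast
  qed
  then show "A \<in> sets invariant_sets" using assms by (simp add: sets_invariant_sets)
qed

lemma emeasure_weighted_eq_0:
  assumes "A \<in> sets X"
  shows "emeasure (weighted \<eta>) A = 0 \<longleftrightarrow> emeasure \<eta> A = 0"
proof -
  note sets_\<eta> = sets_of_Minf[OF \<eta>]
  have "emeasure (weighted \<eta>) A = 0 \<longleftrightarrow> (AE x in \<eta>. fe x * indicator A x = 0)"
    unfolding emeasure_weighted[OF assms]
    using assms by (intro nn_integral_0_iff_AE) (simp add: measurable_cong_sets[OF sets_\<eta> refl])
  also have "\<dots> \<longleftrightarrow> (AE x in \<eta>. x \<notin> A)"
    using fe_pos(2) by (intro AE_cong) (auto simp: space_of_Minf[OF \<eta>] split: split_indicator)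
  also have "\<dots> \<longleftrightarrow> emeasure \<eta> A = 0"
    using assms by (subst AE_iff_measurable[of A]) (auto simp: sets_\<eta> space_of_Minf[OF \<eta>] dest: sets.sets_into_space)
  finally show ?thesis .
qed

text \<open>For an invariant \<open>A\<close>, conditioning with \<open>A\<close> both as the
  invariant set and as the event shows that the mass of \<open>A\<close> under the probability
  \<open>f \<eta>\<close> equals its own square.\<close>

lemma ergodic_if_limit_kernel_eq:
  assumes inv: "invariant_measure G X T \<eta>" and ae: "AE x in \<eta>. limit_kernel x = weighted \<eta>"
  shows "ergodic_measure G X T \<eta>"
  unfolding ergodic_measure_def
proof (intro ballI impI)
  note sets_\<eta> = sets_of_Minf[OF \<eta>]
  let ?P = "weighted \<eta>"
  have ii: "integrable_invariant \<eta>" by (rule integrable_invariant_if_normalized[OF inv])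
  interpret P: prob_space ?P by (rule prob_space_weighted)
  fix A assume A: "A \<in> sets X" and "\<forall>g\<in>carrier G. T g ` A = A"
  then have J: "A \<in> sets invariant_sets" by (simp add: invariant_set_iff)
  have "emeasure ?P A = emeasure ?P (A \<inter> A)" by simp
  also have "\<dots> = (\<integral>\<^sup>+x. indicator A x * emeasure (limit_kernel x) A \<partial>?P)"
    by (rule limit_kernel_conditional_set[OF ii J A, symmetric])
  also have "\<dots> = (\<integral>\<^sup>+x. emeasure ?P A * indicator A x \<partial>?P)"
  proof (rule nn_integral_cong_AE)
    have "AE x in ?P. limit_kernel x = ?P" using ae AE_weighted[OF ii] by blast
    then show "AE x in ?P. indicator A x * emeasure (limit_kernel x) A = emeasure ?P A * indicator A x"
      by eventually_elim (simp add: mult.commute)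
  qed
  also have "\<dots> = emeasure ?P A * emeasure ?P A" using A by (simp add: nn_integral_cmult_indicator sets_\<eta>)
  finally have "measure ?P A * (1 - measure ?P A) = 0"
    by (simp add: P.emeasure_eq_measure algebra_simps flip: ennreal_mult)
  then have "measure ?P A = 0 \<or> measure ?P (space X - A) = 0"
    using P.prob_compl[of A] A by (auto simp: sets_\<eta> space_of_Minf[OF \<eta>])
  then have "emeasure ?P A = 0 \<or> emeasure ?P (space X - A) = 0" by (simp add: P.emeasure_eq_measure)
  then show "emeasure \<eta> A = 0 \<or> emeasure \<eta> (space X - A) = 0"
    using emeasure_weighted_eq_0 A by simp
qed

text \<open>The orbit equations are the conditional identity over the whole space. The variance
  vanishes because kernel values are invariant functions, and these are almost everywhere constant
  under an ergodic measure.\<close>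

lemma normalized_ergodic_if_ergodic:
  assumes inv: "invariant_measure G X T \<eta>" and erg: "ergodic_measure G X T \<eta>"
  shows "\<eta> \<in> normalized_ergodic"
proof -
  note sets_\<eta> = sets_of_Minf[OF \<eta>]
  let ?P = "weighted \<eta>"
  have ii: "integrable_invariant \<eta>" by (rule integrable_invariant_if_normalized[OF inv])
  have sp: "space \<eta> = space X" by (rule space_of_Minf[OF \<eta>])
  interpret P: prob_space ?P by (rule prob_space_weighted)
  interpret L: prob_space "limit_kernel x" for x by (rule prob_space_limit_kernel)
  have top: "space X \<in> sets invariant_sets" using sets.top[of invariant_sets] by simp
  have init: "space X \<inter> initial j = initial j" for j using sets.sets_into_space[OF sets_initial] by blast
  have "(\<integral>\<^sup>+x. fe x * indicator (initial j) x \<partial>\<eta>) = (\<integral>\<^sup>+x. fe x * emeasure (orbit_kernel n x) (initial j) \<partial>\<eta>)" for n j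
  proof -
    have "(\<integral>\<^sup>+x. fe x * emeasure (orbit_kernel n x) (initial j) \<partial>\<eta>) =
        (\<integral>\<^sup>+x. emeasure (orbit_kernel n x) (initial j) \<partial>?P)"
      by (simp add: nn_integral_weighted[OF sets_\<eta>])
    also have "\<dots> = (\<integral>\<^sup>+x. indicator (space X) x * emeasure (orbit_kernel n x) (initial j) \<partial>?P)"
      by (rule nn_integral_cong) (simp add: sp)
    also have "\<dots> = emeasure ?P (space X \<inter> initial j)"
      by (rule orbit_kernel_conditional_set[OF ii _ K_invariant_indicator[OF top]]) simp_all
    finally show ?thesis unfolding init by (simp add: emeasure_weighted)
  qed
  moreover have "(\<integral>\<^sup>+x. fe x * (emeasure (limit_kernel x) (initial j))\<^sup>2 \<partial>\<eta>) = (\<integral>\<^sup>+x. fe x * indicator (initial j) x \<partial>\<eta>)\<^sup>2" for j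
  proof -
    define u where "u x = measure (limit_kernel x) (initial j)" for x
    have u_inv: "u \<in> borel_measurable invariant_sets" unfolding u_def measure_def by measurable
    then have u_X: "u \<in> borel_measurable X" by (rule measurable_invariant_setsD)
    then have u_P: "u \<in> borel_measurable ?P" by (simp add: measurable_cong_sets[OF sets_\<eta> refl])
    have u01: "0 \<le> u x" "u x \<le> 1" for x by (simp_all add: u_def L.prob_le_1)
    have int: "integrable ?P u" using u01 u_P by (intro P.integrable_const_bound[of _ 1]) auto
    have triv: "(AE x in ?P. Q x) \<or> (AE x in ?P. \<not> Q x)" if J: "{x \<in> space invariant_sets. Q x} \<in> sets invariant_sets" for Q
    proof -
      define J where "J = {x \<in> space X. Q x}"
      have J: "J \<in> sets invariant_sets" using J by (simp add: J_def)
      then have JX: "J \<in> sets X" by (rule invariant_sets_subset)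
      have "emeasure \<eta> J = 0 \<or> emeasure \<eta> (space X - J) = 0"
        using erg J JX by (simp add: ergodic_measure_def invariant_set_iff)
      then have "J \<in> null_sets \<eta> \<or> space X - J \<in> null_sets \<eta>" using JX by (auto simp: null_sets_def sets_\<eta>)
      then have "(AE x in \<eta>. \<not> Q x) \<or> (AE x in \<eta>. Q x)"
        by (auto intro!: AE_I' simp: J_def sp)
      then show ?thesis using AE_weighted[OF ii] by blast
    qed
    note [measurable] = u_inv
    \<comment> \<open>A function cannot lie strictly below its mean almost everywhere, so the other
      alternative holds; the same argument from above forces equality with the mean.\<close>
    have "(AE x in ?P. u x < P.expectation u) \<or> (AE x in ?P. \<not> u x < P.expectation u)"
      by (rule triv) measurable
    then have "AE x in ?P. \<not> u x < P.expectation u"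
      using P.expectation_less[OF int, of "P.expectation u"] by blast
    moreover have "(AE x in ?P. P.expectation u < u x) \<or> (AE x in ?P. \<not> P.expectation u < u x)"
      by (rule triv) measurable
    then have "AE x in ?P. \<not> P.expectation u < u x"
      using P.expectation_greater[OF int, of "P.expectation u"] by blast
    ultimately have ae: "AE x in ?P. u x = P.expectation u" by eventually_elim auto
    define c where "c = ennreal (P.expectation u)"
    have aec: "AE x in ?P. emeasure (limit_kernel x) (initial j) = c"
      using ae by eventually_elim (simp add: c_def L.emeasure_eq_measure u_def)
    have "emeasure ?P (initial j) = (\<integral>\<^sup>+x. indicator (space X) x * emeasure (limit_kernel x) (initial j) \<partial>?P)"
      using limit_kernel_conditional_set[OF ii top sets_initial, of j] by (simp add: init)
    also have "\<dots> = (\<integral>\<^sup>+x. emeasure (limit_kernel x) (initial j) \<partial>?P)"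
      by (rule nn_integral_cong) (simp add: sp)
    also have "\<dots> = (\<integral>\<^sup>+x. c \<partial>?P)" using aec by (rule nn_integral_cong_AE)
    finally have "emeasure ?P (initial j) = c" using P.emeasure_space_1 by simp
    moreover have "(\<integral>\<^sup>+x. (emeasure (limit_kernel x) (initial j))\<^sup>2 \<partial>?P) = (\<integral>\<^sup>+x. c\<^sup>2 \<partial>?P)"
      using aec by (intro nn_integral_cong_AE) auto
    ultimately have "(\<integral>\<^sup>+x. (emeasure (limit_kernel x) (initial j))\<^sup>2 \<partial>?P) = (emeasure ?P (initial j))\<^sup>2"
      using P.emeasure_space_1 by simp
    then show ?thesis by (simp add: nn_integral_weighted[OF sets_\<eta>] emeasure_weighted)
  qed
  ultimately show ?thesis using \<eta> normalized by (simp add: normalized_ergodic_def)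
qed

end

theorem normalized_ergodic_iff:
  "\<eta> \<in> normalized_ergodic \<longleftrightarrow> \<eta> \<in> Minf_erg G X T \<and> (\<integral>\<^sup>+x. fe x \<partial>\<eta>) = 1"
proof
  assume "\<eta> \<in> normalized_ergodic"
  then have \<eta>: "\<eta> \<in> space (Minf X)" and n: "(\<integral>\<^sup>+x. fe x \<partial>\<eta>) = 1"
    and mix: "\<And>n j. (\<integral>\<^sup>+x. fe x * indicator (initial j) x \<partial>\<eta>) = (\<integral>\<^sup>+x. fe x * emeasure (orbit_kernel n x) (initial j) \<partial>\<eta>)"
    and var: "\<And>j. (\<integral>\<^sup>+x. fe x * (emeasure (limit_kernel x) (initial j))\<^sup>2 \<partial>\<eta>) = (\<integral>\<^sup>+x. fe x * indicator (initial j) x \<partial>\<eta>)\<^sup>2"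
    by (auto simp: normalized_ergodic_def)
  have inv: "invariant_measure G X T \<eta>" by (rule invariant_if_orbit_mixture[OF \<eta> n mix])
  have "ergodic_measure G X T \<eta>"
    by (rule ergodic_if_limit_kernel_eq[OF \<eta> n inv limit_kernel_eq_if_no_variance[OF \<eta> n inv var]])
  then show "\<eta> \<in> Minf_erg G X T \<and> (\<integral>\<^sup>+x. fe x \<partial>\<eta>) = 1" using \<eta> n inv by (simp add: Minf_erg_def)
qed (auto simp: Minf_erg_def normalized_ergodic_if_ergodic)

text \<open>A normalized ergodic measure can be read off from almost every one of its points.
  Uniqueness of decompositions comes down to this.\<close>

lemma component_eq_if_normalized_ergodic:
  assumes "\<eta> \<in> normalized_ergodic"
  shows "AE x in \<eta>. component x = \<eta>"
proof -
  have \<eta>: "\<eta> \<in> space (Minf X)" and n: "(\<integral>\<^sup>+x. fe x \<partial>\<eta>) = 1"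
    and var: "\<And>j. (\<integral>\<^sup>+x. fe x * (emeasure (limit_kernel x) (initial j))\<^sup>2 \<partial>\<eta>) = (\<integral>\<^sup>+x. fe x * indicator (initial j) x \<partial>\<eta>)\<^sup>2"
    using assms by (auto simp: normalized_ergodic_def)
  have inv: "invariant_measure G X T \<eta>"
    using normalized_ergodic_iff[of \<eta>] assms by (simp add: Minf_erg_def)
  show ?thesis
    using limit_kernel_eq_if_no_variance[OF \<eta> n inv var]
    by eventually_elim (simp add: component_def weighted_unweighted[OF sets_of_Minf[OF \<eta>]])
qed

text \<open>Each of the countably many defining equations, written for \<open>component x\<close>,
  compares two invariant functions of \<open>x\<close>. It therefore suffices to compare their
  integrals over invariant sets, where the conditional identities for the orbit kernels and the
  limit kernel apply.\<close>

theorem AE_component_normalized_ergodic: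
  assumes \<nu>: "integrable_invariant \<nu>"
  shows "AE x in \<nu>. component x \<in> normalized_ergodic"
proof -
  note meas_nn = limit_kernel.measurable_nn_integral_kernel
  have 1: "(\<integral>\<^sup>+y. fe y \<partial>component x) = 1" for x
    using nn_integral_fe_component[of "\<lambda>_. 1" x] prob_space.emeasure_space_1[OF prob_space_limit_kernel[of x]] by simp
  have "AE x in \<nu>. emeasure (limit_kernel x) (initial j) = (\<integral>\<^sup>+y. emeasure (orbit_kernel n y) (initial j) \<partial>limit_kernel x)" for n j
  proof (rule AE_eq_if_invariant[OF \<nu>])
    show "(\<lambda>x. \<integral>\<^sup>+y. emeasure (orbit_kernel n y) (initial j) \<partial>limit_kernel x) \<in> borel_measurable invariant_sets"
      by (rule meas_nn) measurable
    fix J assume J: "J \<in> sets invariant_sets"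
    show "(\<integral>\<^sup>+x. indicator J x * emeasure (limit_kernel x) (initial j) \<partial>weighted \<nu>) =
        (\<integral>\<^sup>+x. indicator J x * (\<integral>\<^sup>+y. emeasure (orbit_kernel n y) (initial j) \<partial>limit_kernel x) \<partial>weighted \<nu>)"
      using limit_kernel_conditional_set[OF \<nu> J sets_initial, of j]
        limit_kernel_conditional[OF \<nu> J orbit_kernel.measurable_kernel[OF sets_initial], of n j]
        orbit_kernel_conditional_set[OF \<nu> invariant_sets_subset[OF J] K_invariant_indicator[OF J] sets_initial, of n j]
      by simp
  qed measurable
  \<comment> \<open>The squared kernel value is already an invariant function, so conditioning does
    not change it; this is the zero-variance equation.\<close>
  moreover have "AE x in \<nu>. (\<integral>\<^sup>+y. (emeasure (limit_kernel y) (initial j))\<^sup>2 \<partial>limit_kernel x) = (emeasure (limit_kernel x) (initial j))\<^sup>2" for j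
  proof (rule AE_eq_if_invariant[OF \<nu>])
    show "(\<lambda>x. \<integral>\<^sup>+y. (emeasure (limit_kernel y) (initial j))\<^sup>2 \<partial>limit_kernel x) \<in> borel_measurable invariant_sets"
      by (rule meas_nn) measurable
    fix J assume J: "J \<in> sets invariant_sets"
    show "(\<integral>\<^sup>+x. indicator J x * (\<integral>\<^sup>+y. (emeasure (limit_kernel y) (initial j))\<^sup>2 \<partial>limit_kernel x) \<partial>weighted \<nu>) =
        (\<integral>\<^sup>+x. indicator J x * (emeasure (limit_kernel x) (initial j))\<^sup>2 \<partial>weighted \<nu>)"
      by (rule limit_kernel_conditional[OF \<nu> J]) measurable
  qed measurable
  ultimately have "AE x in \<nu>. \<forall>n j. emeasure (limit_kernel x) (initial j) = (\<integral>\<^sup>+y. emeasure (orbit_kernel n y) (initial j) \<partial>limit_kernel x)"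
    "AE x in \<nu>. \<forall>j. (\<integral>\<^sup>+y. (emeasure (limit_kernel y) (initial j))\<^sup>2 \<partial>limit_kernel x) = (emeasure (limit_kernel x) (initial j))\<^sup>2"
    by (simp_all add: AE_all_countable)
  then show ?thesis
  proof eventually_elim
    case (elim x)
    then show ?case
      by (simp add: normalized_ergodic_def component_in_Minf 1 nn_integral_fe_component)
  qed
qed

text \<open>Conditioning is applied to the indicator of \<open>A\<close> divided by
  \<open>f\<close>; the weight in \<open>f \<nu>\<close> cancels the division.\<close>

theorem emeasure_eq_component_integral:
  assumes \<nu>: "integrable_invariant \<nu>" and A[measurable]: "A \<in> sets X"
  shows "emeasure \<nu> A = (\<integral>\<^sup>+x. emeasure (component x) A \<partial>weighted \<nu>)"
proof -
  have sp: "space \<nu> = space X" by (rule space_inv[OF \<nu>])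
  have top: "space X \<in> sets invariant_sets" using sets.top[of invariant_sets] by simp
  have "(\<integral>\<^sup>+x. emeasure (component x) A \<partial>weighted \<nu>) =
      (\<integral>\<^sup>+x. indicator (space X) x * (\<integral>\<^sup>+y. ennreal (1 / f y) * indicator A y \<partial>limit_kernel x) \<partial>weighted \<nu>)"
  proof (rule nn_integral_cong)
    fix x assume "x \<in> space (weighted \<nu>)"
    then show "emeasure (component x) A = indicator (space X) x * (\<integral>\<^sup>+y. ennreal (1 / f y) * indicator A y \<partial>limit_kernel x)"
      using nn_integral_component[of "indicator A" x] by (simp add: sp)
  qed
  also have "\<dots> = (\<integral>\<^sup>+x. indicator (space X) x * (ennreal (1 / f x) * indicator A x) \<partial>weighted \<nu>)"
    by (rule limit_kernel_conditional[OF \<nu> top]) measurable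
  also have "\<dots> = (\<integral>\<^sup>+x. fe x * (indicator (space X) x * (ennreal (1 / f x) * indicator A x)) \<partial>\<nu>)"
    by (rule nn_integral_weighted[OF sets_inv[OF \<nu>]]) measurable
  also have "\<dots> = (\<integral>\<^sup>+x. indicator A x \<partial>\<nu>)"
    by (rule nn_integral_cong) (simp add: sp mult.assoc[symmetric] fe_mult_inverse)
  finally show ?thesis by (simp add: sets_inv[OF \<nu>])
qed

end

section \<open>Measurability of functions with Borel graph\<close>

text \<open>
  The projection of a Borel set along a fibre is only analytic; a full measure part of it is a
  countable union of compact sets, by inner regularity, and projections of compact sets are compact.
\<close>

lemma inner_regular_sequence:
  fixes M :: "'a::{second_countable_topology, complete_space} measure"
  assumes M: "sets M = sets borel" "finite_measure M" and B: "B \<in> sets borel"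
  obtains C :: "nat \<Rightarrow> 'a set" where "\<And>n. compact (C n)" "\<And>n. C n \<subseteq> B" "AE x in M. x \<in> B \<longrightarrow> x \<in> (\<Union>n. C n)"
proof -
  interpret finite_measure M by (rule M(2))
  let ?K = "{C. C \<subseteq> B \<and> compact C}"
  have "?K \<noteq> {}" by (auto intro: exI[of _ "{}"])
  then obtain g :: "nat \<Rightarrow> ennreal" where g: "range g \<subseteq> emeasure M ` ?K" "(SUP C\<in>?K. emeasure M C) = Sup (range g)"
    using ennreal_SUP_countable_SUP[of ?K "emeasure M"] by blast
  have "\<exists>C. \<forall>n. C n \<in> ?K \<and> g n = emeasure M (C n)" by (rule choice) (use g(1) in blast)
  then obtain C :: "nat \<Rightarrow> 'a set" where C: "\<And>n. C n \<in> ?K" "\<And>n. g n = emeasure M (C n)" by blast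
  have CM: "(\<Union>n. C n) \<in> sets M" using C(1) by (intro sets.countable_UN) (auto simp: M(1) intro: borel_compact)
  have "emeasure M B = (SUP C\<in>?K. emeasure M C)"
    by (rule inner_regular[OF M(1) _ B]) simp
  also have "\<dots> = (SUP n. emeasure M (C n))" unfolding g(2) C(2)[symmetric] ..
  also have "\<dots> \<le> emeasure M (\<Union>n. C n)"
    by (rule SUP_least, rule emeasure_mono[OF _ CM]) blast
  finally have le: "emeasure M B \<le> emeasure M (\<Union>n. C n)" .
  have "emeasure M (B - (\<Union>n. C n)) = emeasure M B - emeasure M (\<Union>n. C n)"
    using C(1) CM B by (intro emeasure_Diff) (auto simp: M(1))
  also have "\<dots> = 0" using le by (simp add: diff_eq_0_iff_ennreal less_top[symmetric])
  finally have "B - (\<Union>n. C n) \<in> null_sets M" using CM B by (auto simp: null_sets_def M(1))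
  then have "AE x in M. x \<notin> B - (\<Union>n. C n)" by (rule AE_not_in)
  then have "AE x in M. x \<in> B \<longrightarrow> x \<in> (\<Union>n. C n)" by eventually_elim auto
  then show ?thesis using C(1) by (intro that) auto
qed

text \<open>Cut \<Gamma> at the height of a rational. The lower and the upper part project to
  disjoint sets because \<Gamma> is a graph, and each projection contains a Borel set catching
  almost all points of its part. So \<open>A j\<close> decides almost surely whether
  \<open>snd p \<le> rational_enum j\<close>, and these decisions determine
  \<open>snd p\<close>.\<close>

lemma AE_graph_measurable:
  fixes M :: "('a::{second_countable_topology, complete_space} \<times> real) measure"
  assumes M: "sets M = sets borel" "finite_measure M"
    and \<Gamma>: "\<Gamma> \<in> sets borel" "AE p in M. p \<in> \<Gamma>"
    and graph: "\<And>z s t. (z, s) \<in> \<Gamma> \<Longrightarrow> (z, t) \<in> \<Gamma> \<Longrightarrow> s = t"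
  obtains \<phi> where "\<phi> \<in> borel_measurable borel" "AE (z, t) in M. t = \<phi> z"
proof -
  \<comment> \<open>The compact pieces of \<open>B\<close> project to compact sets, whose countable
    union serves as \<open>A\<close>.\<close>
  have half: "\<exists>A\<in>sets borel. A \<subseteq> fst ` B \<and> (AE p in M. p \<in> B \<longrightarrow> fst p \<in> A)" if B: "B \<in> sets borel" for B
  proof -
    obtain C where C: "\<And>n. compact (C n)" "\<And>n. C n \<subseteq> B" "AE p in M. p \<in> B \<longrightarrow> p \<in> (\<Union>n::nat. C n)"
      by (rule inner_regular_sequence[OF M B]) (rule that)
    have "compact (fst ` C n)" for n using C(1) by (intro compact_continuous_image continuous_intros)
    then have "(\<Union>n. fst ` C n) \<in> sets borel" by (intro sets.countable_UN) (auto intro: borel_compact)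
    moreover have "(\<Union>n. fst ` C n) \<subseteq> fst ` B" by (rule UN_least, rule image_mono, rule C(2))
    moreover have "AE p in M. p \<in> B \<longrightarrow> fst p \<in> (\<Union>n. fst ` C n)" using C(3) by eventually_elim auto
    ultimately show ?thesis by (intro bexI conjI)
  qed
  have lo: "\<Gamma> \<inter> {p. snd p \<le> rational_enum j} \<in> sets borel"
    and hi: "\<Gamma> \<inter> {p. rational_enum j < snd p} \<in> sets borel" for j
  proof -
    have "closed {p::'a \<times> real. snd p \<le> rational_enum j}" "open {p::'a \<times> real. rational_enum j < snd p}"
      by (intro closed_Collect_le open_Collect_less continuous_intros)+
    then show "\<Gamma> \<inter> {p. snd p \<le> rational_enum j} \<in> sets borel" "\<Gamma> \<inter> {p. rational_enum j < snd p} \<in> sets borel"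
      using \<Gamma>(1) by auto
  qed
  have "\<forall>j. \<exists>A. A \<in> sets borel \<and> A \<subseteq> fst ` (\<Gamma> \<inter> {p. snd p \<le> rational_enum j}) \<and>
      (AE p in M. p \<in> \<Gamma> \<inter> {p. snd p \<le> rational_enum j} \<longrightarrow> fst p \<in> A)"
    using half[OF lo] unfolding Bex_def by (rule allI)
  then have "\<exists>A. \<forall>j. A j \<in> sets borel \<and> A j \<subseteq> fst ` (\<Gamma> \<inter> {p. snd p \<le> rational_enum j}) \<and>
      (AE p in M. p \<in> \<Gamma> \<inter> {p. snd p \<le> rational_enum j} \<longrightarrow> fst p \<in> A j)"
    by (rule choice)
  then obtain A where A: "\<forall>j. A j \<in> sets borel \<and> A j \<subseteq> fst ` (\<Gamma> \<inter> {p. snd p \<le> rational_enum j}) \<and>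
      (AE p in M. p \<in> \<Gamma> \<inter> {p. snd p \<le> rational_enum j} \<longrightarrow> fst p \<in> A j)"
    by (rule exE)
  have "\<forall>j. \<exists>A. A \<in> sets borel \<and> A \<subseteq> fst ` (\<Gamma> \<inter> {p. rational_enum j < snd p}) \<and>
      (AE p in M. p \<in> \<Gamma> \<inter> {p. rational_enum j < snd p} \<longrightarrow> fst p \<in> A)"
    using half[OF hi] unfolding Bex_def by (rule allI)
  then have "\<exists>A'. \<forall>j. A' j \<in> sets borel \<and> A' j \<subseteq> fst ` (\<Gamma> \<inter> {p. rational_enum j < snd p}) \<and>
      (AE p in M. p \<in> \<Gamma> \<inter> {p. rational_enum j < snd p} \<longrightarrow> fst p \<in> A' j)"
    by (rule choice)
  then obtain A' where A': "\<forall>j. A' j \<in> sets borel \<and> A' j \<subseteq> fst ` (\<Gamma> \<inter> {p. rational_enum j < snd p}) \<and>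
      (AE p in M. p \<in> \<Gamma> \<inter> {p. rational_enum j < snd p} \<longrightarrow> fst p \<in> A' j)"
    by (rule exE)
  have disj: "z \<notin> A' j" if zA: "z \<in> A j" for z j
  proof
    assume zA': "z \<in> A' j"
    have "A j \<subseteq> fst ` (\<Gamma> \<inter> {p. snd p \<le> rational_enum j})"
      "A' j \<subseteq> fst ` (\<Gamma> \<inter> {p. rational_enum j < snd p})"
      using A A' by simp_all
    from subsetD[OF this(1) zA] subsetD[OF this(2) zA']
    have "\<exists>p\<in>\<Gamma>. snd p \<le> rational_enum j \<and> fst p = z"
      "\<exists>p\<in>\<Gamma>. rational_enum j < snd p \<and> fst p = z" by auto
    then obtain p p' where "p \<in> \<Gamma>" "snd p \<le> rational_enum j" "fst p = z"
      "p' \<in> \<Gamma>" "rational_enum j < snd p'" "fst p' = z"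
      by (elim bexE conjE) (rule that)
    then show False using graph[of z "snd p" "snd p'"] by (metis not_less prod.collapse)
  qed
  have "AE p in M. \<forall>j. (p \<in> \<Gamma> \<inter> {p. snd p \<le> rational_enum j} \<longrightarrow> fst p \<in> A j) \<and>
      (p \<in> \<Gamma> \<inter> {p. rational_enum j < snd p} \<longrightarrow> fst p \<in> A' j)"
    using A A' by (simp add: AE_all_countable)
  then have ae: "AE p in M. \<forall>j. fst p \<in> A j \<longleftrightarrow> snd p \<le> rational_enum j"
    using \<Gamma>(2)
  proof eventually_elim
    case (elim p)
    show ?case
    proof
      fix j show "fst p \<in> A j \<longleftrightarrow> snd p \<le> rational_enum j"
        using elim disj[of "fst p" j] by (cases "snd p \<le> rational_enum j") auto
    qed
  qed
  \<comment> \<open>The second coordinate is the infimum of the rationals above it. An infinite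
    infimum occurs only over a null set and becomes 0.\<close>
  define \<phi> where "\<phi> z = real_of_ereal (INF j. if z \<in> A j then ereal (rational_enum j) else \<infinity>)" for z
  have "\<phi> \<in> borel_measurable borel"
  proof -
    have [measurable]: "A j \<in> sets borel" for j using A by simp
    show ?thesis unfolding \<phi>_def by measurable
  qed
  moreover have "AE (z, t) in M. t = \<phi> z"
    using ae
  proof eventually_elim
    case (elim p)
    have "(INF j. if fst p \<in> A j then ereal (rational_enum j) else \<infinity>) = ereal (snd p)"
    proof (rule antisym)
      show "ereal (snd p) \<le> (INF j. if fst p \<in> A j then ereal (rational_enum j) else \<infinity>)"
        by (rule INF_greatest) (use elim in auto)
      show "(INF j. if fst p \<in> A j then ereal (rational_enum j) else \<infinity>) \<le> ereal (snd p)"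
      proof (rule ereal_le_epsilon2)
        fix e :: real assume "0 < e"
        then obtain j where j: "snd p < rational_enum j" "rational_enum j < snd p + e"
          using rational_enum_dense[of "snd p" "snd p + e"] by auto
        have "(INF j. if fst p \<in> A j then ereal (rational_enum j) else \<infinity>) \<le> (if fst p \<in> A j then ereal (rational_enum j) else \<infinity>)"
          by (rule INF_lower) simp
        also have "\<dots> \<le> ereal (snd p) + ereal e" using j elim by auto
        finally show "(INF j. if fst p \<in> A j then ereal (rational_enum j) else \<infinity>) \<le> ereal (snd p) + ereal e" .
      qed
    qed
    then show ?case by (simp add: \<phi>_def case_prod_unfold)
  qed
  ultimately show ?thesis by (rule that)
qed

section \<open>The normalized section of the projective space\<close>

lemma proj_eq_iff:
  assumes "\<eta> \<in> space (Minf X)" "\<eta>' \<in> space (Minf X)"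
  shows "proj X \<eta> = proj X \<eta>' \<longleftrightarrow> (\<exists>c>0. \<eta> = scale_measure (ennreal c) \<eta>')"
  using eq_equiv_class_iff[OF equiv_proj_rel assms] assms by (simp add: proj_def proj_rel_def)

lemma proj_in_space: "\<eta> \<in> space (Minf X) \<Longrightarrow> proj X \<eta> \<in> space (PMinf X)"
  using measurable_space[OF measurable_proj] .

lemma proj_cases:
  assumes "c \<in> space (PMinf X)"
  obtains \<eta> where "\<eta> \<in> space (Minf X)" "c = proj X \<eta>"
  using assms by (auto simp: space_PMinf quotient_def proj_def)

lemma measurable_PMinfI:
  assumes "(\<lambda>\<eta>. h (proj X \<eta>)) \<in> Minf X \<rightarrow>\<^sub>M N"
  shows "h \<in> PMinf X \<rightarrow>\<^sub>M N"
proof (rule measurableI)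
  fix c assume "c \<in> space (PMinf X)"
  then show "h c \<in> space N" using measurable_space[OF assms] by (auto elim: proj_cases)
next
  fix B assume "B \<in> sets N"
  then have "(\<lambda>\<eta>. h (proj X \<eta>)) -` B \<inter> space (Minf X) \<in> sets (Minf X)" by (rule measurable_sets[OF assms])
  moreover have "proj X -` (h -` B \<inter> space (PMinf X)) \<inter> space (Minf X) = (\<lambda>\<eta>. h (proj X \<eta>)) -` B \<inter> space (Minf X)"
    by (auto intro: proj_in_space)
  ultimately show "h -` B \<inter> space (PMinf X) \<in> sets (PMinf X)" by (simp add: sets_PMinf)
qed

context weighted_action
begin

definition total :: "'x measure \<Rightarrow> ennreal" where
  "total \<eta> = (\<integral>\<^sup>+x. fe x \<partial>\<eta>)"

lemma measurable_total [measurable]: "total \<in> borel_measurable (Minf X)"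
  unfolding total_def by measurable

lemma total_pos:
  assumes \<eta>: "\<eta> \<in> space (Minf X)"
  shows "total \<eta> \<noteq> 0"
proof
  assume "total \<eta> = 0"
  then have "AE x in \<eta>. fe x = 0"
    unfolding total_def
    by (subst (asm) nn_integral_0_iff_AE) (simp_all add: measurable_cong_sets[OF sets_of_Minf[OF \<eta>] refl])
  then have "AE x in \<eta>. x \<notin> space X" by eventually_elim (use fe_pos(2) in blast)
  then have "emeasure \<eta> (space X) = 0"
    using AE_iff_measurable[of "space X" \<eta> "\<lambda>x. x \<notin> space X"] by (simp add: sets_of_Minf[OF \<eta>] space_of_Minf[OF \<eta>])
  then show False using \<eta> by (simp add: space_Minf)
qed

lemma nn_integral_scale: "(\<integral>\<^sup>+x. h x \<partial>scale_measure r \<eta>) = r * (\<integral>\<^sup>+x. h x \<partial>\<eta>)" if "h \<in> borel_measurable \<eta>"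
  using that by (rule nn_integral_scale_measure)

lemma total_scale:
  assumes "\<eta> \<in> space (Minf X)" shows "total (scale_measure r \<eta>) = r * total \<eta>"
  unfolding total_def
  by (rule nn_integral_scale) (simp add: measurable_cong_sets[OF sets_of_Minf[OF assms] refl])

text \<open>On measures not integrating \<open>f\<close> the normalization is an arbitrary fixed measure.\<close>

definition normalize :: "'x measure \<Rightarrow> 'x measure" where
  "normalize \<eta> = (if total \<eta> < \<infinity> then scale_measure (inverse (total \<eta>)) \<eta> else component undefined)"

lemma inverse_total:
  assumes "\<eta> \<in> space (Minf X)" "total \<eta> < \<infinity>"
  obtains c where "c > 0" "inverse (total \<eta>) = ennreal c" "total \<eta> = ennreal (1 / c)"
proof -
  obtain t where t: "total \<eta> = ennreal t" "0 \<le> t" using assms(2) by (cases "total \<eta>") auto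
  then have "t > 0" using total_pos[OF assms(1)] by (cases "t = 0") auto
  then show ?thesis using t by (intro that[of "inverse t"]) (simp_all add: inverse_ennreal inverse_eq_divide)
qed

lemma normalize_in_Minf:
  assumes "\<eta> \<in> space (Minf X)" shows "normalize \<eta> \<in> space (Minf X)"
proof (cases "total \<eta> < \<infinity>")
  case True
  obtain c where "c > 0" "inverse (total \<eta>) = ennreal c" using inverse_total[OF assms True] by metis
  then show ?thesis using True scale_in_Minf[OF assms, of c] by (simp add: normalize_def)
qed (auto simp: normalize_def component_in_Minf)

lemma total_component: "total (component x) = 1"
  using nn_integral_fe_component[of "\<lambda>_. 1" x] prob_space.emeasure_space_1[OF prob_space_limit_kernel[of x]]
  by (simp add: total_def)

lemma total_normalize: "\<eta> \<in> space (Minf X) \<Longrightarrow> total (normalize \<eta>) = 1"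
  by (auto simp: normalize_def total_component total_scale elim!: inverse_total simp flip: ennreal_mult)

lemma measurable_normalize [measurable]: "normalize \<in> Minf X \<rightarrow>\<^sub>M Minf X"
proof (rule measurable_MinfI)
  fix A assume A[measurable]: "A \<in> sets X"
  have "(\<lambda>\<eta>. if total \<eta> < \<infinity> then inverse (total \<eta>) * emeasure \<eta> A else emeasure (component undefined) A) \<in> borel_measurable (Minf X)"
    by measurable
  moreover have "emeasure (normalize \<eta>) A =
      (if total \<eta> < \<infinity> then inverse (total \<eta>) * emeasure \<eta> A else emeasure (component undefined) A)" for \<eta>
    by (simp add: normalize_def)
  ultimately show "(\<lambda>\<eta>. emeasure (normalize \<eta>) A) \<in> borel_measurable (Minf X)" by simp
qed (rule normalize_in_Minf)

lemma scale_total_normalize: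
  assumes "\<eta> \<in> space (Minf X)" "total \<eta> < \<infinity>"
  shows "scale_measure (total \<eta>) (normalize \<eta>) = \<eta>"
proof -
  obtain c where "c > 0" "inverse (total \<eta>) = ennreal c" "total \<eta> = ennreal (1 / c)"
    using inverse_total[OF assms] by metis
  then have "total \<eta> * inverse (total \<eta>) = 1" by (simp flip: ennreal_mult)
  then show ?thesis using assms(2)
    by (intro measure_eqI) (simp_all add: normalize_def mult.assoc[symmetric])
qed

lemma proj_normalize:
  assumes "\<eta> \<in> space (Minf X)" "total \<eta> < \<infinity>"
  shows "proj X (normalize \<eta>) = proj X \<eta>"
proof -
  obtain c where "c > 0" "inverse (total \<eta>) = ennreal c" using inverse_total[OF assms] by metis
  then have "\<exists>c>0. normalize \<eta> = scale_measure (ennreal c) \<eta>" using assms(2) by (auto simp: normalize_def)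
  then show ?thesis using proj_eq_iff[OF normalize_in_Minf[OF assms(1)] assms(1)] by blast
qed

lemma normalize_scale:
  assumes \<eta>: "\<eta> \<in> space (Minf X)" and c: "0 < c"
  shows "normalize (scale_measure (ennreal c) \<eta>) = normalize \<eta>"
proof (cases "total \<eta> < \<infinity>")
  case True
  obtain d where d: "d > 0" "inverse (total \<eta>) = ennreal d" "total \<eta> = ennreal (1 / d)"
    using inverse_total[OF \<eta> True] by metis
  have t: "total (scale_measure (ennreal c) \<eta>) = ennreal (c / d)"
    using c d by (simp add: total_scale[OF \<eta>] flip: ennreal_mult)
  have "ennreal (d / c) * ennreal c = ennreal d" using c d by (simp flip: ennreal_mult)
  then have "scale_measure (ennreal (d / c)) (scale_measure (ennreal c) \<eta>) = scale_measure (ennreal d) \<eta>"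
    by (intro measure_eqI) (simp_all add: mult.assoc[symmetric])
  then show ?thesis using True c d by (simp add: normalize_def t inverse_ennreal inverse_eq_divide)
next
  case False
  then have "total \<eta> = \<infinity>" by (simp add: less_top[symmetric])
  then show ?thesis using c by (simp add: normalize_def total_scale[OF \<eta>] ennreal_mult_top)
qed

lemma normalize_normalized: "\<eta> \<in> space (Minf X) \<Longrightarrow> total \<eta> = 1 \<Longrightarrow> normalize \<eta> = \<eta>"
  by (simp add: normalize_def)

text \<open>The choice is harmless because \<open>normalize\<close> is constant on projective
  classes. For a class that does not integrate \<open>f\<close> the value is not a representative of
  that class.\<close>

definition proj_section :: "'x measure set \<Rightarrow> 'x measure" where
  "proj_section c = normalize (SOME \<eta>. \<eta> \<in> space (Minf X) \<and> proj X \<eta> = c)"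

lemma proj_section_proj:
  assumes "\<eta> \<in> space (Minf X)"
  shows "proj_section (proj X \<eta>) = normalize \<eta>"
proof -
  define \<eta>' where "\<eta>' = (SOME \<eta>'. \<eta>' \<in> space (Minf X) \<and> proj X \<eta>' = proj X \<eta>)"
  have "\<eta>' \<in> space (Minf X) \<and> proj X \<eta>' = proj X \<eta>"
    unfolding \<eta>'_def by (rule someI[of _ \<eta>]) (simp add: assms)
  then obtain c where "c > 0" "\<eta>' = scale_measure (ennreal c) \<eta>" using proj_eq_iff[of \<eta>' X \<eta>] assms by auto
  then show ?thesis using normalize_scale[OF assms] by (simp add: proj_section_def \<eta>'_def[symmetric])
qed

lemma measurable_proj_section [measurable]: "proj_section \<in> PMinf X \<rightarrow>\<^sub>M Minf X"
proof (rule measurable_PMinfI)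
  show "(\<lambda>\<eta>. proj_section (proj X \<eta>)) \<in> Minf X \<rightarrow>\<^sub>M Minf X"
    by (subst measurable_cong[OF proj_section_proj]) (assumption, measurable)
qed

text \<open>The ergodic classes that integrate \<open>f\<close>. Unlike \<open>PMinf_erg\<close>,
  this set depends on \<open>f\<close>; it is shown to be Borel and carries every projected
  decomposition.\<close>

definition projective_ergodic :: "'x measure set set" where
  "projective_ergodic = proj X ` normalized_ergodic"

lemma normalized_ergodicD:
  assumes "\<eta> \<in> normalized_ergodic"
  shows "\<eta> \<in> space (Minf X)" "total \<eta> = 1" "\<eta> \<in> Minf_erg G X T"
  using assms normalized_ergodic_iff[of \<eta>] by (auto simp: normalized_ergodic_def total_def)

text \<open>The right side involves only measurable maps and the Borel set
  \<open>normalized_ergodic\<close>, which is how \<open>projective_ergodic\<close> is seen to be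
  Borel.\<close>

lemma proj_in_projective_ergodic_iff:
  assumes \<eta>: "\<eta> \<in> space (Minf X)"
  shows "proj X \<eta> \<in> projective_ergodic \<longleftrightarrow> total \<eta> < \<infinity> \<and> normalize \<eta> \<in> normalized_ergodic"
proof
  assume "proj X \<eta> \<in> projective_ergodic"
  then obtain \<eta>' where \<eta>': "\<eta>' \<in> normalized_ergodic" "proj X \<eta> = proj X \<eta>'" by (auto simp: projective_ergodic_def)
  note d = normalized_ergodicD[OF \<eta>'(1)]
  obtain c where c: "c > 0" "\<eta> = scale_measure (ennreal c) \<eta>'" using \<eta>'(2) proj_eq_iff[OF \<eta> d(1)] by auto
  have "normalize \<eta> = \<eta>'" using c normalize_scale[OF d(1) c(1)] normalize_normalized[OF d(1,2)] by simp
  moreover have "total \<eta> = ennreal c" using c d by (simp add: total_scale)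
  ultimately show "total \<eta> < \<infinity> \<and> normalize \<eta> \<in> normalized_ergodic" using \<eta>' by simp
next
  assume *: "total \<eta> < \<infinity> \<and> normalize \<eta> \<in> normalized_ergodic"
  then have "proj X (normalize \<eta>) \<in> projective_ergodic" by (auto simp: projective_ergodic_def)
  then show "proj X \<eta> \<in> projective_ergodic" using * proj_normalize[OF \<eta>] by simp
qed

lemma sets_projective_ergodic [measurable]: "projective_ergodic \<in> sets (PMinf X)"
proof -
  have "projective_ergodic \<subseteq> space (PMinf X)"
    using normalized_ergodicD(1) by (auto simp: projective_ergodic_def intro: proj_in_space)
  moreover have "proj X -` projective_ergodic \<inter> space (Minf X) =
      {\<eta> \<in> space (Minf X). total \<eta> < \<infinity> \<and> normalize \<eta> \<in> normalized_ergodic}"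
    using proj_in_projective_ergodic_iff by blast
  moreover have "\<dots> \<in> sets (Minf X)" by measurable
  ultimately show ?thesis by (simp add: sets_PMinf)
qed

lemma projective_ergodic_subset: "projective_ergodic \<subseteq> PMinf_erg G X T"
  using normalized_ergodicD(3) by (auto simp: projective_ergodic_def PMinf_erg_def)

lemma proj_proj_section: "c \<in> projective_ergodic \<Longrightarrow> proj X (proj_section c) = c"
  using normalized_ergodicD by (auto simp: projective_ergodic_def proj_section_proj normalize_normalized)

end

section \<open>Decompositions\<close>

text \<open>Including the sets of infinite measure makes \<nu> a genuine mixture, so that the
  identity extends to integrals of all nonnegative functions.\<close>

definition represents :: "'x measure \<Rightarrow> 'x measure \<Rightarrow> 'x measure measure \<Rightarrow> bool" where
  "represents X \<nu> N \<longleftrightarrow> sets N = sets (Minf X) \<and> (\<forall>A\<in>sets X. emeasure \<nu> A = (\<integral>\<^sup>+\<eta>. emeasure \<eta> A \<partial>N))"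

lemma represents_nn_integral:
  assumes "represents X \<nu> N" "sets \<nu> = sets X" "h \<in> borel_measurable X"
  shows "(\<integral>\<^sup>+x. h x \<partial>\<nu>) = (\<integral>\<^sup>+\<eta>. \<integral>\<^sup>+x. h x \<partial>\<eta> \<partial>N)"
proof -
  have N: "sets N = sets (Minf X)" using assms(1) by (simp add: represents_def)
  have "\<nu> = mixture N X (\<lambda>\<eta>. \<eta>)"
    using assms(1,2) by (intro measure_eqI) (simp_all add: Minf_kernel.emeasure_mixture[OF N] represents_def)
  then show ?thesis using Minf_kernel.nn_integral_mixture[OF assms(3) N] by simp
qed

lemma distr_cong_AE':
  assumes "AE x in M. f x = g x" "f \<in> M \<rightarrow>\<^sub>M N" "g \<in> M \<rightarrow>\<^sub>M N"
  shows "distr M N f = distr M N g"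
  using assms by (intro distr_cong_AE) auto

context weighted_action
begin

text \<open>The space is exhausted by sets of finite measure, on which the hypothesis speaks;
  monotone convergence does the rest.\<close>

lemma represents_if_measure_integral:
  assumes \<nu>: "integrable_invariant \<nu>" and N: "N \<in> sigma_finite_measures (Minf X)"
    and int: "is_measure_integral X \<nu> N"
  shows "represents X \<nu> N"
  unfolding represents_def
proof (intro conjI ballI)
  show sets_N: "sets N = sets (Minf X)" using N by (simp add: sigma_finite_measures_def)
  have sets_\<nu>: "sets \<nu> = sets X" by (rule sets_inv[OF \<nu>])
  have sp: "space \<nu> = space X" by (rule space_inv[OF \<nu>])
  \<comment> \<open>These are the sets where \<open>f\<close> is at least
    \<open>1 / (k + 1)\<close>: finite measure by Markov's inequality, and exhausting because
    \<open>f\<close> is positive.\<close>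
  define S where "S k = {x \<in> space X. 1 \<le> real (Suc k) * f x}" for k
  have S[measurable]: "S k \<in> sets X" for k unfolding S_def by measurable
  have S_inc: "incseq S"
  proof (intro incseq_SucI subsetI)
    fix k x assume x: "x \<in> S k"
    then have "real (Suc k) * f x \<le> real (Suc (Suc k)) * f x"
      using f_pos[of x] by (intro mult_right_mono) (auto simp: S_def)
    then show "x \<in> S (Suc k)" using x by (simp add: S_def)
  qed
  have S_UN: "(\<Union>k. S k) = space X"
  proof
    show "space X \<subseteq> (\<Union>k. S k)"
    proof
      fix x assume x: "x \<in> space X"
      then obtain n where "1 < real n * f x" using reals_Archimedean3[OF f_pos[OF x]] by blast
      then have "1 \<le> real (Suc n) * f x" using f_pos[OF x] by (simp add: algebra_simps)
      then show "x \<in> (\<Union>k. S k)" using x by (auto simp: S_def)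
    qed
  qed (auto simp: S_def)
  have S_fin: "emeasure \<nu> (S k) < \<infinity>" for k
  proof -
    have "emeasure \<nu> (S k) = (\<integral>\<^sup>+x. indicator (S k) x \<partial>\<nu>)" by (simp add: sets_\<nu>)
    also have "\<dots> \<le> (\<integral>\<^sup>+x. ennreal (real (Suc k)) * fe x \<partial>\<nu>)"
    proof (rule nn_integral_mono)
      fix x assume "x \<in> space \<nu>"
      show "indicator (S k) x \<le> ennreal (real (Suc k)) * fe x"
      proof (cases "x \<in> S k")
        case True
        then have "ennreal 1 \<le> ennreal (real (Suc k) * f x)" by (intro ennreal_leI) (simp add: S_def)
        then show ?thesis using True by (simp add: ennreal_mult')
      qed simp
    qed
    also have "\<dots> = ennreal (real (Suc k)) * (\<integral>\<^sup>+x. fe x \<partial>\<nu>)"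
      by (rule nn_integral_cmult) (simp add: measurable_cong_sets[OF sets_\<nu> refl])
    also have "\<dots> < \<infinity>" using \<nu> by (simp add: integrable_invariant_def ennreal_mult_less_top)
    finally show ?thesis .
  qed
  fix A assume A[measurable]: "A \<in> sets X"
  have AS: "incseq (\<lambda>k. A \<inter> S k)" using S_inc by (auto simp: incseq_def)
  have A_UN: "(\<Union>k. A \<inter> S k) = A" using S_UN sets.sets_into_space[OF A] by blast
  have sup: "emeasure \<mu> A = (SUP k. emeasure \<mu> (A \<inter> S k))" if "sets \<mu> = sets X" for \<mu>
    using SUP_emeasure_incseq[of "\<lambda>k. A \<inter> S k" \<mu>] AS A_UN that by (simp add: image_subset_iff)
  have "emeasure \<nu> A = (SUP k. emeasure \<nu> (A \<inter> S k))" by (rule sup[OF sets_\<nu>])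
  also have "\<dots> = (SUP k. \<integral>\<^sup>+\<eta>. emeasure \<eta> (A \<inter> S k) \<partial>N)"
  proof (rule SUP_cong[OF refl])
    fix k
    have "emeasure \<nu> (A \<inter> S k) \<le> emeasure \<nu> (S k)" by (rule emeasure_mono) (auto simp: sets_\<nu>)
    then have "emeasure \<nu> (A \<inter> S k) < \<infinity>" using S_fin by (rule le_less_trans)
    moreover have "A \<inter> S k \<in> sets X" by simp
    ultimately show "emeasure \<nu> (A \<inter> S k) = (\<integral>\<^sup>+\<eta>. emeasure \<eta> (A \<inter> S k) \<partial>N)"
      using int unfolding is_measure_integral_def by blast
  qed
  also have "\<dots> = (\<integral>\<^sup>+\<eta>. (SUP k. emeasure \<eta> (A \<inter> S k)) \<partial>N)"
  proof (rule nn_integral_monotone_convergence_SUP_AE[symmetric])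
    show "AE \<eta> in N. emeasure \<eta> (A \<inter> S k) \<le> emeasure \<eta> (A \<inter> S (Suc k))" for k
    proof (rule AE_I2)
      fix \<eta> assume "\<eta> \<in> space N"
      then have "sets \<eta> = sets X" using sets_eq_imp_space_eq[OF sets_N] by (simp add: sets_of_Minf)
      then show "emeasure \<eta> (A \<inter> S k) \<le> emeasure \<eta> (A \<inter> S (Suc k))"
        using S_inc by (intro emeasure_mono) (auto simp: incseq_Suc_iff)
    qed
  qed (simp add: measurable_cong_sets[OF sets_N refl])
  also have "\<dots> = (\<integral>\<^sup>+\<eta>. emeasure \<eta> A \<partial>N)"
    by (rule nn_integral_cong) (simp add: sup sets_of_Minf sets_eq_imp_space_eq[OF sets_N])
  finally show "emeasure \<nu> A = (\<integral>\<^sup>+\<eta>. emeasure \<eta> A \<partial>N)" .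
qed

definition decomposition :: "'x measure \<Rightarrow> 'x measure measure" where
  "decomposition \<nu> = distr (weighted \<nu>) (Minf X) component"

definition projected :: "'x measure \<Rightarrow> 'x measure set measure" where
  "projected \<nu> = distr (decomposition \<nu>) (PMinf X) (proj X)"

lemma sets_decomposition [simp, measurable_cong]: "sets (decomposition \<nu>) = sets (Minf X)"
  by (simp add: decomposition_def)

lemma space_decomposition [simp]: "space (decomposition \<nu>) = space (Minf X)"
  by (rule sets_eq_imp_space_eq) simp

lemma sets_projected [simp, measurable_cong]: "sets (projected \<nu>) = sets (PMinf X)"
  by (simp add: projected_def)

lemma space_projected [simp]: "space (projected \<nu>) = space (PMinf X)"
  by (rule sets_eq_imp_space_eq) simp

lemma measurable_proj_sets:
  assumes "sets N = sets (Minf X)"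
  shows "proj X \<in> N \<rightarrow>\<^sub>M PMinf X"
  unfolding measurable_cong_sets[OF assms refl] by (rule measurable_proj)

context
  fixes \<nu> assumes \<nu>: "integrable_invariant \<nu>"
begin

lemma measurable_component_weighted: "component \<in> weighted \<nu> \<rightarrow>\<^sub>M Minf X"
  using measurable_component_X by (simp add: measurable_cong_sets[OF sets_inv[OF \<nu>] refl])

lemma finite_measure_decomposition: "finite_measure (decomposition \<nu>)"
  unfolding decomposition_def
  by (rule finite_measure.finite_measure_distr[OF finite_measure_weighted[OF \<nu>] measurable_component_weighted])

lemma finite_measure_projected: "finite_measure (projected \<nu>)"
  unfolding projected_def
  by (rule finite_measure.finite_measure_distr[OF finite_measure_decomposition measurable_proj_sets]) simp

lemma AE_decomposition: "AE \<eta> in decomposition \<nu>. \<eta> \<in> normalized_ergodic"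
proof -
  have "{\<eta> \<in> space (Minf X). \<eta> \<in> normalized_ergodic} \<in> sets (Minf X)" by measurable
  then show ?thesis
    unfolding decomposition_def
    using AE_component_normalized_ergodic[OF \<nu>]
    by (subst AE_distr_iff[OF measurable_component_weighted]) (simp_all add: AE_weighted[OF \<nu>])
qed

lemma represents_decomposition: "represents X \<nu> (decomposition \<nu>)"
  unfolding represents_def
proof (intro conjI ballI)
  fix A assume A: "A \<in> sets X"
  have "(\<integral>\<^sup>+\<eta>. emeasure \<eta> A \<partial>decomposition \<nu>) = (\<integral>\<^sup>+x. emeasure (component x) A \<partial>weighted \<nu>)"
    unfolding decomposition_def using A
    by (intro nn_integral_distr[OF measurable_component_weighted]) simp
  then show "emeasure \<nu> A = (\<integral>\<^sup>+\<eta>. emeasure \<eta> A \<partial>decomposition \<nu>)"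
    by (simp add: emeasure_eq_component_integral[OF \<nu> A])
qed simp

text \<open>A normalized ergodic \<eta> has \<eta>-almost everywhere component \<eta>, so
  \<open>h\<close> has \<eta>-integral 1 or 0 according to whether \<eta> lies in \<open>B\<close>.
  Hence the mass of \<open>B\<close> under \<open>N\<close> is the \<nu>-integral of
  \<open>h\<close>, which does not involve \<open>N\<close>.\<close>

lemma decomposition_unique:
  assumes N: "represents X \<nu> N" and erg: "AE \<eta> in N. \<eta> \<in> normalized_ergodic"
  shows "N = decomposition \<nu>"
proof (rule measure_eqI)
  have sets_N: "sets N = sets (Minf X)" using N by (simp add: represents_def)
  then show "sets N = sets (decomposition \<nu>)" by simp
  fix B assume "B \<in> sets N"
  then have B[measurable]: "B \<in> sets (Minf X)" by (simp add: sets_N)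
  have sets_\<nu>: "sets \<nu> = sets X" by (rule sets_inv[OF \<nu>])
  define h where "h x = fe x * indicator B (component x)" for x
  have h[measurable]: "h \<in> borel_measurable X" unfolding h_def by measurable
  have "emeasure (decomposition \<nu>) B = (\<integral>\<^sup>+\<eta>. indicator B \<eta> \<partial>decomposition \<nu>)" by simp
  also have "\<dots> = (\<integral>\<^sup>+x. indicator B (component x) \<partial>weighted \<nu>)"
    unfolding decomposition_def by (rule nn_integral_distr[OF measurable_component_weighted]) simp
  also have "\<dots> = (\<integral>\<^sup>+x. h x \<partial>\<nu>)"
    unfolding h_def by (rule nn_integral_weighted[OF sets_\<nu>]) measurable
  also have "\<dots> = (\<integral>\<^sup>+\<eta>. \<integral>\<^sup>+x. h x \<partial>\<eta> \<partial>N)" by (rule represents_nn_integral[OF N sets_\<nu> h])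
  also have "\<dots> = (\<integral>\<^sup>+\<eta>. indicator B \<eta> \<partial>N)"
    using erg
  proof (intro nn_integral_cong_AE, eventually_elim)
    fix \<eta> assume E: "\<eta> \<in> normalized_ergodic"
    note sets_\<eta> = sets_of_Minf[OF normalized_ergodicD(1)[OF E]]
    have "(\<integral>\<^sup>+x. h x \<partial>\<eta>) = (\<integral>\<^sup>+x. fe x * indicator B \<eta> \<partial>\<eta>)"
      using component_eq_if_normalized_ergodic[OF E]
      by (intro nn_integral_cong_AE, eventually_elim) (simp add: h_def)
    also have "\<dots> = total \<eta> * indicator B \<eta>"
      unfolding total_def by (rule nn_integral_multc) (simp add: measurable_cong_sets[OF sets_\<eta> refl])
    finally show "(\<integral>\<^sup>+x. h x \<partial>\<eta>) = indicator B \<eta>" by (simp add: normalized_ergodicD(2)[OF E])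
  qed
  also have "\<dots> = emeasure N B" by (simp add: sets_N)
  finally show "emeasure N B = emeasure (decomposition \<nu>) B" ..
qed

text \<open>Moving the scalar \<open>total \<eta>\<close> from the measure \<eta> into the mixing
  measure gives a decomposition of \<nu> into normalized ergodic measures, and there is only one.
  Normalizing does not move the projective point.\<close>

lemma projected_eq:
  assumes N: "represents X \<nu> N"
    and erg: "AE \<eta> in N. total \<eta> < \<infinity> \<and> normalize \<eta> \<in> normalized_ergodic"
  shows "distr (density N total) (PMinf X) (proj X) = projected \<nu>"
proof -
  have sets_N: "sets N = sets (Minf X)" using N by (simp add: represents_def)
  have space_N: "space N = space (Minf X)" using sets_N by (rule sets_eq_imp_space_eq)
  note cong = measurable_cong_sets[OF sets_N refl]
  have [measurable]: "total \<in> borel_measurable N" "normalize \<in> N \<rightarrow>\<^sub>M Minf X" by (simp_all add: cong)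
  have norm_density: "normalize \<in> density N total \<rightarrow>\<^sub>M Minf X" by simp
  define M where "M = distr (density N total) (Minf X) normalize"
  have MD: "M = decomposition \<nu>"
  proof (rule decomposition_unique)
    show "represents X \<nu> M"
      unfolding represents_def
    proof (intro conjI ballI)
      fix A assume A: "A \<in> sets X"
      have "(\<integral>\<^sup>+\<eta>. emeasure \<eta> A \<partial>M) = (\<integral>\<^sup>+\<eta>. emeasure (normalize \<eta>) A \<partial>density N total)"
        unfolding M_def using A by (intro nn_integral_distr[OF norm_density]) simp
      also have "\<dots> = (\<integral>\<^sup>+\<eta>. total \<eta> * emeasure (normalize \<eta>) A \<partial>N)"
        using A by (intro nn_integral_density) simp_all
      also have "\<dots> = (\<integral>\<^sup>+\<eta>. emeasure \<eta> A \<partial>N)"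
      proof (rule nn_integral_cong_AE)
        show "AE \<eta> in N. total \<eta> * emeasure (normalize \<eta>) A = emeasure \<eta> A"
          using erg AE_space
        proof eventually_elim
          case (elim \<eta>)
          then have "scale_measure (total \<eta>) (normalize \<eta>) = \<eta>" by (intro scale_total_normalize) (auto simp: space_N)
          then have "emeasure (scale_measure (total \<eta>) (normalize \<eta>)) A = emeasure \<eta> A" by simp
          then show ?case by simp
        qed
      qed
      finally show "emeasure \<nu> A = (\<integral>\<^sup>+\<eta>. emeasure \<eta> A \<partial>M)" using N A by (simp add: represents_def)
    qed (simp add: M_def)
    have "{\<eta> \<in> space (Minf X). \<eta> \<in> normalized_ergodic} \<in> sets (Minf X)" by measurable
    then have "(AE \<eta> in M. \<eta> \<in> normalized_ergodic) \<longleftrightarrow> (AE \<eta> in density N total. normalize \<eta> \<in> normalized_ergodic)"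
      unfolding M_def by (rule AE_distr_iff[OF norm_density])
    then show "AE \<eta> in M. \<eta> \<in> normalized_ergodic" using erg by (auto simp: AE_density)
  qed
  have "projected \<nu> = distr M (PMinf X) (proj X)" unfolding projected_def MD ..
  also have "\<dots> = distr (density N total) (PMinf X) (\<lambda>\<eta>. proj X (normalize \<eta>))"
    unfolding M_def by (subst distr_distr[OF measurable_proj norm_density]) (simp add: o_def)
  also have "\<dots> = distr (density N total) (PMinf X) (proj X)"
  proof (rule distr_cong_AE')
    have "AE \<eta> in N. proj X (normalize \<eta>) = proj X \<eta>"
      using erg AE_space by eventually_elim (auto simp: space_N proj_normalize)
    then show "AE \<eta> in density N total. proj X (normalize \<eta>) = proj X \<eta>"
      unfolding AE_density[OF \<open>total \<in> borel_measurable N\<close>] by eventually_elim simp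
    show "(\<lambda>\<eta>. proj X (normalize \<eta>)) \<in> density N total \<rightarrow>\<^sub>M PMinf X"
      by (rule measurable_compose[OF norm_density measurable_proj])
  qed (simp add: measurable_proj_sets[OF sets_N])
  finally show ?thesis ..
qed

end

lemma total_unweighted_reconstruct: "total (unweighted (reconstruct z)) = 1"
proof -
  have "total (unweighted (reconstruct z)) = (\<integral>\<^sup>+x. ennreal (1 / f x) * fe x \<partial>reconstruct z)"
    unfolding total_def by (rule nn_integral_unweighted) simp_all
  also have "\<dots> = (\<integral>\<^sup>+x. 1 \<partial>reconstruct z)"
    by (rule nn_integral_cong) (simp add: mult.commute fe_mult_inverse)
  finally show ?thesis using prob_space.emeasure_space_1[OF prob_space_reconstruct[of z]] by simp
qed

text \<open>Admissibility makes \<eta>, hence its total mass, a function of the projective point on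
  a set of full measure, but gives no measurability. In coordinates the pair of projective point and
  total lives in a Polish space, where the exceptional null set cuts out a Borel graph, and
  \<open>AE_graph_measurable\<close> supplies the function.\<close>

lemma total_AE_function_of_proj:
  assumes N: "N \<in> sigma_finite_measures (Minf X)" and adm: "admissible X N"
    and fin: "(\<integral>\<^sup>+\<eta>. total \<eta> \<partial>N) < \<infinity>"
  obtains \<phi> :: "'x measure set \<Rightarrow> real" where "\<phi> \<in> borel_measurable (PMinf X)" "\<And>c. 0 < \<phi> c"
    "AE \<eta> in N. total \<eta> = ennreal (\<phi> (proj X \<eta>))"
proof -
  have sets_N: "sets N = sets (Minf X)" using N by (simp add: sigma_finite_measures_def)
  have space_N: "space N = space (Minf X)" using sets_N by (rule sets_eq_imp_space_eq)
  note cong = measurable_cong_sets[OF sets_N refl]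
  obtain Z where Z: "Z \<in> null_sets N" "inj_on (proj X) (space (Minf X) - Z)"
    using adm by (auto simp: admissible_def)
  have Zs: "Z \<in> sets (Minf X)" using Z(1) sets_N by auto
  have tot[measurable]: "total \<in> borel_measurable N" by (simp add: cong)
  have AE_tot: "AE \<eta> in N. total \<eta> < \<infinity>"
    using nn_integral_PInf_AE[OF tot] fin by (auto simp: less_top[symmetric])
  \<comment> \<open>Coordinates of a projective point: the masses of the initial segments under
    \<open>f\<close> times its normalized representative.\<close>
  define \<zeta> where "\<zeta> c = (\<lambda>j. measure (weighted (proj_section c)) (initial j))" for c
  \<comment> \<open>The inverse of the coordinate map \<theta>. The factor 1 for nonpositive second
    coordinates keeps all values in \<open>Minf X\<close>.\<close>
  define W where "W p = scale_measure (ennreal (if snd p > 0 then snd p else 1)) (unweighted (reconstruct (fst p)))"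
    for p :: "(nat \<Rightarrow> real) \<times> real"
  define \<theta> where "\<theta> \<eta> = (\<zeta> (proj X \<eta>), enn2real (total \<eta>))" for \<eta>
  have W_Minf: "W p \<in> space (Minf X)" for p
    unfolding W_def
    by (intro scale_in_Minf unweighted_in_Minf) (auto simp: prob_space_reconstruct)
  have total_W: "total (W (z, t)) = ennreal t" if "t > 0" for z t
    using that unweighted_in_Minf[OF prob_space_reconstruct sets_reconstruct, of z]
    by (simp add: W_def total_scale total_unweighted_reconstruct)
  have [measurable]: "fst \<in> borel \<rightarrow>\<^sub>M (borel :: (nat \<Rightarrow> real) measure)" "snd \<in> borel \<rightarrow>\<^sub>M (borel :: real measure)"
    by (intro borel_measurable_continuous_onI continuous_intros)+
  interpret rec: measure_kernel borel X reconstruct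
  proof
    fix A assume "A \<in> sets X"
    then have "(\<lambda>P. emeasure P A) \<in> borel_measurable (subprob_algebra X)" by (rule measurable_emeasure_subprob_algebra)
    with measurable_prob_algebraD[OF measurable_reconstruct]
    show "(\<lambda>z. emeasure (reconstruct z) A) \<in> borel_measurable borel" by (rule measurable_compose)
  qed simp
  have W[measurable]: "W \<in> borel \<rightarrow>\<^sub>M Minf X"
  proof (rule measurable_MinfI)
    fix A assume A[measurable]: "A \<in> sets X"
    have "(\<lambda>z. \<integral>\<^sup>+x. ennreal (1 / f x) * indicator A x \<partial>reconstruct z) \<in> borel_measurable borel" by measurable
    then have [measurable]: "(\<lambda>p::(nat \<Rightarrow> real) \<times> real. \<integral>\<^sup>+x. ennreal (1 / f x) * indicator A x \<partial>reconstruct (fst p)) \<in> borel_measurable borel"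
      by (rule measurable_compose[rotated]) measurable
    have "emeasure (W p) A = ennreal (if snd p > 0 then snd p else 1) * (\<integral>\<^sup>+x. ennreal (1 / f x) * indicator A x \<partial>reconstruct (fst p))" for p
    proof -
      have "emeasure (unweighted (reconstruct (fst p))) A = (\<integral>\<^sup>+x. indicator A x \<partial>unweighted (reconstruct (fst p)))"
        by (simp add: unweighted_def)
      also have "\<dots> = (\<integral>\<^sup>+x. ennreal (1 / f x) * indicator A x \<partial>reconstruct (fst p))"
        by (rule nn_integral_unweighted) simp_all
      finally show ?thesis by (simp add: W_def)
    qed
    then show "(\<lambda>p. emeasure (W p) A) \<in> borel_measurable borel" by simp
  qed (rule W_Minf)
  have \<zeta>: "\<zeta> \<in> borel_measurable (PMinf X)"
  proof -
    have "(\<lambda>\<eta>. measure (weighted \<eta>) (initial j)) \<in> borel_measurable (Minf X)" for j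
    proof -
      have "(\<lambda>\<eta>. enn2real (\<integral>\<^sup>+x. fe x * indicator (initial j) x \<partial>\<eta>)) \<in> borel_measurable (Minf X)" by measurable
      moreover have "measure (weighted \<eta>) (initial j) = enn2real (\<integral>\<^sup>+x. fe x * indicator (initial j) x \<partial>\<eta>)"
        if "\<eta> \<in> space (Minf X)" for \<eta>
        using nn_integral_weighted[OF sets_of_Minf[OF that], of "indicator (initial j)"]
        by (simp add: measure_def sets_of_Minf[OF that])
      ultimately show ?thesis by (simp cong: measurable_cong)
    qed
    then show ?thesis
      unfolding \<zeta>_def by (intro measurable_coordinatewise_then_product measurable_compose[OF measurable_proj_section])
  qed
  have W_\<theta>: "W (\<theta> \<eta>) = \<eta>" "0 < enn2real (total \<eta>)" if \<eta>: "\<eta> \<in> space (Minf X)" "total \<eta> < \<infinity>" for \<eta>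
  proof -
    show pos: "0 < enn2real (total \<eta>)" using total_pos[OF \<eta>(1)] \<eta>(2) by (simp add: enn2real_positive_iff zero_less_iff_neq_zero)
    note n = normalize_in_Minf[OF \<eta>(1)]
    have "prob_space (weighted (normalize \<eta>))"
      using total_normalize[OF \<eta>(1)] by (intro prob_space_weighted[OF n]) (simp add: total_def)
    then have "reconstruct (\<zeta> (proj X \<eta>)) = weighted (normalize \<eta>)"
      unfolding \<zeta>_def proj_section_proj[OF \<eta>(1)] by (intro reconstruct_measure) (simp_all add: sets_of_Minf[OF n])
    then have "unweighted (reconstruct (\<zeta> (proj X \<eta>))) = normalize \<eta>"
      by (simp add: weighted_unweighted(2)[OF sets_of_Minf[OF n]])
    then show "W (\<theta> \<eta>) = \<eta>"
      using pos \<eta>(2) scale_total_normalize[OF \<eta>] by (simp add: W_def \<theta>_def)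
  qed
  \<comment> \<open>A preimage under \<open>W\<close> and not an image under \<theta>: the preimage
    of a Borel set is Borel, and injectivity of the projection off \<open>Z\<close> makes it a
    graph.\<close>
  define \<Gamma> where "\<Gamma> = {p. 0 < snd p \<and> W p \<in> space (Minf X) - Z}"
  have "\<Gamma> = (snd -` {0<..} \<inter> space borel) \<inter> (W -` (space (Minf X) - Z) \<inter> space borel)" by (auto simp: \<Gamma>_def)
  also have "\<dots> \<in> sets borel" using Zs by (intro sets.Int measurable_sets[of snd borel borel] measurable_sets[OF W]) auto
  finally have \<Gamma>: "\<Gamma> \<in> sets borel" .
  have graph: "s = t" if "(z, s) \<in> \<Gamma>" "(z, t) \<in> \<Gamma>" for z s t
  proof -
    have st: "0 < s" "0 < t" "W (z, s) \<in> space (Minf X) - Z" "W (z, t) \<in> space (Minf X) - Z"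
      using that by (auto simp: \<Gamma>_def)
    have "proj X (W (z, s)) = proj X (unweighted (reconstruct z))" if "0 < s" for s
      using that W_Minf[of "(z, s)"] unweighted_in_Minf[OF prob_space_reconstruct sets_reconstruct, of z]
      by (subst proj_eq_iff) (auto simp: W_def)
    then have "proj X (W (z, s)) = proj X (W (z, t))" using st by simp
    then have "W (z, s) = W (z, t)" using inj_onD[OF Z(2)] st(3,4) by blast
    then have "ennreal s = ennreal t" using total_W[OF st(1), of z] total_W[OF st(2), of z] by simp
    then show ?thesis using st by simp
  qed
  \<comment> \<open>The graph lemma needs a finite measure. The density \<open>total\<close> makes
    the mass finite, and being positive it keeps the null sets.\<close>
  define M where "M = distr (density N total) borel \<theta>"
  have \<theta>: "\<theta> \<in> borel_measurable (Minf X)"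
    unfolding \<theta>_def by (intro borel_measurable_Pair measurable_compose[OF measurable_proj \<zeta>]) measurable
  then have \<theta>': "\<theta> \<in> borel_measurable (density N total)" by (simp add: cong)
  have finN: "finite_measure (density N total)"
  proof (rule finite_measureI)
    have "emeasure (density N total) (space N) = (\<integral>\<^sup>+\<eta>. total \<eta> * indicator (space N) \<eta> \<partial>N)"
      by (rule emeasure_density) simp_all
    also have "\<dots> = (\<integral>\<^sup>+\<eta>. total \<eta> \<partial>N)" by (rule nn_integral_cong) simp
    finally show "emeasure (density N total) (space (density N total)) \<noteq> \<infinity>" using fin by auto
  qed
  then have M: "sets M = sets borel" "finite_measure M"
    unfolding M_def using finite_measure.finite_measure_distr[OF finN \<theta>'] by simp_all
  have AE_Z: "AE \<eta> in N. \<eta> \<notin> Z" using Z(1) by (rule AE_not_in)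
  have "AE \<eta> in N. \<theta> \<eta> \<in> \<Gamma>"
    using AE_tot AE_Z AE_space
  proof eventually_elim
    case (elim \<eta>)
    then show ?case using W_\<theta>[of \<eta>] by (simp add: \<Gamma>_def space_N) (simp add: \<theta>_def)
  qed
  then have "AE \<eta> in density N total. \<theta> \<eta> \<in> \<Gamma>" unfolding AE_density[OF tot] by eventually_elim simp
  then have AE_\<Gamma>: "AE p in M. p \<in> \<Gamma>"
    unfolding M_def using \<Gamma> by (subst AE_distr_iff[OF \<theta>']) simp_all
  obtain \<phi> where \<phi>: "\<phi> \<in> borel_measurable borel" "AE (z, t) in M. t = \<phi> z"
    by (rule AE_graph_measurable[OF M \<Gamma> AE_\<Gamma> graph]) (assumption, assumption, rule that)
  have "{p \<in> space borel. case p of (z, t) \<Rightarrow> t = \<phi> z} \<in> sets (borel :: ((nat \<Rightarrow> real) \<times> real) measure)"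
  proof -
    have [measurable]: "(\<lambda>p::(nat \<Rightarrow> real) \<times> real. \<phi> (fst p)) \<in> borel_measurable borel"
      by (rule measurable_compose[OF _ \<phi>(1)]) measurable
    have "{p \<in> space (borel :: ((nat \<Rightarrow> real) \<times> real) measure). snd p = \<phi> (fst p)} \<in> sets borel" by measurable
    then show ?thesis by (simp add: case_prod_unfold)
  qed
  then have "AE \<eta> in density N total. case \<theta> \<eta> of (z, t) \<Rightarrow> t = \<phi> z"
    using \<phi>(2) unfolding M_def by (subst (asm) AE_distr_iff[OF \<theta>']) auto
  then have "AE \<eta> in N. total \<eta> \<noteq> 0 \<longrightarrow> enn2real (total \<eta>) = \<phi> (\<zeta> (proj X \<eta>))"
    by (simp add: AE_density \<theta>_def zero_less_iff_neq_zero)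
  then have ae: "AE \<eta> in N. total \<eta> = ennreal (\<phi> (\<zeta> (proj X \<eta>))) \<and> 0 < \<phi> (\<zeta> (proj X \<eta>))"
    using AE_tot AE_space
  proof eventually_elim
    case (elim \<eta>)
    then have "enn2real (total \<eta>) = \<phi> (\<zeta> (proj X \<eta>))" using total_pos[of \<eta>] by (simp add: space_N)
    then show ?case using elim W_\<theta>(2)[of \<eta>] by (metis ennreal_enn2real infinity_ennreal_def space_N)
  qed
  show ?thesis
  \<comment> \<open>The value 1 is used only on a null set and makes the function positive
    everywhere.\<close>
  proof (rule that[of "\<lambda>c. if 0 < \<phi> (\<zeta> c) then \<phi> (\<zeta> c) else 1"])
    have [measurable]: "(\<lambda>c. \<phi> (\<zeta> c)) \<in> borel_measurable (PMinf X)" by (rule measurable_compose[OF \<zeta> \<phi>(1)])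
    show "(\<lambda>c. if 0 < \<phi> (\<zeta> c) then \<phi> (\<zeta> c) else 1) \<in> borel_measurable (PMinf X)" by measurable
    show "AE \<eta> in N. total \<eta> = ennreal (if 0 < \<phi> (\<zeta> (proj X \<eta>)) then \<phi> (\<zeta> (proj X \<eta>)) else 1)"
      using ae by eventually_elim simp
  qed simp
qed

end

section \<open>The projected measure class\<close>

text \<open>
  All admissible ergodic decompositions of \<open>\<nu>\<close> project to the same class, so that this union is one class.
\<close>

definition projected_class ::
  "('g, 'b) monoid_scheme \<Rightarrow> 'x measure \<Rightarrow> ('g \<Rightarrow> 'x \<Rightarrow> 'x) \<Rightarrow> 'x measure \<Rightarrow> 'x measure set measure set" where
  "projected_class G X T \<nu> = (\<Union>N\<in>{N. ergodic_decomposition G X T \<nu> N \<and> admissible X N}.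
     measure_class (distr N (PMinf X) (proj X)))"

lemma AE_null_sets_cong:
  assumes "null_sets M = null_sets N" "space M = space N"
  shows "(AE x in M. P x) \<longleftrightarrow> (AE x in N. P x)"
  using assms by (simp add: eventually_ae_filter)

lemma compl_null_sets_if_AE:
  assumes "AE x in M. x \<in> A" "A \<in> sets M"
  shows "space M - A \<in> null_sets M"
proof -
  have "AE x in M. x \<notin> space M - A" using assms(1) by eventually_elim simp
  then show ?thesis using sets.compl_sets[OF assms(2)] by (simp add: AE_iff_null_sets)
qed

lemma measure_class_cong: "\<mu> \<in> measure_class \<nu> \<Longrightarrow> measure_class \<mu> = measure_class \<nu>"
  by (auto simp: measure_class_def sigma_finite_measures_def)

lemma measure_class_self: "sigma_finite_measure \<mu> \<Longrightarrow> \<mu> \<in> measure_class \<mu>"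
  by (simp add: measure_class_def sigma_finite_measures_def)

lemma class_absolutely_continuous_iff:
  assumes "sigma_finite_measure \<mu>" "sigma_finite_measure \<nu>"
  shows "class_absolutely_continuous (measure_class \<mu>) (measure_class \<nu>) \<longleftrightarrow> absolutely_continuous \<nu> \<mu>"
  using measure_class_self[OF assms(1)] measure_class_self[OF assms(2)]
  unfolding class_absolutely_continuous_def
  by (auto simp: measure_class_def absolutely_continuous_def)

lemma mutually_singular_iff_null_sets:
  assumes "sets \<mu> = sets \<nu>"
  shows "mutually_singular \<mu> \<nu> \<longleftrightarrow> (\<exists>A\<in>null_sets \<mu>. space \<mu> - A \<in> null_sets \<nu>)"
  using assms by (auto simp: mutually_singular_def null_sets_def sets_eq_imp_space_eq[OF assms])

lemma class_mutually_singular_iff: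
  assumes "sigma_finite_measure \<mu>" "sigma_finite_measure \<nu>" "sets \<mu> = sets \<nu>"
  shows "class_mutually_singular (measure_class \<mu>) (measure_class \<nu>) \<longleftrightarrow> mutually_singular \<mu> \<nu>"
proof
  assume "class_mutually_singular (measure_class \<mu>) (measure_class \<nu>)"
  then show "mutually_singular \<mu> \<nu>"
    using measure_class_self[OF assms(1)] measure_class_self[OF assms(2)]
    by (auto simp: class_mutually_singular_def)
next
  assume *: "mutually_singular \<mu> \<nu>"
  show "class_mutually_singular (measure_class \<mu>) (measure_class \<nu>)"
    unfolding class_mutually_singular_def
  proof (intro ballI)
    fix \<mu>' \<nu>' assume m: "\<mu>' \<in> measure_class \<mu>" "\<nu>' \<in> measure_class \<nu>"
    then have s: "sets \<mu>' = sets \<mu>" "sets \<nu>' = sets \<nu>" and n: "null_sets \<mu>' = null_sets \<mu>" "null_sets \<nu>' = null_sets \<nu>"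
      by (auto simp: measure_class_def sigma_finite_measures_def)
    have "sets \<mu>' = sets \<nu>'" using s assms(3) by simp
    then show "mutually_singular \<mu>' \<nu>'"
      using * by (simp add: mutually_singular_iff_null_sets assms(3) n sets_eq_imp_space_eq[OF s(1)])
  qed
qed

lemma measure_class_eq_iff:
  assumes "sigma_finite_measure \<mu>" "sigma_finite_measure \<nu>" "sets \<mu> = sets \<nu>"
  shows "measure_class \<mu> = measure_class \<nu> \<longleftrightarrow> absolutely_continuous \<mu> \<nu> \<and> absolutely_continuous \<nu> \<mu>"
proof
  assume "measure_class \<mu> = measure_class \<nu>"
  then have "\<mu> \<in> measure_class \<nu>" using measure_class_self[OF assms(1)] by simp
  then show "absolutely_continuous \<mu> \<nu> \<and> absolutely_continuous \<nu> \<mu>"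
    by (simp add: measure_class_def absolutely_continuous_def)
next
  assume "absolutely_continuous \<mu> \<nu> \<and> absolutely_continuous \<nu> \<mu>"
  then have "null_sets \<mu> = null_sets \<nu>" by (auto simp: absolutely_continuous_def)
  then show "measure_class \<mu> = measure_class \<nu>" using assms(3) by (simp add: measure_class_def sigma_finite_measures_def)
qed

text \<open>Preimages of sets of finite measure have the same finite measure. The converse fails in
  general, so for projections of decompositions sigma-finiteness needs an argument of its
  own.\<close>

lemma sigma_finite_if_sigma_finite_distr:
  assumes p: "p \<in> N \<rightarrow>\<^sub>M P" and sf: "sigma_finite_measure (distr N P p)"
  shows "sigma_finite_measure N"
proof -
  interpret D: sigma_finite_measure "distr N P p" by (rule sf)
  obtain A where A: "countable A" "A \<subseteq> sets P" "\<Union>A = space P" "\<forall>a\<in>A. emeasure (distr N P p) a \<noteq> \<infinity>"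
    using D.sigma_finite_countable by auto
  show ?thesis
  proof
    show "\<exists>A'. countable A' \<and> A' \<subseteq> sets N \<and> \<Union>A' = space N \<and> (\<forall>a\<in>A'. emeasure N a \<noteq> \<infinity>)"
    proof (intro exI[of _ "(\<lambda>a. p -` a \<inter> space N) ` A"] conjI)
      show "countable ((\<lambda>a. p -` a \<inter> space N) ` A)" using A(1) by (rule countable_image)
      show "(\<lambda>a. p -` a \<inter> space N) ` A \<subseteq> sets N" using A(2) measurable_sets[OF p] by blast
      show "\<Union>((\<lambda>a. p -` a \<inter> space N) ` A) = space N" using A(3) measurable_space[OF p] by blast
      show "\<forall>a\<in>(\<lambda>a. p -` a \<inter> space N) ` A. emeasure N a \<noteq> \<infinity>"
      proof
        fix b assume "b \<in> (\<lambda>a. p -` a \<inter> space N) ` A"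
        then obtain a where a: "a \<in> A" "b = p -` a \<inter> space N" by blast
        then show "emeasure N b \<noteq> \<infinity>" using A(2,4) emeasure_distr[OF p, of a] by auto
      qed
    qed
  qed
qed

lemma Minf_erg_scale:
  assumes \<eta>: "\<eta> \<in> Minf_erg G X T" and c: "0 < c" and T: "\<And>g. g \<in> carrier G \<Longrightarrow> T g \<in> X \<rightarrow>\<^sub>M X"
  shows "scale_measure (ennreal c) \<eta> \<in> Minf_erg G X T"
proof -
  have m: "\<eta> \<in> space (Minf X)" using \<eta> by (simp add: Minf_erg_def)
  note sets_\<eta> = sets_of_Minf[OF m]
  have "distr (scale_measure (ennreal c) \<eta>) X (T g) = scale_measure (ennreal c) \<eta>" if g: "g \<in> carrier G" for g
  proof (rule measure_eqI)
    fix A assume "A \<in> sets (distr (scale_measure (ennreal c) \<eta>) X (T g))"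
    then have A: "A \<in> sets X" by simp
    have Tg: "T g \<in> \<eta> \<rightarrow>\<^sub>M X" using T[OF g] by (simp add: measurable_cong_sets[OF sets_\<eta> refl])
    have Tg': "T g \<in> scale_measure (ennreal c) \<eta> \<rightarrow>\<^sub>M X"
      using T[OF g] by (simp add: measurable_cong_sets[of "scale_measure (ennreal c) \<eta>" X] sets_\<eta>)
    have "emeasure (distr (scale_measure (ennreal c) \<eta>) X (T g)) A = ennreal c * emeasure (distr \<eta> X (T g)) A"
      using A by (simp add: emeasure_distr[OF Tg] emeasure_distr[OF Tg'] space_scale_measure)
    also have "distr \<eta> X (T g) = \<eta>" using \<eta> g by (simp add: Minf_erg_def invariant_measure_def)
    finally show "emeasure (distr (scale_measure (ennreal c) \<eta>) X (T g)) A = emeasure (scale_measure (ennreal c) \<eta>) A"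
      by simp
  qed (simp add: sets_\<eta>)
  moreover have "ergodic_measure G X T (scale_measure (ennreal c) \<eta>)"
    using \<eta> by (fastforce simp: Minf_erg_def ergodic_measure_def)
  ultimately show ?thesis
    using scale_in_Minf[OF m c] by (simp add: Minf_erg_def invariant_measure_def)
qed

context weighted_action
begin

lemma total_proj_section: "c \<in> space (PMinf X) \<Longrightarrow> total (proj_section c) = 1"
  by (auto elim!: proj_cases simp: proj_section_proj total_normalize)

lemma proj_section_in_Minf: "c \<in> space (PMinf X) \<Longrightarrow> proj_section c \<in> space (Minf X)"
  by (rule measurable_space[OF measurable_proj_section])

context
  fixes \<nu> assumes \<nu>: "integrable_invariant \<nu>"
begin

lemma sigma_finite_projected: "sigma_finite_measure (projected \<nu>)"
  using finite_measure_projected[OF \<nu>] by (simp add: finite_measure_def)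

lemma measurable_proj_decomposition: "proj X \<in> decomposition \<nu> \<rightarrow>\<^sub>M PMinf X"
  by (rule measurable_proj_sets) simp

lemma AE_projected: "AE c in projected \<nu>. c \<in> projective_ergodic"
proof -
  have "{c \<in> space (PMinf X). c \<in> projective_ergodic} \<in> sets (PMinf X)" by measurable
  then show ?thesis
    unfolding projected_def using AE_decomposition[OF \<nu>]
    by (subst AE_distr_iff[OF measurable_proj_decomposition])
      (auto simp: projective_ergodic_def elim: eventually_mono)
qed

lemma emeasure_eq_section_integral:
  assumes A: "A \<in> sets X"
  shows "emeasure \<nu> A = (\<integral>\<^sup>+c. emeasure (proj_section c) A \<partial>projected \<nu>)"
proof -
  have m: "(\<lambda>c. emeasure (proj_section c) A) \<in> borel_measurable (PMinf X)"
    using A by measurable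
  have "(\<integral>\<^sup>+c. emeasure (proj_section c) A \<partial>projected \<nu>) = (\<integral>\<^sup>+\<eta>. emeasure (proj_section (proj X \<eta>)) A \<partial>decomposition \<nu>)"
    unfolding projected_def using m by (intro nn_integral_distr[OF measurable_proj_decomposition]) simp
  also have "\<dots> = (\<integral>\<^sup>+\<eta>. emeasure \<eta> A \<partial>decomposition \<nu>)"
    using AE_decomposition[OF \<nu>]
    by (intro nn_integral_cong_AE, eventually_elim)
      (simp add: proj_section_proj normalized_ergodicD normalize_normalized)
  finally show ?thesis using represents_decomposition[OF \<nu>] A by (simp add: represents_def)
qed

text \<open>On normalized measures the section inverts the projection, and almost all components are
  normalized.\<close>

lemma decomposition_admissible: "admissible X (decomposition \<nu>)"
  unfolding admissible_def
proof (intro bexI[of _ "space (Minf X) - normalized_ergodic"])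
  show "space (Minf X) - normalized_ergodic \<in> null_sets (decomposition \<nu>)"
    using compl_null_sets_if_AE[OF AE_decomposition[OF \<nu>]] by simp
  show "inj_on (proj X) (space (Minf X) - (space (Minf X) - normalized_ergodic))"
  proof (rule inj_onI)
    fix \<eta> \<eta>' assume "\<eta> \<in> space (Minf X) - (space (Minf X) - normalized_ergodic)"
      "\<eta>' \<in> space (Minf X) - (space (Minf X) - normalized_ergodic)" and p: "proj X \<eta> = proj X \<eta>'"
    then have E: "\<eta> \<in> normalized_ergodic" "\<eta>' \<in> normalized_ergodic" by auto
    have "\<eta> = proj_section (proj X \<eta>)"
      using normalized_ergodicD[OF E(1)] by (simp add: proj_section_proj normalize_normalized)
    also have "\<dots> = \<eta>'"
      unfolding p using normalized_ergodicD[OF E(2)] by (simp add: proj_section_proj normalize_normalized)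
    finally show "\<eta> = \<eta>'" .
  qed
qed

lemma decomposition_ergodic: "ergodic_decomposition G X T \<nu> (decomposition \<nu>)"
  unfolding ergodic_decomposition_def
proof (intro conjI)
  show "decomposition \<nu> \<in> sigma_finite_measures (Minf X)"
    using finite_measure_decomposition[OF \<nu>] by (simp add: sigma_finite_measures_def finite_measure_def)
  show "is_measure_integral X \<nu> (decomposition \<nu>)"
    using represents_decomposition[OF \<nu>] by (auto simp: is_measure_integral_def represents_def)
  show "AE \<eta> in decomposition \<nu>. invariant_measure G X T \<eta> \<and> ergodic_measure G X T \<eta>"
    using AE_decomposition[OF \<nu>] by eventually_elim (use normalized_ergodicD(3) in \<open>auto simp: Minf_erg_def\<close>)
qed

lemma total_integral:
  assumes "represents X \<nu> N" shows "(\<integral>\<^sup>+\<eta>. total \<eta> \<partial>N) < \<infinity>"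
  using represents_nn_integral[OF assms sets_inv[OF \<nu>], of fe] \<nu>
  by (simp add: total_def[abs_def] integrable_invariant_def)

text \<open>Since the total mass factors through the projection almost everywhere, the density may
  be taken after projecting instead of before.\<close>

lemma density_proj_eq_projected:
  assumes N: "N \<in> sigma_finite_measures (Minf X)" and rep: "represents X \<nu> N"
    and erg: "AE \<eta> in N. total \<eta> < \<infinity> \<and> normalize \<eta> \<in> normalized_ergodic"
    and \<phi>: "\<phi> \<in> borel_measurable (PMinf X)" "AE \<eta> in N. total \<eta> = ennreal (\<phi> (proj X \<eta>))"
  shows "density (distr N (PMinf X) (proj X)) (\<lambda>c. ennreal (\<phi> c)) = projected \<nu>"
proof -
  have sets_N: "sets N = sets (Minf X)" using N by (simp add: sigma_finite_measures_def)
  note p = measurable_proj_sets[OF sets_N]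
  have tot: "total \<in> borel_measurable N" by (simp add: measurable_cong_sets[OF sets_N refl])
  have pd: "proj X \<in> density N total \<rightarrow>\<^sub>M PMinf X" using p by simp
  note [measurable] = \<phi>(1)
  have "density (distr N (PMinf X) (proj X)) (\<lambda>c. ennreal (\<phi> c)) = distr (density N total) (PMinf X) (proj X)"
  proof (rule measure_eqI)
    fix C assume "C \<in> sets (density (distr N (PMinf X) (proj X)) (\<lambda>c. ennreal (\<phi> c)))"
    then have C[measurable]: "C \<in> sets (PMinf X)" by simp
    have "emeasure (density (distr N (PMinf X) (proj X)) (\<lambda>c. ennreal (\<phi> c))) C =
        (\<integral>\<^sup>+c. ennreal (\<phi> c) * indicator C c \<partial>distr N (PMinf X) (proj X))"
      by (rule emeasure_density) simp_all
    also have "\<dots> = (\<integral>\<^sup>+\<eta>. ennreal (\<phi> (proj X \<eta>)) * indicator C (proj X \<eta>) \<partial>N)"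
      by (rule nn_integral_distr[OF p]) simp
    also have "\<dots> = (\<integral>\<^sup>+\<eta>. total \<eta> * indicator (proj X -` C \<inter> space N) \<eta> \<partial>N)"
      using \<phi>(2) AE_space by (intro nn_integral_cong_AE, eventually_elim) (simp split: split_indicator)
    also have "\<dots> = emeasure (density N total) (proj X -` C \<inter> space N)"
      using tot measurable_sets[OF p C] by (rule emeasure_density[symmetric])
    also have "\<dots> = emeasure (distr (density N total) (PMinf X) (proj X)) C"
      using emeasure_distr[OF pd C] by simp
    finally show "emeasure (density (distr N (PMinf X) (proj X)) (\<lambda>c. ennreal (\<phi> c))) C =
        emeasure (distr (density N total) (PMinf X) (proj X)) C" .
  qed simp
  then show ?thesis using projected_eq[OF \<nu> rep erg] by simp
qed

text \<open>\<open>projected \<nu>\<close> has a positive finite density \<phi> with respect to the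
  projection of \<open>N\<close>, so both have the same null sets. Sigma-finiteness comes back from
  \<open>projected \<nu>\<close> through the density \<open>1 / \<phi>\<close>.\<close>

theorem distr_proj_in_class:
  assumes N: "ergodic_decomposition G X T \<nu> N" and adm: "admissible X N"
  shows "distr N (PMinf X) (proj X) \<in> measure_class (projected \<nu>)"
proof -
  have Nsf: "N \<in> sigma_finite_measures (Minf X)" and int: "is_measure_integral X \<nu> N"
    and AE_erg: "AE \<eta> in N. invariant_measure G X T \<eta> \<and> ergodic_measure G X T \<eta>"
    using N by (auto simp: ergodic_decomposition_def)
  have sets_N: "sets N = sets (Minf X)" using Nsf by (simp add: sigma_finite_measures_def)
  have space_N: "space N = space (Minf X)" using sets_N by (rule sets_eq_imp_space_eq)
  have rep: "represents X \<nu> N" by (rule represents_if_measure_integral[OF \<nu> Nsf int])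
  have tot: "total \<in> borel_measurable N" by (simp add: measurable_cong_sets[OF sets_N refl])
  have fin: "(\<integral>\<^sup>+\<eta>. total \<eta> \<partial>N) < \<infinity>" by (rule total_integral[OF rep])
  have "AE \<eta> in N. total \<eta> < \<infinity>"
    using nn_integral_PInf_AE[OF tot] fin by (auto simp: less_top[symmetric])
  then have erg: "AE \<eta> in N. total \<eta> < \<infinity> \<and> normalize \<eta> \<in> normalized_ergodic"
    using AE_erg AE_space
  proof eventually_elim
    case (elim \<eta>)
    then have m: "\<eta> \<in> space (Minf X)" "\<eta> \<in> Minf_erg G X T" by (auto simp: space_N Minf_erg_def)
    obtain c where "c > 0" "inverse (total \<eta>) = ennreal c" using inverse_total[OF m(1) elim(1)] by metis
    then have "normalize \<eta> \<in> Minf_erg G X T"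
      using elim(1) Minf_erg_scale[OF m(2), of c] measurable_T by (simp add: normalize_def)
    then show ?case
      using elim(1) total_normalize[OF m(1)] by (simp add: normalized_ergodic_iff total_def)
  qed
  obtain \<phi> :: "_ \<Rightarrow> real" where \<phi>[measurable]: "\<phi> \<in> borel_measurable (PMinf X)" and pos: "\<And>c. 0 < \<phi> c"
    and ae: "AE \<eta> in N. total \<eta> = ennreal (\<phi> (proj X \<eta>))"
    by (rule total_AE_function_of_proj[OF Nsf adm fin]) (rule that)
  define P where "P = distr N (PMinf X) (proj X)"
  have sets_P[measurable_cong]: "sets P = sets (PMinf X)" by (simp add: P_def)
  have dens: "density P (\<lambda>c. ennreal (\<phi> c)) = projected \<nu>"
    unfolding P_def by (rule density_proj_eq_projected[OF Nsf rep erg \<phi> ae])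
  have "density (projected \<nu>) (\<lambda>c. ennreal (1 / \<phi> c)) = density P (\<lambda>c. ennreal (\<phi> c) * ennreal (1 / \<phi> c))"
    unfolding dens[symmetric] by (rule density_density_eq) measurable
  also have "(\<lambda>c. ennreal (\<phi> c) * ennreal (1 / \<phi> c)) = (\<lambda>_. 1)"
  proof
    fix c
    have "ennreal (\<phi> c) * ennreal (1 / \<phi> c) = ennreal (\<phi> c * (1 / \<phi> c))"
      using pos[of c] by (intro ennreal_mult[symmetric]) simp_all
    then show "ennreal (\<phi> c) * ennreal (1 / \<phi> c) = 1" using pos[of c] by simp
  qed
  finally have P_eq: "P = density (projected \<nu>) (\<lambda>c. ennreal (1 / \<phi> c))" by (simp add: density_1)
  interpret pr: sigma_finite_measure "projected \<nu>" by (rule sigma_finite_projected)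
  have "sigma_finite_measure P"
    unfolding P_eq by (subst pr.sigma_finite_iff_density_finite) auto
  moreover have "null_sets P = null_sets (projected \<nu>)"
  proof -
    have "A \<in> null_sets (density P (\<lambda>c. ennreal (\<phi> c))) \<longleftrightarrow> A \<in> sets P \<and> (AE c in P. c \<in> A \<longrightarrow> ennreal (\<phi> c) = 0)" for A
      by (rule null_sets_density_iff) measurable
    moreover have "A \<in> sets P \<and> (AE c in P. c \<notin> A) \<longleftrightarrow> A \<in> null_sets P" for A
      using AE_iff_null_sets[of A P] by blast
    moreover have "ennreal (\<phi> c) \<noteq> 0" for c using pos[of c] by simp
    ultimately show ?thesis unfolding dens by auto
  qed
  ultimately show ?thesis unfolding P_def[symmetric] by (simp add: measure_class_def sigma_finite_measures_def sets_P)
qed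

text \<open>The left side does not mention \<open>f\<close>. The class is therefore the same for
  every weight integrable with respect to \<nu>, and two measures can later be treated with a common
  weight.\<close>

lemma projected_class_eq: "projected_class G X T \<nu> = measure_class (projected \<nu>)"
proof -
  have "measure_class (distr N (PMinf X) (proj X)) = measure_class (projected \<nu>)"
    if "ergodic_decomposition G X T \<nu> N" "admissible X N" for N
    by (rule measure_class_cong) (rule distr_proj_in_class[OF that])
  then show ?thesis
    unfolding projected_class_def using decomposition_ergodic decomposition_admissible by blast
qed

text \<open>The set lies in the complement of \<open>projective_ergodic\<close>, a Borel null set;
  the completion makes every subset of it null.\<close>

theorem complement_PMinf_erg_null:
  assumes "\<mu> \<in> measure_class (projected \<nu>)"
  shows "space (PMinf X) - PMinf_erg G X T \<in> null_sets (completion \<mu>)"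
proof -
  have "space (PMinf X) - projective_ergodic \<in> null_sets (projected \<nu>)"
    using compl_null_sets_if_AE[OF AE_projected] by simp
  then have "space (PMinf X) - projective_ergodic \<in> null_sets \<mu>" using assms by (simp add: measure_class_def)
  then show ?thesis
    using projective_ergodic_subset by (intro null_sets_completion_subset[OF _ null_sets_completionI]) auto
qed

text \<open>With \<delta> the density of \<open>projected \<nu>\<close> with respect to \<mu>, the
  lift puts \<mu> on the representatives \<open>\<delta> c\<close> times
  \<open>proj_section c\<close>. A lift is fixed by the total masses it assigns to projective
  points, and representing \<nu> forces them to equal \<delta> almost everywhere.\<close>

theorem lift_unique:
  assumes \<mu>: "\<mu> \<in> measure_class (projected \<nu>)"
  shows "\<exists>!N. N \<in> sigma_finite_measures (Minf X) \<and> admissible X N \<and>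
            distr N (PMinf X) (proj X) = \<mu> \<and> is_measure_integral X \<nu> N"
proof -
  have sets_\<mu>[measurable_cong]: "sets \<mu> = sets (PMinf X)" and sf: "sigma_finite_measure \<mu>"
    and null: "null_sets \<mu> = null_sets (projected \<nu>)"
    using \<mu> by (auto simp: measure_class_def sigma_finite_measures_def)
  have space_\<mu>: "space \<mu> = space (PMinf X)" using sets_\<mu> by (rule sets_eq_imp_space_eq)
  interpret sigma_finite_measure \<mu> by (rule sf)
  have AE_\<mu>: "AE c in \<mu>. c \<in> projective_ergodic"
    using AE_projected AE_null_sets_cong[OF null] by (simp add: space_\<mu>)
  obtain \<delta> :: "_ \<Rightarrow> real" where \<delta>[measurable]: "\<delta> \<in> borel_measurable (PMinf X)" and pos: "\<And>c. 0 < \<delta> c"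
    and dens: "density \<mu> (\<lambda>c. ennreal (\<delta> c)) = projected \<nu>"
  proof -
    define D where "D = RN_deriv \<mu> (projected \<nu>)"
    have ac: "absolutely_continuous \<mu> (projected \<nu>)" using null by (simp add: absolutely_continuous_def)
    have [measurable]: "D \<in> borel_measurable \<mu>" unfolding D_def by simp
    then have D[measurable]: "D \<in> borel_measurable (PMinf X)" by (simp add: measurable_cong_sets[OF sets_\<mu> refl])
    have dens: "density \<mu> D = projected \<nu>" unfolding D_def by (rule density_RN_deriv[OF ac]) (simp add: sets_\<mu>)
    have fin: "AE c in \<mu>. D c \<noteq> \<infinity>"
      unfolding D_def by (rule RN_deriv_finite[OF sigma_finite_projected ac]) (simp add: sets_\<mu>)
    have "{c \<in> space (PMinf X). D c = 0} \<in> null_sets (density \<mu> D)"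
      by (subst null_sets_density_iff) (auto simp: sets_\<mu>)
    then have "{c \<in> space (PMinf X). D c = 0} \<in> null_sets \<mu>" by (simp add: dens null)
    then have "AE c in \<mu>. c \<notin> {c \<in> space (PMinf X). D c = 0}" by (rule AE_not_in)
    with AE_space have nz: "AE c in \<mu>. D c \<noteq> 0" by eventually_elim (simp add: space_\<mu>)
    show ?thesis
    \<comment> \<open>The derivative is infinite only on a null set because
      \<open>projected \<nu>\<close> is sigma-finite, and 0 only on a null set because the null sets
      agree. Replacing these values by 1 makes it a positive real function everywhere.\<close>
    proof (rule that[of "\<lambda>c. if 0 < enn2real (D c) then enn2real (D c) else 1"])
      have "density \<mu> (\<lambda>c. ennreal (if 0 < enn2real (D c) then enn2real (D c) else 1)) = density \<mu> D"
      proof (rule density_cong)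
        show "AE c in \<mu>. ennreal (if 0 < enn2real (D c) then enn2real (D c) else 1) = D c"
          using fin nz by eventually_elim (auto simp: enn2real_positive_iff zero_less_iff_neq_zero less_top[symmetric])
      qed simp_all
      then show "density \<mu> (\<lambda>c. ennreal (if 0 < enn2real (D c) then enn2real (D c) else 1)) = projected \<nu>"
        by (simp add: dens)
    next
      have "(\<lambda>c. enn2real (D c)) \<in> borel_measurable (PMinf X)" by (rule measurable_compose[OF D]) measurable
      then show "(\<lambda>c. if 0 < enn2real (D c) then enn2real (D c) else 1) \<in> borel_measurable (PMinf X)" by measurable
    qed simp
  qed
  define \<kappa> where "\<kappa> c = scale_measure (ennreal (\<delta> c)) (proj_section c)" for c
  have \<kappa>_Minf: "\<kappa> c \<in> space (Minf X)" if "c \<in> space (PMinf X)" for c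
    unfolding \<kappa>_def by (rule scale_in_Minf[OF proj_section_in_Minf[OF that] pos])
  have \<kappa>[measurable]: "\<kappa> \<in> PMinf X \<rightarrow>\<^sub>M Minf X"
  proof (rule measurable_MinfI)
    fix A assume [measurable]: "A \<in> sets X"
    have "(\<lambda>c. ennreal (\<delta> c) * emeasure (proj_section c) A) \<in> borel_measurable (PMinf X)" by measurable
    then show "(\<lambda>c. emeasure (\<kappa> c) A) \<in> borel_measurable (PMinf X)" by (simp add: \<kappa>_def)
  qed (rule \<kappa>_Minf)
  have \<kappa>_\<mu>: "\<kappa> \<in> \<mu> \<rightarrow>\<^sub>M Minf X" by measurable
  have total_\<kappa>: "total (\<kappa> c) = ennreal (\<delta> c)" if "c \<in> space (PMinf X)" for c
    using that by (simp add: \<kappa>_def total_scale[OF proj_section_in_Minf] total_proj_section)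
  have proj_\<kappa>: "proj X (\<kappa> c) = c" if "c \<in> projective_ergodic" for c
  proof -
    have c: "c \<in> space (PMinf X)" using that sets.sets_into_space[OF sets_projective_ergodic] by blast
    have "proj X (\<kappa> c) = proj X (proj_section c)"
      using \<kappa>_Minf[OF c] proj_section_in_Minf[OF c] pos[of c] by (subst proj_eq_iff) (auto simp: \<kappa>_def)
    then show ?thesis using proj_proj_section[OF that] by simp
  qed
  have \<kappa>_proj: "\<kappa> (proj X \<eta>) = \<eta>"
    if "\<eta> \<in> space (Minf X)" "total \<eta> = ennreal (\<delta> (proj X \<eta>))" for \<eta>
    using that scale_total_normalize[of \<eta>] by (simp add: \<kappa>_def proj_section_proj)
  define N where "N = distr \<mu> (Minf X) \<kappa>"
  have sets_N: "sets N = sets (Minf X)" by (simp add: N_def)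
  have "N \<in> sigma_finite_measures (Minf X) \<and> admissible X N \<and>
            distr N (PMinf X) (proj X) = \<mu> \<and> is_measure_integral X \<nu> N"
  proof (intro conjI)
    have "distr N (PMinf X) (proj X) = distr \<mu> (PMinf X) (\<lambda>c. proj X (\<kappa> c))"
      unfolding N_def by (subst distr_distr[OF measurable_proj \<kappa>_\<mu>]) (simp add: o_def)
    also have "\<dots> = distr \<mu> (PMinf X) (\<lambda>c. c)"
    proof (rule distr_cong_AE')
      show "AE c in \<mu>. proj X (\<kappa> c) = c" using AE_\<mu> by eventually_elim (rule proj_\<kappa>)
      show "(\<lambda>c. proj X (\<kappa> c)) \<in> \<mu> \<rightarrow>\<^sub>M PMinf X" by (rule measurable_compose[OF \<kappa>_\<mu> measurable_proj])
    qed measurable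
    also have "\<dots> = \<mu>" by (rule distr_id2) (simp add: sets_\<mu>)
    finally show N\<mu>: "distr N (PMinf X) (proj X) = \<mu>" .
    then have "sigma_finite_measure N"
      using sigma_finite_if_sigma_finite_distr[OF measurable_proj_sets[OF sets_N]] sf by simp
    then show "N \<in> sigma_finite_measures (Minf X)" by (simp add: sigma_finite_measures_def sets_N)
    \<comment> \<open>A Borel set on which \<open>\<kappa>\<close> inverts the projection. It has
      full measure and witnesses admissibility.\<close>
    define Y where "Y = {\<eta> \<in> space (Minf X). total \<eta> = ennreal (\<delta> (proj X \<eta>))}"
    have [measurable]: "(\<lambda>\<eta>. \<delta> (proj X \<eta>)) \<in> borel_measurable (Minf X)"
      by (rule measurable_compose[OF measurable_proj \<delta>])
    have Y[measurable]: "Y \<in> sets (Minf X)" unfolding Y_def by measurable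
    have "AE \<eta> in N. \<eta> \<in> Y"
    proof -
      have "{\<eta> \<in> space (Minf X). \<eta> \<in> Y} \<in> sets (Minf X)" by measurable
      moreover have "AE c in \<mu>. \<kappa> c \<in> Y"
        using AE_\<mu> AE_space
        by eventually_elim (simp add: Y_def proj_\<kappa> total_\<kappa> \<kappa>_Minf space_\<mu>)
      ultimately show ?thesis unfolding N_def by (subst AE_distr_iff[OF \<kappa>_\<mu>])
    qed
    then have "space (Minf X) - Y \<in> null_sets N"
      using compl_null_sets_if_AE[of Y N] Y sets_eq_imp_space_eq[OF sets_N] by (simp add: sets_N)
    moreover have "inj_on (proj X) (space (Minf X) - (space (Minf X) - Y))"
    proof (rule inj_on_inverseI)
      fix \<eta> assume "\<eta> \<in> space (Minf X) - (space (Minf X) - Y)"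
      then show "\<kappa> (proj X \<eta>) = \<eta>" by (intro \<kappa>_proj) (auto simp: Y_def)
    qed
    ultimately show "admissible X N" unfolding admissible_def by blast
    have "emeasure \<nu> A = (\<integral>\<^sup>+\<eta>. emeasure \<eta> A \<partial>N)" if A[measurable]: "A \<in> sets X" for A
    proof -
      have "(\<integral>\<^sup>+\<eta>. emeasure \<eta> A \<partial>N) = (\<integral>\<^sup>+c. emeasure (\<kappa> c) A \<partial>\<mu>)"
        unfolding N_def by (rule nn_integral_distr[OF \<kappa>_\<mu>]) simp
      also have "\<dots> = (\<integral>\<^sup>+c. ennreal (\<delta> c) * emeasure (proj_section c) A \<partial>\<mu>)" by (simp add: \<kappa>_def)
      also have "\<dots> = (\<integral>\<^sup>+c. emeasure (proj_section c) A \<partial>projected \<nu>)"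
        unfolding dens[symmetric] by (rule nn_integral_density[symmetric]) measurable
      finally show ?thesis by (simp add: emeasure_eq_section_integral[OF A])
    qed
    then show "is_measure_integral X \<nu> N"
      by (simp add: is_measure_integral_def measurable_cong_sets[OF sets_N refl])
  qed
  moreover have "N' = N" if N': "N' \<in> sigma_finite_measures (Minf X) \<and> admissible X N' \<and>
            distr N' (PMinf X) (proj X) = \<mu> \<and> is_measure_integral X \<nu> N'" for N'
  proof -
    have Nsf: "N' \<in> sigma_finite_measures (Minf X)" and adm: "admissible X N'"
      and d: "distr N' (PMinf X) (proj X) = \<mu>" and int: "is_measure_integral X \<nu> N'" using N' by auto
    have sets_N': "sets N' = sets (Minf X)" using Nsf by (simp add: sigma_finite_measures_def)
    have space_N': "space N' = space (Minf X)" using sets_N' by (rule sets_eq_imp_space_eq)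
    note p = measurable_proj_sets[OF sets_N']
    have rep: "represents X \<nu> N'" by (rule represents_if_measure_integral[OF \<nu> Nsf int])
    \<comment> \<open>Since \<open>N'\<close> projects to \<mu>, almost sure properties of
      projective points can be pulled back along the projection.\<close>
    have AE_pullback: "AE \<eta> in N'. Q (proj X \<eta>)"
      if "AE c in \<mu>. Q c" "{c \<in> space (PMinf X). Q c} \<in> sets (PMinf X)" for Q
      using that(1) AE_distr_iff[OF p that(2)] unfolding d by blast
    have "AE \<eta> in N'. proj X \<eta> \<in> projective_ergodic"
      by (rule AE_pullback[OF AE_\<mu>]) measurable
    with AE_space have erg: "AE \<eta> in N'. total \<eta> < \<infinity> \<and> normalize \<eta> \<in> normalized_ergodic"
      by eventually_elim (simp add: space_N' proj_in_projective_ergodic_iff)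
    obtain \<phi> :: "_ \<Rightarrow> real" where \<phi>[measurable]: "\<phi> \<in> borel_measurable (PMinf X)" and \<phi>pos: "\<And>c. 0 < \<phi> c"
      and ae: "AE \<eta> in N'. total \<eta> = ennreal (\<phi> (proj X \<eta>))"
      by (rule total_AE_function_of_proj[OF Nsf adm total_integral[OF rep]]) (rule that)
    \<comment> \<open>Both sides are \<open>projected \<nu>\<close>, and densities with respect to
      the sigma-finite \<mu> are unique. So almost every measure under \<open>N'\<close> is the
      value of \<open>\<kappa>\<close> at its projective point.\<close>
    have "density \<mu> (\<lambda>c. ennreal (\<phi> c)) = density \<mu> (\<lambda>c. ennreal (\<delta> c))"
      using density_proj_eq_projected[OF Nsf rep erg \<phi> ae] by (simp add: d dens)
    then have "AE c in \<mu>. ennreal (\<phi> c) = ennreal (\<delta> c)" by (intro density_unique) measurable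
    then have "AE c in \<mu>. \<phi> c = \<delta> c"
      by eventually_elim (use pos \<phi>pos in \<open>simp add: less_imp_le\<close>)
    then have "AE \<eta> in N'. \<phi> (proj X \<eta>) = \<delta> (proj X \<eta>)" by (rule AE_pullback) measurable
    with ae AE_space have "AE \<eta> in N'. \<eta> = \<kappa> (proj X \<eta>)"
      by eventually_elim (simp add: \<kappa>_proj space_N')
    then have "distr N' (Minf X) (\<lambda>\<eta>. \<eta>) = distr N' (Minf X) (\<lambda>\<eta>. \<kappa> (proj X \<eta>))"
      using measurable_compose[OF p \<kappa>] by (intro distr_cong_AE') (simp_all add: measurable_cong_sets[OF sets_N' refl])
    also have "\<dots> = distr (distr N' (PMinf X) (proj X)) (Minf X) \<kappa>"
      by (subst distr_distr[OF \<kappa> p]) (simp add: o_def)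
    finally show "N' = N" using distr_id2[OF sets_N'[symmetric]] by (simp add: d N_def)
  qed
  ultimately show ?thesis by (rule ex1I)
qed

section \<open>Null sets on \<open>X\<close> and on the projective space\<close>

lemma emeasure_projected_eq_0:
  assumes C: "C \<in> sets (PMinf X)"
  shows "{x \<in> space X. proj X (component x) \<in> C} \<in> sets X"
    and "emeasure (projected \<nu>) C = 0 \<longleftrightarrow> emeasure \<nu> {x \<in> space X. proj X (component x) \<in> C} = 0"
proof -
  have m: "(\<lambda>x. proj X (component x)) \<in> X \<rightarrow>\<^sub>M PMinf X"
    by (rule measurable_compose[OF measurable_component_X measurable_proj])
  have eq: "{x \<in> space X. proj X (component x) \<in> C} = (\<lambda>x. proj X (component x)) -` C \<inter> space X" by auto
  show S: "{x \<in> space X. proj X (component x) \<in> C} \<in> sets X" unfolding eq by (rule measurable_sets[OF m C])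
  have sp: "space \<nu> = space X" by (rule space_inv[OF \<nu>])
  have "projected \<nu> = distr (weighted \<nu>) (PMinf X) (\<lambda>x. proj X (component x))"
    unfolding projected_def decomposition_def
    by (subst distr_distr[OF measurable_proj measurable_component_weighted[OF \<nu>]]) (simp add: o_def)
  then have "emeasure (projected \<nu>) C = emeasure (weighted \<nu>) {x \<in> space X. proj X (component x) \<in> C}"
    using m C unfolding eq
    by (simp add: emeasure_distr sp measurable_cong_sets[OF sets_inv[OF \<nu>] refl])
  also have "\<dots> = 0 \<longleftrightarrow> (AE x in weighted \<nu>. \<not> proj X (component x) \<in> C)"
    using S by (subst AE_iff_measurable[of "{x \<in> space X. proj X (component x) \<in> C}"]) (auto simp: sp sets_inv[OF \<nu>])
  also have "\<dots> \<longleftrightarrow> (AE x in \<nu>. \<not> proj X (component x) \<in> C)" by (rule AE_weighted[OF \<nu>])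
  also have "\<dots> \<longleftrightarrow> emeasure \<nu> {x \<in> space X. proj X (component x) \<in> C} = 0"
    using S by (subst AE_iff_measurable[of "{x \<in> space X. proj X (component x) \<in> C}"]) (auto simp: sp sets_inv[OF \<nu>])
  finally show "emeasure (projected \<nu>) C = 0 \<longleftrightarrow> emeasure \<nu> {x \<in> space X. proj X (component x) \<in> C} = 0" .
qed

text \<open>With \<open>emeasure_projected_eq_0\<close> this translates null sets in both
  directions, through maps that depend on \<open>f\<close> but not on \<nu>. Relations between the
  null sets of two measures therefore carry over.\<close>

lemma emeasure_eq_0_iff_sections:
  assumes A[measurable]: "A \<in> sets X"
  shows "emeasure \<nu> A = 0 \<longleftrightarrow> (AE c in projected \<nu>. emeasure (proj_section c) A = 0)"
  unfolding emeasure_eq_section_integral[OF A] by (rule nn_integral_0_iff_AE) measurable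

end

theorem absolutely_continuous_projected_iff:
  assumes \<nu>1: "integrable_invariant \<nu>1" and \<nu>2: "integrable_invariant \<nu>2"
  shows "absolutely_continuous (projected \<nu>2) (projected \<nu>1) \<longleftrightarrow> absolutely_continuous \<nu>2 \<nu>1"
proof
  assume *: "absolutely_continuous (projected \<nu>2) (projected \<nu>1)"
  show "absolutely_continuous \<nu>2 \<nu>1"
    unfolding absolutely_continuous_def
  proof
    fix A assume "A \<in> null_sets \<nu>2"
    then have A: "A \<in> sets X" and "emeasure \<nu>2 A = 0" by (auto simp: sets_inv[OF \<nu>2] null_sets_def)
    then have "AE c in projected \<nu>2. emeasure (proj_section c) A = 0" using emeasure_eq_0_iff_sections[OF \<nu>2 A] by simp
    from absolutely_continuous_AE[OF _ * this] have "AE c in projected \<nu>1. emeasure (proj_section c) A = 0"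
      by simp
    then show "A \<in> null_sets \<nu>1" using emeasure_eq_0_iff_sections[OF \<nu>1 A] A by (simp add: null_sets_def sets_inv[OF \<nu>1])
  qed
next
  assume *: "absolutely_continuous \<nu>2 \<nu>1"
  show "absolutely_continuous (projected \<nu>2) (projected \<nu>1)"
    unfolding absolutely_continuous_def
  proof
    fix C assume "C \<in> null_sets (projected \<nu>2)"
    then have C: "C \<in> sets (PMinf X)" and "emeasure (projected \<nu>2) C = 0" by (auto simp: null_sets_def)
    then have "{x \<in> space X. proj X (component x) \<in> C} \<in> null_sets \<nu>2"
      using emeasure_projected_eq_0[OF \<nu>2 C] by (simp add: null_sets_def sets_inv[OF \<nu>2])
    then have "{x \<in> space X. proj X (component x) \<in> C} \<in> null_sets \<nu>1"
      using * by (auto simp: absolutely_continuous_def)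
    then show "C \<in> null_sets (projected \<nu>1)"
      using emeasure_projected_eq_0(2)[OF \<nu>1 C] C by (simp add: null_sets_def)
  qed
qed

text \<open>A separating set of projective points pulls back along the component map. Conversely, a
  separating set \<open>A\<close> in \<open>X\<close> yields the classes that charge
  \<open>A\<close>, because almost every class charges at most one of \<open>A\<close> and its
  complement for the respective measure.\<close>

theorem mutually_singular_projected_iff:
  assumes \<nu>1: "integrable_invariant \<nu>1" and \<nu>2: "integrable_invariant \<nu>2"
  shows "mutually_singular (projected \<nu>1) (projected \<nu>2) \<longleftrightarrow> mutually_singular \<nu>1 \<nu>2"
proof
  assume "mutually_singular (projected \<nu>1) (projected \<nu>2)"
  then obtain C where C: "C \<in> sets (PMinf X)" "emeasure (projected \<nu>1) C = 0" "emeasure (projected \<nu>2) (space (PMinf X) - C) = 0"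
    by (auto simp: mutually_singular_def)
  define S where "S = {x \<in> space X. proj X (component x) \<in> C}"
  have S: "S \<in> sets X" "emeasure \<nu>1 S = 0"
    using C(2) emeasure_projected_eq_0[OF \<nu>1 C(1)] by (auto simp: S_def)
  have C': "space (PMinf X) - C \<in> sets (PMinf X)" using C(1) by (rule sets.compl_sets)
  have "{x \<in> space X. proj X (component x) \<in> space (PMinf X) - C} = space X - S"
    using proj_in_space[OF component_in_Minf] by (auto simp: S_def)
  then have "emeasure \<nu>2 (space X - S) = 0"
    using C(3) emeasure_projected_eq_0(2)[OF \<nu>2 C'] by simp
  then show "mutually_singular \<nu>1 \<nu>2"
    unfolding mutually_singular_def using S by (intro bexI[of _ S]) (simp_all add: sets_inv[OF \<nu>1] space_inv[OF \<nu>1])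
next
  assume "mutually_singular \<nu>1 \<nu>2"
  then obtain A where A[measurable]: "A \<in> sets X" and A0: "emeasure \<nu>1 A = 0" "emeasure \<nu>2 (space X - A) = 0"
    by (auto simp: mutually_singular_def sets_inv[OF \<nu>1] space_inv[OF \<nu>1])
  define C where "C = {c \<in> space (PMinf X). emeasure (proj_section c) A \<noteq> 0}"
  have C: "C \<in> sets (PMinf X)" unfolding C_def by measurable
  have "AE c in projected \<nu>1. emeasure (proj_section c) A = 0" using A0(1) emeasure_eq_0_iff_sections[OF \<nu>1 A] by simp
  then have "AE c in projected \<nu>1. \<not> c \<in> C" by eventually_elim (simp add: C_def)
  then have 1: "emeasure (projected \<nu>1) C = 0"
    using C sets.sets_into_space[OF C] by (subst (asm) AE_iff_measurable[of C]) auto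
  have "AE c in projected \<nu>2. emeasure (proj_section c) (space X - A) = 0"
    using A0(2) emeasure_eq_0_iff_sections[OF \<nu>2, of "space X - A"] by simp
  then have "AE c in projected \<nu>2. \<not> c \<in> space (PMinf X) - C"
    using AE_space
  proof eventually_elim
    case (elim c)
    then have m: "proj_section c \<in> space (Minf X)" by (intro proj_section_in_Minf) simp
    \<comment> \<open>The section takes values in nonzero measures, so a measure that vanishes on
      the complement of \<open>A\<close> must charge \<open>A\<close>.\<close>
    have "emeasure (proj_section c) (space X) \<le> emeasure (proj_section c) A + emeasure (proj_section c) (space X - A)"
      using emeasure_subadditive[of A "proj_section c" "space X - A"] sets.sets_into_space[OF A]
      by (simp add: sets_of_Minf[OF m] Un_absorb1)
    then have "emeasure (proj_section c) A \<noteq> 0" using elim m by (auto simp: space_Minf)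
    then show ?case using elim by (simp add: C_def)
  qed
  then have 2: "emeasure (projected \<nu>2) (space (PMinf X) - C) = 0"
    using sets.compl_sets[OF C] by (subst (asm) AE_iff_measurable[of "space (PMinf X) - C"]) auto
  show "mutually_singular (projected \<nu>1) (projected \<nu>2)"
    unfolding mutually_singular_def using C 1 2 by (intro bexI[of _ C]) simp_all
qed

lemma integrable_invariantI:
  assumes "\<nu> \<in> sigma_finite_measures X" "invariant_measure G X T \<nu>" "integrable \<nu> f"
  shows "integrable_invariant \<nu>"
proof -
  have "space \<nu> = space X" using assms(1) by (intro sets_eq_imp_space_eq) (simp add: sigma_finite_measures_def)
  then have "(\<integral>\<^sup>+x. fe x \<partial>\<nu>) = ennreal (\<integral>x. f x \<partial>\<nu>)"
    using f_pos assms(3) by (intro nn_integral_eq_integral AE_I2) (auto intro: less_imp_le)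
  then show ?thesis using assms by (simp add: integrable_invariant_def)
qed

end

theorem theorem2:
  fixes G :: "('g, 'b) monoid_scheme"
    and K :: "nat \<Rightarrow> 'g topology"
    and X :: "'x measure"
    and T :: "'g \<Rightarrow> 'x \<Rightarrow> 'x"
  assumes "inductively_compact_group G K"
    and "standard_Borel_space X"
    and "measurable_action G K X T"
  shows "\<exists>PCL :: 'x measure \<Rightarrow> 'x measure set measure set.
    (\<forall>\<nu>\<in>integrable_invariant_measures G K X T.
       PCL \<nu> \<in> measure_classes (PMinf X) \<and>
       (\<forall>\<mu>\<in>PCL \<nu>. space (PMinf X) - PMinf_erg G X T \<in> null_sets (completion \<mu>)) \<and>
       (\<forall>N. ergodic_decomposition G X T \<nu> N \<and> admissible X N \<longrightarrow>
            distr N (PMinf X) (proj X) \<in> PCL \<nu>) \<and>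
       (\<forall>\<mu>\<in>PCL \<nu>. \<exists>!N. N \<in> sigma_finite_measures (Minf X) \<and> admissible X N \<and>
            distr N (PMinf X) (proj X) = \<mu> \<and> is_measure_integral X \<nu> N)) \<and>
    (\<forall>\<nu>1\<in>integrable_invariant_measures G K X T.
     \<forall>\<nu>2\<in>integrable_invariant_measures G K X T.
       (absolutely_continuous \<nu>2 \<nu>1 \<longleftrightarrow> class_absolutely_continuous (PCL \<nu>1) (PCL \<nu>2)) \<and>
       (mutually_singular \<nu>1 \<nu>2 \<longleftrightarrow> class_mutually_singular (PCL \<nu>1) (PCL \<nu>2)) \<and>
       (PCL \<nu>1 = PCL \<nu>2 \<longleftrightarrow> measure_class \<nu>1 = measure_class \<nu>2))"
\<comment> \<open>The witness is one function of \<nu>, fixed before any weight is chosen; the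
  weight depends on \<nu>.\<close>
proof (intro exI[of _ "projected_class G X T"] conjI)
  obtain code decode where code: "coded_space X code decode"
    using standard_Borel_space_coded[OF assms(2)] by blast
  have action: "weighted_action G K X code decode T f"
    if "fibrewise_continuous K X T f" "\<forall>x\<in>space X. f x > 0" for f
    using that assms code
    by (simp add: weighted_action_def weighted_action_axioms_def coded_action_def coded_action_axioms_def)
  show "\<forall>\<nu>\<in>integrable_invariant_measures G K X T.
       projected_class G X T \<nu> \<in> measure_classes (PMinf X) \<and>
       (\<forall>\<mu>\<in>projected_class G X T \<nu>. space (PMinf X) - PMinf_erg G X T \<in> null_sets (completion \<mu>)) \<and>
       (\<forall>N. ergodic_decomposition G X T \<nu> N \<and> admissible X N \<longrightarrow>
            distr N (PMinf X) (proj X) \<in> projected_class G X T \<nu>) \<and>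
       (\<forall>\<mu>\<in>projected_class G X T \<nu>. \<exists>!N. N \<in> sigma_finite_measures (Minf X) \<and> admissible X N \<and>
            distr N (PMinf X) (proj X) = \<mu> \<and> is_measure_integral X \<nu> N)"
  proof
    fix \<nu> assume "\<nu> \<in> integrable_invariant_measures G K X T"
    then obtain f where f: "fibrewise_continuous K X T f" "\<forall>x\<in>space X. f x > 0" "integrable \<nu> f"
      and inv: "\<nu> \<in> sigma_finite_measures X" "invariant_measure G X T \<nu>"
      by (auto simp: integrable_invariant_measures_def has_positive_fibrewise_continuous_integrable_def)
    interpret weighted_action G K X code decode T f by (rule action[OF f(1,2)])
    have \<nu>: "integrable_invariant \<nu>" by (rule integrable_invariantI[OF inv f(3)])
    have "projected \<nu> \<in> sigma_finite_measures (PMinf X)"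
      using sigma_finite_projected[OF \<nu>] by (simp add: sigma_finite_measures_def)
    then have "measure_class (projected \<nu>) \<in> measure_classes (PMinf X)"
      by (simp add: measure_classes_def)
    then show "projected_class G X T \<nu> \<in> measure_classes (PMinf X) \<and>
       (\<forall>\<mu>\<in>projected_class G X T \<nu>. space (PMinf X) - PMinf_erg G X T \<in> null_sets (completion \<mu>)) \<and>
       (\<forall>N. ergodic_decomposition G X T \<nu> N \<and> admissible X N \<longrightarrow>
            distr N (PMinf X) (proj X) \<in> projected_class G X T \<nu>) \<and>
       (\<forall>\<mu>\<in>projected_class G X T \<nu>. \<exists>!N. N \<in> sigma_finite_measures (Minf X) \<and> admissible X N \<and>
            distr N (PMinf X) (proj X) = \<mu> \<and> is_measure_integral X \<nu> N)"
      unfolding projected_class_eq[OF \<nu>]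
      using complement_PMinf_erg_null[OF \<nu>] distr_proj_in_class[OF \<nu>] lift_unique[OF \<nu>] by blast
  qed
  show "\<forall>\<nu>1\<in>integrable_invariant_measures G K X T.
     \<forall>\<nu>2\<in>integrable_invariant_measures G K X T.
       (absolutely_continuous \<nu>2 \<nu>1 \<longleftrightarrow> class_absolutely_continuous (projected_class G X T \<nu>1) (projected_class G X T \<nu>2)) \<and>
       (mutually_singular \<nu>1 \<nu>2 \<longleftrightarrow> class_mutually_singular (projected_class G X T \<nu>1) (projected_class G X T \<nu>2)) \<and>
       (projected_class G X T \<nu>1 = projected_class G X T \<nu>2 \<longleftrightarrow> measure_class \<nu>1 = measure_class \<nu>2)"
  proof (intro ballI)
    fix \<nu>1 \<nu>2
    assume "\<nu>1 \<in> integrable_invariant_measures G K X T" "\<nu>2 \<in> integrable_invariant_measures G K X T"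
    then obtain f1 f2 where f1: "fibrewise_continuous K X T f1" "\<forall>x\<in>space X. f1 x > 0" "integrable \<nu>1 f1"
      and f2: "fibrewise_continuous K X T f2" "\<forall>x\<in>space X. f2 x > 0" "integrable \<nu>2 f2"
      and inv: "\<nu>1 \<in> sigma_finite_measures X" "invariant_measure G X T \<nu>1"
        "\<nu>2 \<in> sigma_finite_measures X" "invariant_measure G X T \<nu>2"
      by (auto simp: integrable_invariant_measures_def has_positive_fibrewise_continuous_integrable_def)
    \<comment> \<open>The minimum is still positive and fibrewise continuous, and both measures
      integrate it. One weight means one component map and one section for both measures, as the
      comparison requires.\<close>
    define f where "f = (\<lambda>x. min (f1 x) (f2 x))"
    have "fibrewise_continuous K X T f"
      using f1(1) f2(1) by (auto simp: fibrewise_continuous_def f_def intro!: continuous_map_real_min)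
    moreover have pos: "\<forall>x\<in>space X. f x > 0" using f1(2) f2(2) by (simp add: f_def)
    ultimately interpret weighted_action G K X code decode T f by (rule action)
    have sets: "sets \<nu>1 = sets X" "sets \<nu>2 = sets X" using inv by (auto simp: sigma_finite_measures_def)
    have sf: "sigma_finite_measure \<nu>1" "sigma_finite_measure \<nu>2" using inv by (auto simp: sigma_finite_measures_def)
    have m: "f \<in> borel_measurable X"
      using f1(1) f2(1) unfolding f_def fibrewise_continuous_def by (intro borel_measurable_min) auto
    have bound: "norm (f x) \<le> norm (f1 x)" "norm (f x) \<le> norm (f2 x)" if "x \<in> space X" for x
      using bspec[OF f1(2) that] bspec[OF f2(2) that] by (simp_all add: f_def)
    have "integrable \<nu>1 f"
      by (rule Bochner_Integration.integrable_bound[OF f1(3)])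
        (use m bound in \<open>auto intro!: AE_I2 simp: measurable_cong_sets[OF sets(1) refl] sets_eq_imp_space_eq[OF sets(1)]\<close>)
    then have \<nu>1: "integrable_invariant \<nu>1" by (rule integrable_invariantI[OF inv(1,2)])
    have "integrable \<nu>2 f"
      by (rule Bochner_Integration.integrable_bound[OF f2(3)])
        (use m bound in \<open>auto intro!: AE_I2 simp: measurable_cong_sets[OF sets(2) refl] sets_eq_imp_space_eq[OF sets(2)]\<close>)
    then have \<nu>2: "integrable_invariant \<nu>2" by (rule integrable_invariantI[OF inv(3,4)])
    note s = sigma_finite_projected[OF \<nu>1] sigma_finite_projected[OF \<nu>2]
    have se: "sets (projected \<nu>1) = sets (projected \<nu>2)" "sets \<nu>1 = sets \<nu>2" by (simp_all add: sets)
    show "(absolutely_continuous \<nu>2 \<nu>1 \<longleftrightarrow> class_absolutely_continuous (projected_class G X T \<nu>1) (projected_class G X T \<nu>2)) \<and>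
       (mutually_singular \<nu>1 \<nu>2 \<longleftrightarrow> class_mutually_singular (projected_class G X T \<nu>1) (projected_class G X T \<nu>2)) \<and>
       (projected_class G X T \<nu>1 = projected_class G X T \<nu>2 \<longleftrightarrow> measure_class \<nu>1 = measure_class \<nu>2)"
      unfolding projected_class_eq[OF \<nu>1] projected_class_eq[OF \<nu>2]
        class_absolutely_continuous_iff[OF s] class_mutually_singular_iff[OF s se(1)]
        measure_class_eq_iff[OF s se(1)] measure_class_eq_iff[OF sf se(2)]
        absolutely_continuous_projected_iff[OF \<nu>1 \<nu>2] absolutely_continuous_projected_iff[OF \<nu>2 \<nu>1]
        mutually_singular_projected_iff[OF \<nu>1 \<nu>2]
      by blast
  qed
qed

end
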